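(* For every integer $n \ge 2$ define the integer $k_n$ by $$\left\lfloor \frac{1}{\zeta(n)-1} \right\rfloor=2^n-\left\lfloor \left( \frac{4}{3} \right)^n \right\rfloor-k_n.$$ Then $k_n\in\{1,2\}$ for all $n\ge 2$, and $k_n=1$ for only finitely many $n$ (so $k_n=2$ for all but finitely many $n\ge 2$).
   Context: $\zeta(s)=\sum_{m=1}^{\infty} m^{-s}$ is the Riemann zeta function (for real $s>1$), and $\lfloor x\rfloor$ is the greatest integer not exceeding $x$. *)

theory Defs
  imports Complex_Main
begin

text \<open>The series converges only for \<open>s > 1\<close>; for \<open>s \<le> 1\<close> the value is an unspecified
  default of the operator \<^const>\<open>suminf\<close> and carries no meaning.
  The summation index is shifted by one.\<close>

definition riemann_zeta :: "real \<Rightarrow> real" where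
  "riemann_zeta s = (\<Sum>m. real (Suc m) powr (- s))"

end

theory Submission
  imports Defs "HOL-Library.Poly_Mapping" "HOL-Library.FuncSet" "HOL-Real_Asymp.Real_Asymp"
    "Jordan_Normal_Form.Determinant"
begin

text \<open>Writing \<open>\<zeta>(n) - 1 = 2\<^sup>-\<^sup>n (1 + x)\<close>, one finds \<open>1 / (\<zeta>(n) - 1) = 2^n - 1 - (4/3)^n + \<delta>\<close>
  with \<open>0 \<le> \<delta> < 1\<close> and \<open>\<delta> = O((8/9)^n)\<close>. Hence \<open>k n \<in> {1, 2}\<close>, and \<open>k n = 1\<close> forces the fractional
  part of \<open>(4/3)^n\<close> to be at most \<open>\<delta>\<close>. That this happens only finitely often is a theorem of Mahler,
  the case of Ridout's theorem in which the points approximated are the rational points \<open>1\<close> (at the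
  real place), \<open>0\<close> (at 2) and \<open>\<infinity>\<close> (at 3), and it is proved by Roth's method. By the pigeonhole
  principle there is an integral polynomial in many variables that vanishes to high order at
  \<open>(1, \<dots>, 1)\<close> and whose monomials have nearly average weight; the latter is the vanishing
  condition at \<open>0\<close> and \<open>\<infinity>\<close>. By Roth's lemma some derivative of low order does not vanish at the point
  whose coordinates are the approximations \<open>4^n / (y 3^n)\<close>, for rapidly increasing exponents \<open>n\<close>. After clearing
  denominators its value is a nonzero integer divisible by large powers of 4 and 3, but its size
  is too small for that.\<close>

text \<open>The contradiction comes from comparing exponents. With m = 4 N^2 variables and S0 = (1 -
  1/N) m D / 2, the nonzero value is divisible by a^(S0 - D) b^S0 and is at most 32^(sum of the d h)
  a^(m D - S0) (\<rho> b)^S0. The powers of b cancel. Those of a fail to cancel by only (4 N + 1) D,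
  because S0 is nearly half of m D, whereas \<rho>^S0 saves about 2 N^2 D factors \<rho>. So every
  \<rho> < 1 is allowed once N is large, and the rate 8/9 of \<delta> is good enough. Two obstacles
  shape the rest. The fraction 4^n / (y 3^n) need not be in lowest terms; but a common divisor also
  divides 4^n - y 3^n, so it is too small to spoil the height. And in several variables a bound on
  the degree does not by itself bound the order of vanishing. Roth's lemma therefore separates the
  last variable by means of a determinant of derivatives that factors, and this is where the
  exponents must grow rapidly. The required growth depends on N, so infinitely many exceptional n
  are assumed and the finiteness comes without a bound.\<close>

abbreviation lookup :: "('a \<Rightarrow>\<^sub>0 'b::zero) \<Rightarrow> 'a \<Rightarrow> 'b" where "lookup \<equiv> Poly_Mapping.lookup"
abbreviation keys :: "('a \<Rightarrow>\<^sub>0 'b::zero) \<Rightarrow> 'a set" where "keys \<equiv> Poly_Mapping.keys"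
abbreviation single :: "'a \<Rightarrow> 'b \<Rightarrow> ('a \<Rightarrow>\<^sub>0 'b::zero)" where "single \<equiv> Poly_Mapping.single"

type_synonym monom = "nat \<Rightarrow>\<^sub>0 nat"
type_synonym mpoly = "monom \<Rightarrow>\<^sub>0 real"

section \<open>Polynomials in several variables\<close>

lemma lookup_const_mult [simp]: "lookup (single 0 c * P) e = c * lookup P e"
  for P :: mpoly
proof -
  have "lookup (Poly_Mapping.map ((*) c) P) e = c * lookup P e"
    by (transfer) (auto simp: when_def)
  then show ?thesis by (simp add: mult_map_scale_conv_mult)
qed

lemma mpoly_expand: "P = (\<Sum>e\<in>keys P. single e (lookup P e))" for P :: mpoly
proof (rule poly_mapping_eqI)
  fix k
  have "lookup (\<Sum>e\<in>keys P. single e (lookup P e)) k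
      = (\<Sum>e\<in>keys P. if e = k then lookup P e else 0)"
    by (simp add: lookup_sum lookup_single when_def)
  also have "\<dots> = lookup P k"
    by (auto simp: sum.delta in_keys_iff)
  finally show "lookup P k = lookup (\<Sum>e\<in>keys P. single e (lookup P e)) k" by simp
qed

lemma mpoly_mult_expand:
  "P * Q = (\<Sum>e\<in>keys P. \<Sum>f\<in>keys Q. single (e + f) (lookup P e * lookup Q f))" for P Q :: mpoly
proof -
  have "P * Q = (\<Sum>e\<in>keys P. single e (lookup P e)) * (\<Sum>f\<in>keys Q. single f (lookup Q f))"
    using mpoly_expand[of P] mpoly_expand[of Q] by simp
  then show ?thesis by (simp add: sum_product mult_single)
qed

text \<open>If only one pair of monomials multiplies to the given one, the convolution collapses to
  a single term. This serves both for factors in disjoint variables and for lowest terms.\<close>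

lemma lookup_mult_unique:
  fixes P Q :: mpoly
  assumes "\<And>e' f'. e' \<in> keys P \<Longrightarrow> f' \<in> keys Q \<Longrightarrow> e' + f' = e + f \<Longrightarrow> e' = e \<and> f' = f"
  shows "lookup (P * Q) (e + f) = lookup P e * lookup Q f"
proof -
  have "lookup (P * Q) (e + f)
      = (\<Sum>e'\<in>keys P. \<Sum>f'\<in>keys Q. if e' + f' = e + f then lookup P e' * lookup Q f' else 0)"
    by (subst mpoly_mult_expand) (simp add: lookup_sum lookup_single when_def)
  also have "\<dots> = (\<Sum>e'\<in>keys P. \<Sum>f'\<in>keys Q. if e' = e then (if f' = f then lookup P e * lookup Q f else 0) else 0)"
    by (intro sum.cong refl) (use assms in auto)
  also have "\<dots> = (\<Sum>e'\<in>keys P. if e' = e then (\<Sum>f'\<in>keys Q. (if f' = f then lookup P e * lookup Q f else 0)) else 0)"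
    by (intro sum.cong refl) auto
  also have "\<dots> = lookup P e * lookup Q f"
    by (simp add: sum.delta in_keys_iff)
  finally show ?thesis .
qed

text \<open>Translations are defined on monomials and extended linearly; by \<open>lin_mult\<close>,
  multiplicativity on monomials is enough for multiplicativity on all polynomials.\<close>

definition lin :: "(monom \<Rightarrow> mpoly) \<Rightarrow> mpoly \<Rightarrow> mpoly" where
  "lin g P = (\<Sum>e\<in>keys P. single 0 (lookup P e) * g e)"

lemma lookup_lin: "lookup (lin g P) j = (\<Sum>e\<in>keys P. lookup P e * lookup (g e) j)"
  by (simp add: lin_def lookup_sum)

lemma lookup_lin_superset:
  assumes "finite S" "keys P \<subseteq> S"
  shows "lookup (lin g P) j = (\<Sum>e\<in>S. lookup P e * lookup (g e) j)"
  unfolding lookup_lin by (rule sum.mono_neutral_left) (use assms in \<open>auto simp: in_keys_iff\<close>)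

lemma lin_add: "lin g (P + Q) = lin g P + lin g Q"
proof (rule poly_mapping_eqI)
  fix j
  let ?S = "keys P \<union> keys Q"
  have "keys (P + Q) \<subseteq> ?S" by (rule keys_add)
  then show "lookup (lin g (P + Q)) j = lookup (lin g P + lin g Q) j"
    by (simp add: lookup_add lookup_lin_superset[of ?S] algebra_simps sum.distrib)
qed

lemma lin_zero [simp]: "lin g 0 = 0"
  by (simp add: lin_def)

lemma lin_sum: "lin g (sum f A) = (\<Sum>a\<in>A. lin g (f a))"
  by (induction A rule: infinite_finite_induct) (auto simp: lin_add)

lemma lin_single: "lin g (single e c) = single 0 c * g e"
  by (rule poly_mapping_eqI) (simp add: lookup_lin_superset[of "{e}"])

lemma lin_mult:
  assumes "\<And>e f. g (e + f) = g e * g f"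
  shows "lin g (P * Q) = lin g P * lin g Q"
proof -
  have c: "single 0 (a * b) = single 0 a * (single 0 b :: mpoly)" for a b
    by (simp add: mult_single)
  have "lin g (P * Q)
      = (\<Sum>e\<in>keys P. \<Sum>f\<in>keys Q. single 0 (lookup P e * lookup Q f) * g (e + f))"
    by (subst mpoly_mult_expand) (simp add: lin_sum lin_single)
  also have "\<dots> = lin g P * lin g Q"
    unfolding lin_def sum_product assms c by (intro sum.cong refl) (simp add: mult_ac)
  finally show ?thesis .
qed

subsection \<open>The sum of the absolute values of the coefficients\<close>

text \<open>This height is submultiplicative, so products, determinants and substitutions are
  bounded without counting monomials, and it still dominates every single coefficient.\<close>

definition l1 :: "mpoly \<Rightarrow> real" where
  "l1 P = (\<Sum>e\<in>keys P. \<bar>lookup P e\<bar>)"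

lemma l1_superset:
  assumes "finite S" "keys P \<subseteq> S"
  shows "l1 P = (\<Sum>e\<in>S. \<bar>lookup P e\<bar>)"
  unfolding l1_def by (rule sum.mono_neutral_left) (use assms in \<open>auto simp: in_keys_iff\<close>)

lemma l1_nonneg [simp]: "0 \<le> l1 P"
  by (auto simp: l1_def intro: sum_nonneg)

lemma l1_add: "l1 (P + Q) \<le> l1 P + l1 Q"
proof -
  let ?S = "keys P \<union> keys Q"
  have "keys (P + Q) \<subseteq> ?S" by (rule keys_add)
  then have "l1 (P + Q) = (\<Sum>e\<in>?S. \<bar>lookup P e + lookup Q e\<bar>)"
    by (subst l1_superset[of ?S]) (auto simp: lookup_add)
  also have "\<dots> \<le> (\<Sum>e\<in>?S. \<bar>lookup P e\<bar> + \<bar>lookup Q e\<bar>)"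
    by (intro sum_mono) auto
  also have "\<dots> = l1 P + l1 Q"
    by (simp add: sum.distrib l1_superset[of ?S])
  finally show ?thesis .
qed

lemma l1_zero [simp]: "l1 0 = 0"
  by (simp add: l1_def)

lemma l1_sum: "l1 (sum f A) \<le> (\<Sum>a\<in>A. l1 (f a))"
  by (induction A rule: infinite_finite_induct) (auto intro: order.trans[OF l1_add])

lemma l1_single [simp]: "l1 (single e c) = \<bar>c\<bar>"
  by (subst l1_superset[of "{e}"]) auto

lemma l1_one [simp]: "l1 1 = 1"
  using l1_single[of 0 1] by (simp del: l1_single)

lemma l1_mult: "l1 (P * Q) \<le> l1 P * l1 Q"
proof -
  have "l1 (P * Q) \<le> (\<Sum>e\<in>keys P. \<Sum>f\<in>keys Q. \<bar>lookup P e * lookup Q f\<bar>)"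
    by (subst mpoly_mult_expand) (intro order.trans[OF l1_sum] sum_mono, simp)
  also have "\<dots> = l1 P * l1 Q"
    by (simp add: l1_def sum_product abs_mult)
  finally show ?thesis .
qed

lemma l1_prod: "l1 (prod f A) \<le> (\<Prod>a\<in>A. l1 (f a))"
proof (induction A rule: infinite_finite_induct)
  case (insert x F)
  then show ?case
    by simp (intro order.trans[OF l1_mult] mult_left_mono, auto)
qed auto

lemma l1_uminus [simp]: "l1 (- P) = l1 P"
  by (simp add: l1_def)

lemma abs_lookup_le_l1: "\<bar>lookup P e\<bar> \<le> l1 P"
proof (cases "e \<in> keys P")
  case True
  then show ?thesis unfolding l1_def by (intro member_le_sum) auto
qed (simp add: in_keys_iff)

subsection \<open>Integral coefficients\<close>

text \<open>Integrality is a predicate on real polynomials, since the factors of a Wronskian are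
  only real and must live in the same ring as the integral polynomials.\<close>

definition int_coeffs :: "mpoly \<Rightarrow> bool" where
  "int_coeffs P \<longleftrightarrow> (\<forall>e. lookup P e \<in> \<int>)"

lemma int_coeffs_uminus: "int_coeffs P \<Longrightarrow> int_coeffs (- P)"
  by (auto simp: int_coeffs_def)

lemma int_coeffs_sum: "(\<And>a. a \<in> A \<Longrightarrow> int_coeffs (f a)) \<Longrightarrow> int_coeffs (sum f A)"
  by (auto simp: int_coeffs_def lookup_sum intro: Ints_sum)

lemma int_coeffs_single: "c \<in> \<int> \<Longrightarrow> int_coeffs (single e c)"
  by (auto simp: int_coeffs_def lookup_single when_def)

lemma int_coeffs_mult: "int_coeffs P \<Longrightarrow> int_coeffs Q \<Longrightarrow> int_coeffs (P * Q)"
  by (subst mpoly_mult_expand) (intro int_coeffs_sum int_coeffs_single, auto simp: int_coeffs_def)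

lemma int_coeffs_prod: "(\<And>a. a \<in> A \<Longrightarrow> int_coeffs (f a)) \<Longrightarrow> int_coeffs (prod f A)"
proof (induction A rule: infinite_finite_induct)
  case (insert x F)
  then show ?case by (simp add: int_coeffs_mult)
qed (auto simp flip: single_one intro: int_coeffs_single)

lemma abs_coeff_ge_1: "int_coeffs P \<Longrightarrow> e \<in> keys P \<Longrightarrow> 1 \<le> \<bar>lookup P e\<bar>"
  by (auto simp: int_coeffs_def in_keys_iff Ints_nonzero_abs_ge1)

subsection \<open>Hasse derivatives\<close>

text \<open>It vanishes unless \<open>d\<close> is at most \<open>e\<close> in every variable, which
  makes the truncated difference \<open>e - d\<close> harmless wherever it is multiplied by
  \<open>mbinom e d\<close>.\<close>

definition mbinom :: "monom \<Rightarrow> monom \<Rightarrow> nat" where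
  "mbinom e d = (\<Prod>h\<in>keys d. lookup e h choose lookup d h)"

lemma mbinom_superset:
  assumes "finite S" "keys d \<subseteq> S"
  shows "mbinom e d = (\<Prod>h\<in>S. lookup e h choose lookup d h)"
  unfolding mbinom_def by (rule prod.mono_neutral_left) (use assms in \<open>auto simp: in_keys_iff\<close>)

text \<open>The composition law of Hasse derivatives, on the level of coefficients.\<close>

lemma mbinom_trans: "mbinom (j + d) d * mbinom e (j + d) = mbinom e d * mbinom (e - d) j"
proof -
  let ?S = "keys j \<union> keys d"
  have k: "keys (j + d) \<subseteq> ?S" by (rule keys_add)
  have *: "((b + a) choose b) * (n choose (b + a)) = (n choose b) * ((n - b) choose a)" for a b n :: nat
  proof (cases "b + a \<le> n")
    case True
    then show ?thesis using choose_mult[of b "b + a" n] by (simp add: mult_ac)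
  next
    case False
    then show ?thesis by (auto simp: binomial_eq_0)
  qed
  have "mbinom (j + d) d * mbinom e (j + d)
      = (\<Prod>h\<in>?S. ((lookup j h + lookup d h) choose lookup d h) * (lookup e h choose (lookup j h + lookup d h)))"
    by (simp add: mbinom_superset[of ?S] k lookup_add flip: prod.distrib)
  also have "\<dots> = (\<Prod>h\<in>?S. (lookup e h choose lookup d h) * ((lookup e h - lookup d h) choose lookup j h))"
    by (intro prod.cong refl) (metis * add.commute)
  also have "\<dots> = mbinom e d * mbinom (e - d) j"
    by (simp add: mbinom_superset[of ?S] lookup_minus flip: prod.distrib)
  finally show ?thesis .
qed

text \<open>The partial derivative divided by the factorials of the orders. The division keeps the
  coefficients integral and lets the norm grow only by a power of 2.\<close>

lift_definition hasse :: "monom \<Rightarrow> mpoly \<Rightarrow> mpoly" is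
  "\<lambda>d P e. real (mbinom (e + d) d) * P (e + d)"
proof -
  fix d :: monom and P :: "monom \<Rightarrow> real"
  assume "finite {e. P e \<noteq> 0}"
  then have "finite ((\<lambda>e. e + d) -` {e. P e \<noteq> 0})"
    by (rule finite_vimageI) (auto intro: injI)
  then show "finite {e. real (mbinom (e + d) d) * P (e + d) \<noteq> 0}"
    by (rule rev_finite_subset) auto
qed

lemma lookup_hasse: "lookup (hasse d P) e = real (mbinom (e + d) d) * lookup P (e + d)"
  by transfer simp

lemma keys_hasse: "e \<in> keys (hasse d P) \<Longrightarrow> e + d \<in> keys P"
  by (auto simp: in_keys_iff lookup_hasse)

lemma hasse_add: "hasse d (P + Q) = hasse d P + hasse d Q"
  by (rule poly_mapping_eqI) (simp add: lookup_hasse lookup_add algebra_simps)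

lemma hasse_zero [simp]: "hasse d 0 = 0"
  by (rule poly_mapping_eqI) (simp add: lookup_hasse)

lemma hasse_sum: "hasse d (sum f A) = (\<Sum>a\<in>A. hasse d (f a))"
  by (induction A rule: infinite_finite_induct) (auto simp: hasse_add)

lemma int_coeffs_hasse: "int_coeffs P \<Longrightarrow> int_coeffs (hasse d P)"
  by (auto simp: int_coeffs_def lookup_hasse)

subsection \<open>Translation of the variables\<close>

text \<open>The coefficient of \<open>shift \<xi> m P\<close> at \<open>j\<close> is the value at \<open>\<xi>\<close> of the Hasse derivative \<open>hasse j P\<close>, so
  the order of vanishing of \<open>P\<close> at \<open>\<xi>\<close> can be read off from the monomials of \<open>shift \<xi> m P\<close>.\<close>

definition mpow :: "(nat \<Rightarrow> real) \<Rightarrow> nat \<Rightarrow> monom \<Rightarrow> real" where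
  "mpow \<xi> m e = (\<Prod>h<m. \<xi> h ^ lookup e h)"

definition shift_monom :: "(nat \<Rightarrow> real) \<Rightarrow> nat \<Rightarrow> monom \<Rightarrow> mpoly" where
  "shift_monom \<xi> m e = (\<Prod>h<m. (single (single h 1) 1 + single 0 (\<xi> h)) ^ lookup e h)"

definition shift :: "(nat \<Rightarrow> real) \<Rightarrow> nat \<Rightarrow> mpoly \<Rightarrow> mpoly" where
  "shift \<xi> m P = lin (shift_monom \<xi> m) P"

definition vars_in :: "nat set \<Rightarrow> mpoly \<Rightarrow> bool" where
  "vars_in A P \<longleftrightarrow> (\<forall>e\<in>keys P. keys e \<subseteq> A)"

lemma shift_monom_add: "shift_monom \<xi> m (e + f) = shift_monom \<xi> m e * shift_monom \<xi> m f"
  by (simp add: shift_monom_def lookup_add power_add prod.distrib)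

lemma shift_add: "shift \<xi> m (P + Q) = shift \<xi> m P + shift \<xi> m Q"
  by (simp add: shift_def lin_add)

lemma shift_zero [simp]: "shift \<xi> m 0 = 0"
  by (simp add: shift_def)

lemma shift_sum: "shift \<xi> m (sum f A) = (\<Sum>a\<in>A. shift \<xi> m (f a))"
  by (simp add: shift_def lin_sum)

lemma shift_mult: "shift \<xi> m (P * Q) = shift \<xi> m P * shift \<xi> m Q"
  unfolding shift_def by (rule lin_mult) (rule shift_monom_add)

lemma shift_const [simp]: "shift \<xi> m (single 0 c) = single 0 c"
  by (simp add: shift_def lin_single shift_monom_def)

lemma shift_one [simp]: "shift \<xi> m 1 = 1"
  using shift_const[of \<xi> m 1] by (simp del: shift_const)

lemma shift_uminus: "shift \<xi> m (- P) = - shift \<xi> m P"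
  using shift_add[of \<xi> m P "- P"] by (simp add: eq_neg_iff_add_eq_0 add.commute)

lemma shift_prod: "shift \<xi> m (prod f A) = (\<Prod>a\<in>A. shift \<xi> m (f a))"
  by (induction A rule: infinite_finite_induct) (auto simp: shift_mult)

lemma shift_power: "shift \<xi> m (P ^ k) = shift \<xi> m P ^ k"
  by (induction k) (auto simp: shift_mult)

lemma shift_var: "h < m \<Longrightarrow> shift \<xi> m (single (single h 1) 1) = single (single h 1) 1 + single 0 (\<xi> h)"
proof -
  assume "h < m"
  have "shift_monom \<xi> m (single h 1)
      = (\<Prod>i<m. if i = h then single (single h 1) 1 + single 0 (\<xi> h) else 1)"
    unfolding shift_monom_def by (intro prod.cong refl) (auto simp: lookup_single when_def)
  also have "\<dots> = single (single h 1) 1 + single 0 (\<xi> h)"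
    using \<open>h < m\<close> by (simp add: prod.delta)
  finally show ?thesis by (simp add: shift_def lin_single)
qed

lemma shift_monom_zero:
  assumes "keys e \<subseteq> {..<m}"
  shows "shift_monom (\<lambda>_. 0) m e = single e 1"
proof -
  have pw: "(single (single h 1) 1 :: mpoly) ^ k = single (single h k) 1" for h k
  proof (induction k)
    case (Suc k)
    then show ?case by (simp add: mult_single flip: single_add)
  qed simp
  have "(\<Prod>h<k. (single (single h (lookup e h)) 1 :: mpoly)) = single (\<Sum>h<k. single h (lookup e h)) 1" for k
    by (induction k) (auto simp: mult_single add.commute)
  moreover have "(\<Sum>h<m. single h (lookup e h)) = e"
    by (rule poly_mapping_eqI)
       (use assms in \<open>auto simp: lookup_sum lookup_single when_def sum.delta in_keys_iff subset_iff\<close>)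
  ultimately show ?thesis by (simp add: shift_monom_def pw[simplified])
qed

lemma shift_by_zero:
  assumes "vars_in {..<m} P"
  shows "shift (\<lambda>_. 0) m P = P"
proof -
  have "shift (\<lambda>_. 0) m P = (\<Sum>e\<in>keys P. single e (lookup P e))"
    unfolding shift_def lin_def
    by (intro sum.cong refl) (use assms in \<open>auto simp: vars_in_def shift_monom_zero mult_single\<close>)
  then show ?thesis using mpoly_expand[of P] by simp
qed

lemma shift_shift: "shift \<xi> m (shift \<eta> m P) = shift (\<lambda>h. \<eta> h + \<xi> h) m P"
proof -
  have "shift \<xi> m (shift_monom \<eta> m e) = shift_monom (\<lambda>h. \<eta> h + \<xi> h) m e" for e
    unfolding shift_monom_def shift_prod
    by (intro prod.cong refl) (simp add: shift_power shift_add shift_var[simplified] single_add add_ac)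
  then show ?thesis
    unfolding shift_def[of \<eta>] shift_def[of "\<lambda>h. \<eta> h + \<xi> h"] lin_def
    by (simp add: shift_sum shift_mult)
qed

section \<open>Splitting off one variable\<close>

lemma add_single_unique:
  fixes e e' :: monom
  assumes "m \<notin> keys e" "m \<notin> keys e'" "e + single m t = e' + single m t'"
  shows "e = e' \<and> t = t'"
proof -
  have *: "lookup e h + lookup (single m t) h = lookup e' h + lookup (single m t') h" for h
    using assms(3) by (metis lookup_add)
  have t: "t = t'" using *[of m] assms(1,2) by (simp add: in_keys_iff)
  have "e = e'"
    by (rule poly_mapping_eqI) (use * t in auto)
  with t show ?thesis by simp
qed

lemma monom_split:
  fixes j :: monom
  obtains e where "j = e + single m (lookup j m)" "keys e = keys j - {m}"
proof
  show "j = (j - single m (lookup j m)) + single m (lookup j m)"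
    by (rule poly_mapping_eqI) (auto simp: lookup_add lookup_minus lookup_single when_def)
  show "keys (j - single m (lookup j m)) = keys j - {m}"
    by (auto simp: in_keys_iff lookup_minus lookup_single when_def split: if_splits)
qed

lemma binomial_power_mpoly:
  "(single (single h 1) 1 + single 0 c) ^ N
     = (\<Sum>t\<le>N. single (single h t) (real (N choose t) * c ^ (N - t)) :: mpoly)"
proof -
  have pw: "(single (single h 1) 1 :: mpoly) ^ k = single (single h k) 1" for k
  proof (induction k)
    case (Suc k)
    then show ?case by (simp add: mult_single flip: single_add)
  qed simp
  have pc: "(single 0 c :: mpoly) ^ k = single 0 (c ^ k)" for k
    by (induction k) (auto simp: mult_single)
  have nat: "(of_nat a :: mpoly) = single 0 (real a)" for a
    by simp
  show ?thesis
    unfolding binomial_ring pw pc nat mult_single by simp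
qed

lemma keys_sum_subset: "keys (sum f A) \<subseteq> (\<Union>a\<in>A. keys (f a))"
  by (induction A rule: infinite_finite_induct) (use keys_add in fastforce)+

lemma vars_in_mult:
  assumes "vars_in A P" "vars_in B Q"
  shows "vars_in (A \<union> B) (P * Q)"
proof -
  have "keys (e + f) \<subseteq> A \<union> B" if "e \<in> keys P" "f \<in> keys Q" for e f
    using keys_add[of e f] that assms by (auto simp: vars_in_def)
  then show ?thesis
    using keys_mult[of P Q] by (fastforce simp: vars_in_def)
qed

lemma lookup_binomial_power_mpoly:
  "lookup ((single (single h 1) 1 + single 0 c) ^ N :: mpoly) (single h t)
     = real (N choose t) * c ^ (N - t)"
proof -
  have "single h x = single h t \<longleftrightarrow> x = t" for x t :: nat
    by (metis lookup_single_eq)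
  then show ?thesis
    unfolding binomial_power_mpoly
    by (simp add: lookup_sum lookup_single[of "single _ _"] when_def sum.delta binomial_eq_0)
qed

lemma vars_in_binomial_power_mpoly:
  "vars_in {h} ((single (single h 1) 1 + single 0 c) ^ N :: mpoly)"
  unfolding binomial_power_mpoly vars_in_def
  using keys_sum_subset by (fastforce split: if_splits)

lemma keys_subset_single:
  fixes f :: monom
  assumes "keys f \<subseteq> {h}"
  shows "f = single h (lookup f h)"
  by (rule poly_mapping_eqI) (use assms in \<open>auto simp: lookup_single when_def in_keys_iff subset_iff\<close>)

lemma lookup_mult_disjoint:
  fixes P Q :: mpoly
  assumes "vars_in A P" "vars_in {m} Q" "m \<notin> A" "m \<notin> keys e"
  shows "lookup (P * Q) (e + single m t) = lookup P e * lookup Q (single m t)"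
proof (rule lookup_mult_unique)
  fix e' f' assume *: "e' \<in> keys P" "f' \<in> keys Q" "e' + f' = e + single m t"
  obtain t' where f': "f' = single m t'"
    using *(2) assms(2) keys_subset_single by (fastforce simp: vars_in_def)
  moreover have "m \<notin> keys e'" using *(1) assms(1,3) by (auto simp: vars_in_def)
  ultimately show "e' = e \<and> f' = single m t"
    using * add_single_unique[of m e' e t' t] assms(4) by auto
qed

text \<open>Both facts share one induction: the coefficient formula for \<open>Suc m\<close> uses
  that the factor from the first \<open>m\<close> variables does not contain the variable
  \<open>m\<close>.\<close>

lemma shift_monom_props:
  "vars_in {..<m} (shift_monom \<xi> m e) \<and>
   (\<forall>j. keys j \<subseteq> {..<m} \<longrightarrow>
     lookup (shift_monom \<xi> m e) j
       = (\<Prod>h<m. real (lookup e h choose lookup j h) * \<xi> h ^ (lookup e h - lookup j h)))"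
proof (induction m)
  case 0
  then show ?case by (auto simp: shift_monom_def vars_in_def lookup_one when_def)
next
  case (Suc m)
  let ?B = "(single (single m 1) 1 + single 0 (\<xi> m)) ^ lookup e m :: mpoly"
  have eq: "shift_monom \<xi> (Suc m) e = shift_monom \<xi> m e * ?B"
    by (simp add: shift_monom_def)
  have v: "vars_in {m} ?B" by (rule vars_in_binomial_power_mpoly)
  have "vars_in ({..<m} \<union> {m}) (shift_monom \<xi> (Suc m) e)"
    unfolding eq by (rule vars_in_mult) (use Suc v in auto)
  then have 1: "vars_in {..<Suc m} (shift_monom \<xi> (Suc m) e)"
    by (simp add: lessThan_Suc insert_commute)
  have "lookup (shift_monom \<xi> (Suc m) e) j
       = (\<Prod>h<Suc m. real (lookup e h choose lookup j h) * \<xi> h ^ (lookup e h - lookup j h))"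
    if j: "keys j \<subseteq> {..<Suc m}" for j
  proof -
    obtain i where i: "j = i + single m (lookup j m)" "keys i = keys j - {m}"
      by (rule monom_split)
    then have ki: "keys i \<subseteq> {..<m}" using j by auto
    have li: "lookup i h = lookup j h" if "h < m" for h
      using that by (subst i(1)) (simp add: lookup_add lookup_single when_def)
    have "lookup (shift_monom \<xi> (Suc m) e) j = lookup (shift_monom \<xi> m e) i * lookup ?B (single m (lookup j m))"
      by (subst i(1), subst eq, rule lookup_mult_disjoint[of "{..<m}"])
         (use Suc v i in auto)
    also have "lookup (shift_monom \<xi> m e) i
        = (\<Prod>h<m. real (lookup e h choose lookup j h) * \<xi> h ^ (lookup e h - lookup j h))"
      using Suc ki by (simp add: li)
    finally show ?thesis by (simp only: lookup_binomial_power_mpoly prod.lessThan_Suc)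
  qed
  with 1 show ?case by blast
qed

lemma lookup_shift:
  assumes "keys j \<subseteq> {..<m}"
  shows "lookup (shift \<xi> m P) j = (\<Sum>e\<in>keys P. lookup P e * (real (mbinom e j) * mpow \<xi> m (e - j)))"
proof -
  have "lookup (shift_monom \<xi> m e) j = real (mbinom e j) * mpow \<xi> m (e - j)" for e
    using shift_monom_props[of m \<xi> e] assms
    by (simp add: mbinom_superset[of "{..<m}"] mpow_def lookup_minus prod.distrib)
  then show ?thesis by (simp add: shift_def lookup_lin)
qed

lemma vars_in_shift: "vars_in {..<m} (shift \<xi> m P)"
proof -
  have "keys j \<subseteq> {..<m}" if "lookup (shift \<xi> m P) j \<noteq> 0" for j
  proof -
    have "\<exists>e\<in>keys P. lookup (shift_monom \<xi> m e) j \<noteq> 0"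
    proof (rule ccontr)
      assume "\<not> ?thesis"
      then show False using that by (simp add: shift_def lookup_lin)
    qed
    then obtain e where "lookup (shift_monom \<xi> m e) j \<noteq> 0" by blast
    then show ?thesis
      using shift_monom_props[of m \<xi> e] by (auto simp: vars_in_def in_keys_iff)
  qed
  then show ?thesis by (simp add: vars_in_def in_keys_iff)
qed

lemma mbinom_nonzeroD:
  assumes "mbinom e d \<noteq> 0"
  shows "e = (e - d) + d"
proof (rule poly_mapping_eqI)
  fix h
  have "lookup d h \<le> lookup e h"
  proof (cases "h \<in> keys d")
    case True
    then have "lookup e h choose lookup d h \<noteq> 0"
      using assms by (auto simp: mbinom_def)
    then show ?thesis by (metis binomial_eq_0 not_le)
  qed (simp add: in_keys_iff)
  then show "lookup e h = lookup (e - d + d) h" by (simp add: lookup_add lookup_minus)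
qed

text \<open>Coefficient by coefficient this is \<open>mbinom_trans\<close>. It transfers a lower
  bound on the order of vanishing of \<open>P\<close> at \<xi> to the derivatives of
  \<open>P\<close>.\<close>

lemma hasse_shift:
  assumes "keys d \<subseteq> {..<m}"
  shows "hasse d (shift \<xi> m P) = shift \<xi> m (hasse d P)"
proof (rule poly_mapping_eqI)
  fix j
  show "lookup (hasse d (shift \<xi> m P)) j = lookup (shift \<xi> m (hasse d P)) j"
  proof (cases "keys j \<subseteq> {..<m}")
    case False
    moreover have "keys j \<subseteq> keys (j + d)" by (auto simp: in_keys_iff lookup_add)
    ultimately have "\<not> keys (j + d) \<subseteq> {..<m}" by blast
    with False have "lookup (shift \<xi> m P) (j + d) = 0" "lookup (shift \<xi> m (hasse d P)) j = 0"
      using vars_in_shift[of m \<xi> P] vars_in_shift[of m \<xi> "hasse d P"]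
      by (metis in_keys_iff vars_in_def)+
    then show ?thesis by (simp add: lookup_hasse)
  next
    case True
    have jd: "keys (j + d) \<subseteq> {..<m}" using keys_add[of j d] True assms by auto
    have *: "real (mbinom (j + d) d) * (lookup P e * (real (mbinom e (j + d)) * mpow \<xi> m (e - (j + d))))
        = lookup P e * (real (mbinom e d) * real (mbinom (e - d) j) * mpow \<xi> m (e - d - j))" for e
    proof -
      have "real (mbinom (j + d) d) * real (mbinom e (j + d)) = real (mbinom e d) * real (mbinom (e - d) j)"
        using mbinom_trans[of j d e] by (metis of_nat_mult)
      moreover have "e - (j + d) = e - d - j" by (metis add.commute diff_diff_add)
      ultimately show ?thesis by (simp add: mult_ac)
    qed
    let ?g = "\<lambda>e. lookup P e * (real (mbinom e d) * real (mbinom (e - d) j) * mpow \<xi> m (e - d - j))"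
    have "lookup (hasse d (shift \<xi> m P)) j = (\<Sum>e\<in>keys P. ?g e)"
      by (simp only: lookup_hasse lookup_shift[OF jd] sum_distrib_left *)
    \<comment> \<open>Monomials of \<open>P\<close> that do not come from the derivative carry a
      zero binomial factor, so the reindexing loses nothing.\<close>
    also have "\<dots> = (\<Sum>e\<in>(\<lambda>e. e + d) ` keys (hasse d P). ?g e)"
    proof (rule sum.mono_neutral_right)
      show "(\<lambda>e. e + d) ` keys (hasse d P) \<subseteq> keys P" using keys_hasse by auto
      show "\<forall>e\<in>keys P - (\<lambda>e. e + d) ` keys (hasse d P). ?g e = 0"
      proof
        fix e assume e: "e \<in> keys P - (\<lambda>e. e + d) ` keys (hasse d P)"
        show "?g e = 0"
        proof (cases "mbinom e d = 0")
          case False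
          then have "e = (e - d) + d" by (rule mbinom_nonzeroD)
          then have "lookup (hasse d P) (e - d) \<noteq> 0"
            using e False by (metis DiffD1 in_keys_iff lookup_hasse mult_eq_0_iff of_nat_eq_0_iff)
          then have "e \<in> (\<lambda>e. e + d) ` keys (hasse d P)"
            using \<open>e = (e - d) + d\<close> by (auto simp: in_keys_iff intro!: image_eqI[of _ _ "e - d"])
          then show ?thesis using e by blast
        qed simp
      qed
    qed simp
    also have "\<dots> = (\<Sum>e\<in>keys (hasse d P). ?g (e + d))"
      by (subst sum.reindex) (auto intro: inj_onI)
    also have "\<dots> = lookup (shift \<xi> m (hasse d P)) j"
      by (simp add: lookup_shift[OF True] lookup_hasse mult_ac)
    finally show ?thesis .
  qed
qed

subsection \<open>Weighted degrees\<close>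

text \<open>If \<open>n h * d h = D\<close> for all h, then \<open>wt n m e / D\<close> is the sum
  of e_h / d_h, that is, Roth's index with denominators cleared.\<close>

definition wt :: "(nat \<Rightarrow> nat) \<Rightarrow> nat \<Rightarrow> monom \<Rightarrow> nat" where
  "wt n m e = (\<Sum>h<m. n h * lookup e h)"

lemma wt_add: "wt n m (e + f) = wt n m e + wt n m f"
  by (simp add: wt_def lookup_add algebra_simps sum.distrib)

section \<open>The index of a polynomial in one variable\<close>

text \<open>A form of Gauss's lemma. Solving for the coefficients of \<open>R\<close> from the
  bottom introduces only powers of \<open>p\<close> as denominators, from the top only powers of
  \<open>q\<close>; Bezout combines the two.\<close>

lemma integral_quotient:
  fixes R :: "real poly" and p q :: int
  assumes cop: "coprime p q"
    and int: "\<And>i. coeff ([:- of_int p, of_int q:] * R) i \<in> \<int>"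
  shows "coeff R i \<in> \<int>"
proof -
  have c0: "coeff ([:- of_int p, of_int q:] * R) 0 = - of_int p * coeff R 0"
    by simp
  have cS: "coeff ([:- of_int p, of_int q:] * R) (Suc i) = of_int q * coeff R i - of_int p * coeff R (Suc i)" for i
    by simp
  have A: "of_int p ^ Suc i * coeff R i \<in> \<int>" for i
  proof (induction i)
    case 0
    then show ?case using int[of 0] c0 by (simp add: minus_in_Ints_iff)
  next
    case (Suc i)
    have "of_int p ^ Suc (Suc i) * coeff R (Suc i)
        = of_int q * (of_int p ^ Suc i * coeff R i)
          - of_int p ^ Suc i * coeff ([:- of_int p, of_int q:] * R) (Suc i)"
      unfolding cS by (simp add: algebra_simps)
    also have "\<dots> \<in> \<int>" by (intro Ints_diff Ints_mult Ints_power Suc int) auto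
    finally show ?case .
  qed
  have B: "degree R < i + k \<Longrightarrow> of_int q ^ k * coeff R i \<in> \<int>" for i k
  proof (induction k arbitrary: i)
    case 0
    then show ?case by (simp add: coeff_eq_0)
  next
    case (Suc k)
    have "of_int q ^ Suc k * coeff R i
        = of_int q ^ k * coeff ([:- of_int p, of_int q:] * R) (Suc i)
          + of_int p * (of_int q ^ k * coeff R (Suc i))"
      unfolding cS by (simp add: algebra_simps)
    also have "\<dots> \<in> \<int>" by (intro Ints_add Ints_mult Ints_power Suc int) (use Suc.prems in auto)
    finally show ?case .
  qed
  let ?k = "Suc (degree R)"
  obtain u v where "u * p ^ Suc i + v * q ^ ?k = gcd (p ^ Suc i) (q ^ ?k)"
    using bezout_int by blast
  also have "\<dots> = 1" using cop by (metis coprime_imp_gcd_eq_1 coprime_power_left_iff coprime_power_right_iff)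
  finally have "real_of_int (u * p ^ Suc i + v * q ^ ?k) = 1" by simp
  then have "coeff R i = real_of_int (u * p ^ Suc i + v * q ^ ?k) * coeff R i" by simp
  also have "\<dots> = of_int u * (of_int p ^ Suc i * coeff R i) + of_int v * (of_int q ^ ?k * coeff R i)"
    by (simp add: algebra_simps)
  also have "\<dots> \<in> \<int>" by (intro Ints_add Ints_mult A B) auto
  finally show ?thesis .
qed

lemma integral_quotient_power:
  fixes R :: "real poly" and p q :: int
  assumes "coprime p q" "\<And>i. coeff ([:- of_int p, of_int q:] ^ l * R) i \<in> \<int>"
  shows "coeff R i \<in> \<int>"
  using assms(2)
proof (induction l arbitrary: R i)
  case (Suc l)
  have "coeff ([:- of_int p, of_int q:] * R) i \<in> \<int>" for i
    by (rule Suc.IH) (use Suc.prems in \<open>simp only: power_Suc2 mult.assoc\<close>)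
  then show ?case by (rule integral_quotient[OF assms(1)])
qed simp

text \<open>At the lowest nonzero coefficient of the quotient only the constant term (-p)^l of the
  power contributes, and that coefficient of the quotient is a nonzero integer.\<close>

lemma linear_power_dvd_bound:
  fixes v :: "real poly" and p q :: int
  assumes "coprime p q" "p \<noteq> 0" "v \<noteq> 0" "\<And>i. coeff v i \<in> \<int>"
    and "[:- of_int p, of_int q:] ^ l dvd v"
  shows "\<exists>t. \<bar>of_int p\<bar> ^ l \<le> \<bar>coeff v t\<bar>"
proof -
  obtain R where R: "v = [:- of_int p, of_int q:] ^ l * R" using assms(5) by (elim dvdE)
  have int: "coeff R i \<in> \<int>" for i
    by (rule integral_quotient_power[OF assms(1), of l]) (use assms(4) R in metis)
  define t where "t = (LEAST t. coeff R t \<noteq> 0)"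
  have "R \<noteq> 0" using R assms(3) by auto
  then have "\<exists>t. coeff R t \<noteq> 0" by (metis leading_coeff_neq_0)
  then have t: "coeff R t \<noteq> 0" unfolding t_def by (rule LeastI_ex)
  have below: "coeff R s = 0" if "s < t" for s using that not_less_Least unfolding t_def by blast
  have "coeff v t = (\<Sum>i\<le>t. coeff ([:- of_int p, of_int q:] ^ l) i * coeff R (t - i))"
    unfolding R coeff_mult ..
  also have "\<dots> = (\<Sum>i\<in>{0}. coeff ([:- of_int p, of_int q:] ^ l) i * coeff R (t - i))"
    by (rule sum.mono_neutral_right) (auto simp: below)
  also have "\<dots> = (- of_int p) ^ l * coeff R t"
    by (simp add: coeff_0_power)
  finally have "\<bar>coeff v t\<bar> = \<bar>of_int p\<bar> ^ l * \<bar>coeff R t\<bar>"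
    by (simp add: abs_mult power_abs)
  moreover have "1 \<le> \<bar>coeff R t\<bar>" using int t by (rule Ints_nonzero_abs_ge1)
  ultimately show ?thesis
    by (metis abs_ge_zero mult.right_neutral mult_left_mono zero_le_power)
qed

text \<open>Vanishing to order \<open>l\<close> at p/q means divisibility by (q X - p)^l, which
  forces a coefficient of size at least |p|^l. All bounds on orders of vanishing in Roth's lemma go
  back to this.\<close>

lemma index_one_variable:
  fixes p q :: int
  assumes V: "int_coeffs V" "V \<noteq> 0" "vars_in {m} V"
    and pq: "coprime p q" "p \<noteq> 0" "q \<noteq> 0" "\<xi> m = of_int p / of_int q"
    and ord: "\<And>t. t < l \<Longrightarrow> lookup (shift \<xi> (Suc m) V) (single m t) = 0"
  shows "\<bar>of_int p\<bar> ^ l \<le> l1 V"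
proof -
  define v where "v = (\<Sum>e\<in>keys V. monom (lookup V e) (lookup e m))"
  have e: "e = single m (lookup e m)" if "e \<in> keys V" for e
    using that V(3) keys_subset_single by (auto simp: vars_in_def)
  have coeff: "coeff v t = lookup V (single m t)" for t
  proof -
    have "coeff v t = (\<Sum>e\<in>keys V. if e = single m t then lookup V e else 0)"
      unfolding v_def coeff_sum
      by (intro sum.cong refl) (use e in \<open>force simp: lookup_single\<close>)
    also have "\<dots> = lookup V (single m t)"
      by (auto simp: sum.delta in_keys_iff)
    finally show ?thesis .
  qed
  \<comment> \<open>A common bound on the degrees, so that the Taylor expansions of all monomials
    run over the same range and can be added.\<close>
  define M where "M = Max (insert 0 ((\<lambda>e. lookup e m) ` keys V))"
  have M: "lookup e m \<le> M" if "e \<in> keys V" for e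
    unfolding M_def using that by (intro Max_ge) auto
  define c where "c t = (\<Sum>e\<in>keys V. lookup V e * (real (lookup e m choose t) * \<xi> m ^ (lookup e m - t)))" for t
  have X: "monom a N = (\<Sum>t\<le>M. smult (a * (real (N choose t) * \<xi> m ^ (N - t))) ([:- \<xi> m, 1:] ^ t))"
    if "N \<le> M" for a :: real and N
  proof -
    have const: "[:x:] ^ k = [:x ^ k:]" for x :: real and k by (induction k) auto
    have "monom 1 N = ([:- \<xi> m, 1:] + [:\<xi> m:]) ^ N"
      by (simp add: monom_altdef)
    also have "\<dots> = (\<Sum>t\<le>N. smult (real (N choose t) * \<xi> m ^ (N - t)) ([:- \<xi> m, 1:] ^ t))"
      unfolding binomial_ring const
      by (intro sum.cong refl) (simp add: of_nat_poly mult_ac)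
    also have "\<dots> = (\<Sum>t\<le>M. smult (real (N choose t) * \<xi> m ^ (N - t)) ([:- \<xi> m, 1:] ^ t))"
      by (rule sum.mono_neutral_left) (use that in \<open>auto simp: binomial_eq_0\<close>)
    finally have "smult a (monom 1 N) = smult a \<dots>" by simp
    moreover have "smult a (sum f A) = (\<Sum>x\<in>A. smult a (f x))" for f :: "nat \<Rightarrow> real poly" and A
      by (induction A rule: infinite_finite_induct) (auto simp: smult_add_right)
    ultimately show ?thesis by (simp add: smult_monom)
  qed
  have "v = (\<Sum>e\<in>keys V. \<Sum>t\<le>M. smult (lookup V e * (real (lookup e m choose t) * \<xi> m ^ (lookup e m - t))) ([:- \<xi> m, 1:] ^ t))"
    unfolding v_def by (intro sum.cong refl X M)
  also have "\<dots> = (\<Sum>t\<le>M. smult (c t) ([:- \<xi> m, 1:] ^ t))"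
    unfolding c_def by (subst sum.swap) (simp add: smult_sum)
  finally have v: "v = (\<Sum>t\<le>M. smult (c t) ([:- \<xi> m, 1:] ^ t))" .
  have c0: "c t = 0" if "t < l" for t
  proof -
    have "lookup (shift \<xi> (Suc m) V) (single m t) = c t"
    proof -
      have "mbinom e (single m t) = lookup e m choose t" for e
        by (subst mbinom_superset[of "{m}"]) auto
      moreover have "mpow \<xi> (Suc m) (e - single m t) = \<xi> m ^ (lookup e m - t)" if "e \<in> keys V" for e
      proof -
        have "lookup e h = 0" if "h < m" for h
          using e[OF \<open>e \<in> keys V\<close>] that
          by (metis lookup_single_not_eq nat_neq_iff)
        then show ?thesis by (simp add: mpow_def lookup_minus)
      qed
      ultimately show ?thesis
        unfolding c_def by (subst lookup_shift) auto
    qed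
    then show ?thesis using ord that by metis
  qed
  have "[:- \<xi> m, 1:] ^ l dvd v"
    unfolding v
  proof (rule dvd_sum)
    fix t
    show "[:- \<xi> m, 1:] ^ l dvd smult (c t) ([:- \<xi> m, 1:] ^ t)"
      by (cases "t < l") (auto simp: c0 intro!: dvd_smult le_imp_power_dvd)
  qed
  moreover have "[:- of_int p, of_int q:] = smult (of_int q) [:- \<xi> m, 1:]"
    using pq by simp
  then have "[:- of_int p, of_int q:] ^ l = smult (of_int q ^ l) ([:- \<xi> m, 1:] ^ l)"
    by (simp only: smult_power)
  ultimately have dvd: "[:- of_int p, of_int q:] ^ l dvd v"
    using pq(3) by (simp only: smult_dvd_iff) simp
  obtain e0 where e0: "e0 \<in> keys V" using V(2) by (metis ex_in_conv keys_eq_empty)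
  then have "coeff v (lookup e0 m) \<noteq> 0" using e coeff by (metis in_keys_iff)
  then have "v \<noteq> 0" by auto
  then obtain t where "\<bar>of_int p\<bar> ^ l \<le> \<bar>coeff v t\<bar>"
    using linear_power_dvd_bound[OF pq(1,2) _ _ dvd] V(1) coeff by (auto simp: int_coeffs_def)
  then show ?thesis using abs_lookup_le_l1[of V "single m t"] coeff by simp
qed

section \<open>Generalised Wronskians\<close>

text \<open>Gaussian elimination. The pivot is always taken in the lowest nonzero row, at its lowest nonzero
  entry; this is what makes the lowest terms of the factors pairwise distinct.\<close>

lemma rank_decomposition:
  fixes A :: "'a::linorder \<Rightarrow> 'b::linorder \<Rightarrow> real"
  assumes "finite R" "finite C" "\<forall>i j. A i j \<noteq> 0 \<longrightarrow> i \<in> R \<and> j \<in> C"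
  shows "\<exists>(k::nat) \<phi> \<psi> e f. (\<forall>i j. A i j = (\<Sum>l<k. \<phi> l i * \<psi> l j)) \<and>
     inj_on e {..<k} \<and> inj_on f {..<k} \<and>
     (\<forall>l<k. e l \<in> R \<and> f l \<in> C \<and> \<phi> l (e l) \<noteq> 0 \<and> \<psi> l (f l) \<noteq> 0 \<and>
        (\<forall>i. \<phi> l i \<noteq> 0 \<longrightarrow> i \<in> R \<and> e l \<le> i) \<and> (\<forall>j. \<psi> l j \<noteq> 0 \<longrightarrow> j \<in> C \<and> f l \<le> j))"
  using assms
proof (induction R arbitrary: A C rule: finite_psubset_induct)
  case (psubset R)
  show ?case
  proof (cases "\<exists>i j. A i j \<noteq> 0")
    case False
    then show ?thesis by (intro exI[of _ 0]) auto
  next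
    case True
    define Z where "Z = {i \<in> R. \<exists>j. A i j \<noteq> 0}"
    define i0 where "i0 = Min Z"
    have Z: "finite Z" "Z \<noteq> {}" unfolding Z_def using psubset(1) True psubset(4) by (simp, blast)
    then have "i0 \<in> Z" unfolding i0_def by (rule Min_in)
    then have i0: "i0 \<in> R" "\<exists>j. A i0 j \<noteq> 0" unfolding Z_def by auto
    define Y where "Y = {j \<in> C. A i0 j \<noteq> 0}"
    define j0 where "j0 = Min Y"
    have Y: "finite Y" "Y \<noteq> {}" unfolding Y_def using psubset(3) i0 psubset(4) by (simp, blast)
    then have "j0 \<in> Y" unfolding j0_def by (rule Min_in)
    then have j0: "j0 \<in> C" "A i0 j0 \<noteq> 0" unfolding Y_def by auto
    have i0_le: "i0 \<le> i" if "A i j \<noteq> 0" for i j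
      unfolding i0_def using that Z psubset(4)[rule_format, of i j] by (intro Min_le) (auto simp: Z_def)
    have j0_le: "j0 \<le> j" if "A i0 j \<noteq> 0" for j
      unfolding j0_def using that Y psubset(4)[rule_format, of i0 j] by (intro Min_le) (auto simp: Y_def)
    \<comment> \<open>The rank-one correction clears row \<open>i0\<close> and column
      \<open>j0\<close>, so these pivots cannot recur later in the elimination.\<close>
    define A' where "A' i j = A i j - A i j0 * (A i0 j / A i0 j0)" for i j
    have supp: "\<forall>i j. A' i j \<noteq> 0 \<longrightarrow> i \<in> R - {i0} \<and> j \<in> C - {j0}"
    proof (intro allI impI)
      fix i j assume "A' i j \<noteq> 0"
      then show "i \<in> R - {i0} \<and> j \<in> C - {j0}"
        using psubset(4)[rule_format, of i j] psubset(4)[rule_format, of i j0] psubset(4)[rule_format, of i0 j] j0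
        by (cases "A i j = 0") (auto simp: A'_def)
    qed
    have "R - {i0} \<subset> R" "finite (C - {j0})" using i0 psubset(3) by auto
    from psubset.IH[where A = A', OF this supp] obtain k :: nat and \<phi> \<psi> e f where
      "\<forall>i j. A' i j = (\<Sum>l<k. \<phi> l i * \<psi> l j)" "inj_on e {..<k}" "inj_on f {..<k}"
      "\<forall>l<k. e l \<in> R - {i0} \<and> f l \<in> C - {j0} \<and> \<phi> l (e l) \<noteq> 0 \<and> \<psi> l (f l) \<noteq> 0 \<and>
        (\<forall>i. \<phi> l i \<noteq> 0 \<longrightarrow> i \<in> R - {i0} \<and> e l \<le> i) \<and> (\<forall>j. \<psi> l j \<noteq> 0 \<longrightarrow> j \<in> C - {j0} \<and> f l \<le> j)"
      by (elim exE conjE) (rule that)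
    then have IH: "A' i j = (\<Sum>l<k. \<phi> l i * \<psi> l j)" "inj_on e {..<k}" "inj_on f {..<k}"
      "l < k \<Longrightarrow> e l \<in> R - {i0} \<and> f l \<in> C - {j0} \<and> \<phi> l (e l) \<noteq> 0 \<and> \<psi> l (f l) \<noteq> 0 \<and>
        (\<forall>i. \<phi> l i \<noteq> 0 \<longrightarrow> i \<in> R - {i0} \<and> e l \<le> i) \<and> (\<forall>j. \<psi> l j \<noteq> 0 \<longrightarrow> j \<in> C - {j0} \<and> f l \<le> j)"
      for i j l by simp_all
    let ?\<phi> = "\<phi>(k := \<lambda>i. A i j0)" and ?\<psi> = "\<psi>(k := \<lambda>j. A i0 j / A i0 j0)"
    let ?e = "e(k := i0)" and ?f = "f(k := j0)"
    have 1: "A i j = (\<Sum>l<Suc k. ?\<phi> l i * ?\<psi> l j)" for i j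
      using IH(1)[of i j] by (simp add: A'_def)
    have ne: "e l \<noteq> i0" "f l \<noteq> j0" if "l < k" for l
      using IH(4)[OF that] by blast+
    have 2: "inj_on ?e {..<Suc k}" "inj_on ?f {..<Suc k}"
      unfolding lessThan_Suc inj_on_insert using IH(2,3) ne by (fastforce intro!: inj_on_fun_updI)+
    have 3: "?e l \<in> R \<and> ?f l \<in> C \<and> ?\<phi> l (?e l) \<noteq> 0 \<and> ?\<psi> l (?f l) \<noteq> 0 \<and>
        (\<forall>i. ?\<phi> l i \<noteq> 0 \<longrightarrow> i \<in> R \<and> ?e l \<le> i) \<and> (\<forall>j. ?\<psi> l j \<noteq> 0 \<longrightarrow> j \<in> C \<and> ?f l \<le> j)"
      if "l < Suc k" for l
    proof (cases "l = k")
      case True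
      moreover have "A i j0 \<noteq> 0 \<longrightarrow> i \<in> R \<and> i0 \<le> i" for i
        using psubset(4) i0_le by blast
      moreover have "A i0 j / A i0 j0 \<noteq> 0 \<longrightarrow> j \<in> C \<and> j0 \<le> j" for j
        using psubset(4) j0_le by (metis div_0)
      ultimately show ?thesis using i0(1) j0 by simp
    next
      case False
      then show ?thesis using IH(4)[of l] that by auto
    qed
    from 1 2 3 show ?thesis by blast
  qed
qed

text \<open>Multiplication by a linear form raises the degree of \<open>d\<close> by at most one,
  because n C(n,t) = (t+1) C(n,t+1) + t C(n,t).\<close>

lemma mbinom_mult_var:
  assumes "finite S" "h \<in> S" "keys d \<subseteq> S"
  shows "(real (lookup x h) - a) * real (mbinom x d)
    = real (lookup d h + 1) * real (mbinom x (d + single h 1)) + (real (lookup d h) - a) * real (mbinom x d)"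
proof -
  have k: "keys (d + single h 1) \<subseteq> S" using keys_add[of d "single h 1"] assms by auto
  have b: "real n * real (n choose t) = real (t + 1) * real (n choose (t + 1)) + real t * real (n choose t)" for n t
  proof -
    have "(t + 1) * (n choose (t + 1)) = (n - t) * (n choose t)"
      by (metis Suc_eq_plus1 binomial_absorb_comp binomial_absorption diff_Suc_1)
    moreover have "(n - t) * (n choose t) + t * (n choose t) = n * (n choose t)"
      by (cases "t \<le> n") (simp_all add: binomial_eq_0 add_mult_distrib[symmetric])
    ultimately have "n * (n choose t) = (t + 1) * (n choose (t + 1)) + t * (n choose t)" by simp
    then show ?thesis by (metis of_nat_add of_nat_mult)
  qed
  define r where "r = (\<Prod>i\<in>S - {h}. real (lookup x i choose lookup d i))"
  have 1: "real (mbinom x d) = real (lookup x h choose lookup d h) * r"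
    unfolding mbinom_superset[OF assms(1,3)] r_def using assms by (subst prod.remove[of S h]) auto
  have "(\<Prod>i\<in>S - {h}. real (lookup x i choose lookup (d + single h 1) i)) = r"
    unfolding r_def by (intro prod.cong refl) (auto simp: lookup_add lookup_single when_def)
  then have 2: "real (mbinom x (d + single h 1)) = real (lookup x h choose (lookup d h + 1)) * r"
    unfolding mbinom_superset[OF assms(1) k] using assms
    by (subst prod.remove[of S h]) (auto simp: lookup_add)
  have "real (lookup x h) * (real (lookup x h choose lookup d h) * r)
      = (real (lookup x h) * real (lookup x h choose lookup d h)) * r" by simp
  also have "\<dots> = real (lookup d h + 1) * (real (lookup x h choose (lookup d h + 1)) * r)
      + real (lookup d h) * (real (lookup x h choose lookup d h) * r)"
    by (subst b) (simp only: distrib_right mult.assoc)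
  finally have "real (lookup x h) * real (mbinom x d)
      = real (lookup d h + 1) * real (mbinom x (d + single h 1)) + real (lookup d h) * real (mbinom x d)"
    by (simp only: 1 2)
  then show ?thesis unfolding left_diff_distrib by linarith
qed

text \<open>In the induction step, the expansion along the last row is a linear functional in that row. If it
  vanished for every admissible \<open>d\<close>, it would annihilate all polynomials of degree at most \<open>k\<close>, in
  particular a product of \<open>k\<close> linear forms that vanishes at all the points \<open>e l\<close> except the last one.\<close>

lemma binomial_minor_nonzero:
  fixes e :: "nat \<Rightarrow> monom"
  assumes S: "finite S" and "inj_on e {..<k}" "\<And>l. l < k \<Longrightarrow> keys (e l) \<subseteq> S"
  shows "\<exists>\<delta>. (\<forall>i<k. keys (\<delta> i) \<subseteq> S \<and> (\<Sum>h\<in>S. lookup (\<delta> i) h) \<le> i) \<and>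
     det (mat k k (\<lambda>(i, l). real (mbinom (e l) (\<delta> i)))) \<noteq> 0"
  using assms(2,3)
proof (induction k)
  case 0
  then show ?case by (simp add: det_def)
next
  case (Suc k)
  then obtain \<delta> where \<delta>: "\<And>i. i < k \<Longrightarrow> keys (\<delta> i) \<subseteq> S \<and> (\<Sum>h\<in>S. lookup (\<delta> i) h) \<le> i"
    and det: "det (mat k k (\<lambda>(i, l). real (mbinom (e l) (\<delta> i)))) \<noteq> 0"
    by (auto simp: inj_on_def)
  \<comment> \<open>The cofactors of the last row. They do not involve the \<open>d\<close> still to
    be chosen, and \<open>C k\<close> is the minor from the induction hypothesis.\<close>
  define C where "C l = (-1) ^ (k + l) *
     det (mat k k (\<lambda>(i, l'). real (mbinom (e (if l' < l then l' else Suc l')) (\<delta> i))))" for l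
  have "mat k k (\<lambda>(i, l'). real (mbinom (e (if l' < k then l' else Suc l')) (\<delta> i)))
      = mat k k (\<lambda>(i, l). real (mbinom (e l) (\<delta> i)))"
    by (rule eq_matI) auto
  then have Ck: "C k \<noteq> 0" using det by (simp add: C_def)
  have laplace: "det (mat (Suc k) (Suc k) (\<lambda>(i, l). real (mbinom (e l) ((\<delta>(k := d)) i))))
      = (\<Sum>l<Suc k. C l * real (mbinom (e l) d))" (is "det ?M = _") for d
  proof -
    have "cofactor ?M k l = C l" if "l < Suc k" for l
      unfolding cofactor_def C_def mat_delete_def
      by (intro arg_cong2[where f = "(*)"] arg_cong[where f = det] eq_matI refl) (use that in auto)
    then show ?thesis
      by (subst laplace_expansion_row[of _ "Suc k" k]) (auto intro!: sum.cong)
  qed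
  have "\<exists>d. keys d \<subseteq> S \<and> (\<Sum>h\<in>S. lookup d h) \<le> k \<and> (\<Sum>l<Suc k. C l * real (mbinom (e l) d)) \<noteq> 0"
  proof (rule ccontr)
    assume "\<not> ?thesis"
    then have zero: "(\<Sum>l<Suc k. C l * real (mbinom (e l) d)) = 0"
      if "keys d \<subseteq> S" "(\<Sum>h\<in>S. lookup d h) \<le> k" for d using that by blast
    have "\<exists>h\<in>S. lookup (e l) h \<noteq> lookup (e k) h" if "l < k" for l
    proof -
      have "e l \<noteq> e k" using Suc.prems(1) that by (auto simp: inj_on_def)
      then obtain h where h: "lookup (e l) h \<noteq> lookup (e k) h" by (metis poly_mapping_eqI)
      then have "h \<in> keys (e l) \<union> keys (e k)" by (auto simp: in_keys_iff)
      then show ?thesis using h Suc.prems(2)[of l] Suc.prems(2)[of k] that by auto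
    qed
    then obtain g where g: "\<And>l. l < k \<Longrightarrow> g l \<in> S \<and> lookup (e l) (g l) \<noteq> lookup (e k) (g l)" by metis
    \<comment> \<open>The condition on \<open>d\<close> is a degree budget: every further linear
      form may raise \<open>d\<close> by one, and the total stays at most \<open>k\<close>.\<close>
    have prod_zero: "(\<Sum>l<Suc k. C l * ((\<Prod>s<r. real (lookup (e l) (g s)) - real (lookup (e s) (g s))) * real (mbinom (e l) d))) = 0"
      if "r \<le> k" "keys d \<subseteq> S" "(\<Sum>h\<in>S. lookup d h) + r \<le> k" for r d
      using that
    proof (induction r arbitrary: d)
      case 0
      then show ?case using zero by simp
    next
      case (Suc r)
      let ?F = "\<lambda>l. \<Prod>s<r. real (lookup (e l) (g s)) - real (lookup (e s) (g s))"
      let ?h = "g r" and ?a = "real (lookup (e r) (g r))"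
      let ?d = "d + single ?h 1"
      have h: "?h \<in> S" using g[of r] Suc.prems by auto
      have k': "keys ?d \<subseteq> S" using keys_add[of d "single ?h 1"] h Suc.prems by auto
      have "(\<Sum>i\<in>S. lookup ?d i) = (\<Sum>i\<in>S. lookup d i) + 1"
        using h S by (simp add: lookup_add lookup_single when_def sum.distrib sum.delta)
      then have "(\<Sum>l<Suc k. C l * (?F l * real (mbinom (e l) ?d))) = 0"
        "(\<Sum>l<Suc k. C l * (?F l * real (mbinom (e l) d))) = 0"
        by (intro Suc.IH; use Suc.prems k' in auto)+
      then have "real (lookup d ?h + 1) * (\<Sum>l<Suc k. C l * (?F l * real (mbinom (e l) ?d)))
         + (real (lookup d ?h) - ?a) * (\<Sum>l<Suc k. C l * (?F l * real (mbinom (e l) d))) = 0" by simp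
      also have "real (lookup d ?h + 1) * (\<Sum>l<Suc k. C l * (?F l * real (mbinom (e l) ?d)))
         + (real (lookup d ?h) - ?a) * (\<Sum>l<Suc k. C l * (?F l * real (mbinom (e l) d)))
         = (\<Sum>l<Suc k. C l * (?F l * ((real (lookup d ?h + 1) * real (mbinom (e l) ?d)
              + (real (lookup d ?h) - ?a) * real (mbinom (e l) d)))))"
        unfolding sum_distrib_left sum.distrib[symmetric]
        by (intro sum.cong refl) (simp add: algebra_simps)
      also have "\<dots> = (\<Sum>l<Suc k. C l * (?F l * ((real (lookup (e l) ?h) - ?a) * real (mbinom (e l) d))))"
        by (subst mbinom_mult_var[OF S h]) (use Suc.prems in auto)
      finally show ?case by (simp add: mult_ac)
    qed
    have "(\<Sum>l<Suc k. C l * ((\<Prod>s<k. real (lookup (e l) (g s)) - real (lookup (e s) (g s))) * real (mbinom (e l) 0))) = 0"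
      by (rule prod_zero) auto
    moreover have "(\<Prod>s<k. real (lookup (e l) (g s)) - real (lookup (e s) (g s))) = 0" if "l < k" for l
      using that by auto
    ultimately have "C k * (\<Prod>s<k. real (lookup (e k) (g s)) - real (lookup (e s) (g s))) = 0"
      by (simp add: mbinom_def)
    with Ck have "\<exists>s<k. real (lookup (e k) (g s)) - real (lookup (e s) (g s)) = 0"
      by auto
    then show False using g by fastforce
  qed
  then obtain d where d: "keys d \<subseteq> S" "(\<Sum>h\<in>S. lookup d h) \<le> k" "(\<Sum>l<Suc k. C l * real (mbinom (e l) d)) \<noteq> 0"
    by blast
  show ?case
  proof (intro exI conjI allI impI)
    fix i assume "i < Suc k"
    then show "keys ((\<delta>(k := d)) i) \<subseteq> S" "(\<Sum>h\<in>S. lookup ((\<delta>(k := d)) i) h) \<le> i"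
      using \<delta>[of i] d by (auto simp: less_Suc_eq)
  next
    show "det (mat (Suc k) (Suc k) (\<lambda>(i, l). real (mbinom (e l) ((\<delta>(k := d)) i)))) \<noteq> 0"
      using d laplace by simp
  qed
qed

text \<open>The order on exponents is linear and compatible with addition, so the sum of the lowest
  exponents arises in only one way and lowest terms multiply without cancellation.\<close>

lemma lookup_prod_lowest:
  fixes f :: "'a \<Rightarrow> mpoly"
  assumes "finite A" "\<And>a e'. a \<in> A \<Longrightarrow> e' \<in> keys (f a) \<Longrightarrow> e a \<le> e'"
  shows "lookup (\<Prod>a\<in>A. f a) (\<Sum>a\<in>A. e a) = (\<Prod>a\<in>A. lookup (f a) (e a)) \<and>
    (\<forall>e'\<in>keys (\<Prod>a\<in>A. f a). (\<Sum>a\<in>A. e a) \<le> e')"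
  using assms
proof (induction A rule: finite_induct)
  case (insert x F)
  then have IH: "lookup (\<Prod>a\<in>F. f a) (\<Sum>a\<in>F. e a) = (\<Prod>a\<in>F. lookup (f a) (e a))"
    "\<And>e'. e' \<in> keys (\<Prod>a\<in>F. f a) \<Longrightarrow> (\<Sum>a\<in>F. e a) \<le> e'" by auto
  have "lookup (f x * (\<Prod>a\<in>F. f a)) (e x + (\<Sum>a\<in>F. e a)) = lookup (f x) (e x) * lookup (\<Prod>a\<in>F. f a) (\<Sum>a\<in>F. e a)"
  proof (rule lookup_mult_unique)
    fix e' f' assume *: "e' \<in> keys (f x)" "f' \<in> keys (\<Prod>a\<in>F. f a)" "e' + f' = e x + (\<Sum>a\<in>F. e a)"
    have "e x \<le> e'" "(\<Sum>a\<in>F. e a) \<le> f'" using * insert.prems IH by auto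
    then show "e' = e x \<and> f' = (\<Sum>a\<in>F. e a)"
      using *(3) add_less_le_mono[of "e x" e' "\<Sum>a\<in>F. e a" f'] add_le_less_mono[of "e x" e' "\<Sum>a\<in>F. e a" f']
      by (auto simp: order.order_iff_strict)
  qed
  moreover have "e x + (\<Sum>a\<in>F. e a) \<le> e'" if "e' \<in> keys (f x * (\<Prod>a\<in>F. f a))" for e'
  proof -
    obtain u v where "e' = u + v" "u \<in> keys (f x)" "v \<in> keys (\<Prod>a\<in>F. f a)"
      using keys_mult[of "f x" "\<Prod>a\<in>F. f a"] \<open>e' \<in> _\<close> by auto
    then show ?thesis using insert.prems IH by (auto intro: add_mono)
  qed
  ultimately show ?case using insert.hyps IH by simp
qed (simp add: lookup_one)

lemma lookup_signof_mult [simp]: "lookup (signof p * P) e = signof p * lookup P e" for P :: mpoly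
  by (cases p rule: sign_cases) auto

lemma lookup_monom_mult_hasse:
  "lookup (single d 1 * hasse d P) e = real (mbinom e d) * lookup P e"
proof (cases "mbinom e d = 0")
  case False
  then obtain g where e: "e = d + g" using mbinom_nonzeroD by (metis add.commute)
  have "lookup (single d 1 * hasse d P) (d + g) = lookup (single d 1 :: mpoly) d * lookup (hasse d P) g"
    by (rule lookup_mult_unique) auto
  then show ?thesis unfolding e by (simp add: lookup_hasse add.commute)
next
  case True
  have "e \<notin> keys (single d 1 * hasse d P)"
  proof
    assume "e \<in> keys (single d 1 * hasse d P)"
    then obtain f where f: "e = d + f" "f \<in> keys (hasse d P)"
      using keys_mult[of "single d 1" "hasse d P"] by (auto split: if_splits)
    then show False using True by (auto simp: in_keys_iff lookup_hasse add.commute)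
  qed
  with True show ?thesis by (simp add: in_keys_iff)
qed

lemma permutes_less: "p permutes {0..<k} \<Longrightarrow> i < k \<Longrightarrow> p i < k" for k :: nat
  using permutes_in_image[of p "{0..<k}" i] by simp

text \<open>Multiplying row \<open>i\<close> by the monomial \<open>\<delta> i\<close> turns the Hasse derivatives into operators that are diagonal
  on monomials. The coefficient of the determinant at the sum of the lowest monomials is then, up to
  a nonzero factor, the minor of binomial coefficients.\<close>

lemma wronskian_nonzero:
  fixes \<phi> :: "nat \<Rightarrow> mpoly"
  assumes low: "\<And>l e'. l < k \<Longrightarrow> e' \<in> keys (\<phi> l) \<Longrightarrow> e l \<le> e'"
    and nz: "\<And>l. l < k \<Longrightarrow> e l \<in> keys (\<phi> l)"
    and det: "det (mat k k (\<lambda>(i, l). real (mbinom (e l) (\<delta> i)))) \<noteq> 0"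
  shows "det (mat k k (\<lambda>(i, l). hasse (\<delta> i) (\<phi> l))) \<noteq> 0"
proof
  assume zero: "det (mat k k (\<lambda>(i, l). hasse (\<delta> i) (\<phi> l))) = 0"
  let ?N = "\<lambda>i l. single (\<delta> i) 1 * hasse (\<delta> i) (\<phi> l)"
  let ?E = "\<Sum>l<k. e l"
  let ?P = "{p. p permutes {0..<k}}"
  have "(\<Sum>p\<in>?P. signof p * (\<Prod>i=0..<k. ?N i (p i)))
      = (\<Prod>i=0..<k. single (\<delta> i) 1) * (\<Sum>p\<in>?P. signof p * (\<Prod>i=0..<k. hasse (\<delta> i) (\<phi> (p i))))"
    unfolding sum_distrib_left prod.distrib by (intro sum.cong refl) (simp add: mult_ac)
  also have "(\<Sum>p\<in>?P. signof p * (\<Prod>i=0..<k. hasse (\<delta> i) (\<phi> (p i)))) = 0"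
    using zero by (subst (asm) det_def'[of _ k]) (auto simp: permutes_less intro!: sum.cong prod.cong)
  finally have "lookup (\<Sum>p\<in>?P. signof p * (\<Prod>i=0..<k. ?N i (p i))) ?E = 0" by simp
  moreover have "lookup (\<Sum>p\<in>?P. signof p * (\<Prod>i=0..<k. ?N i (p i))) ?E
     = (\<Sum>p\<in>?P. signof p * (\<Prod>i=0..<k. real (mbinom (e (p i)) (\<delta> i)))) * (\<Prod>l<k. lookup (\<phi> l) (e l))"
    unfolding lookup_sum sum_distrib_right lookup_signof_mult
  proof (intro sum.cong refl)
    fix p assume "p \<in> ?P"
    then have p: "p permutes {0..<k}" by simp
    have re: "(\<Sum>i=0..<k. g (p i)) = (\<Sum>l<k. g l)" for g :: "nat \<Rightarrow> monom"
      using sum.permute[OF p, of g] by (simp add: o_def atLeast0LessThan)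
    have rp: "(\<Prod>i=0..<k. g (p i)) = (\<Prod>l<k. g l)" for g :: "nat \<Rightarrow> real"
      using prod.permute[OF p, of g] by (simp add: o_def atLeast0LessThan)
    have "lookup (\<Prod>i=0..<k. ?N i (p i)) (\<Sum>i=0..<k. e (p i)) = (\<Prod>i=0..<k. lookup (?N i (p i)) (e (p i)))"
    proof (rule lookup_prod_lowest[THEN conjunct1])
      fix i e' assume i: "i \<in> {0..<k}" "e' \<in> keys (?N i (p i))"
      then have "lookup (\<phi> (p i)) e' \<noteq> 0"
        by (metis in_keys_iff lookup_monom_mult_hasse mult_zero_right)
      then show "e (p i) \<le> e'"
        using low[of "p i"] i p by (auto simp: in_keys_iff permutes_less)
    qed simp
    also have "\<dots> = (\<Prod>i=0..<k. real (mbinom (e (p i)) (\<delta> i))) * (\<Prod>i=0..<k. lookup (\<phi> (p i)) (e (p i)))"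
      by (simp add: lookup_monom_mult_hasse prod.distrib)
    finally show "signof p * lookup (\<Prod>i=0..<k. ?N i (p i)) ?E
      = signof p * (\<Prod>i=0..<k. real (mbinom (e (p i)) (\<delta> i))) * (\<Prod>l<k. lookup (\<phi> l) (e l))"
      by (simp add: re rp[of "\<lambda>l. lookup (\<phi> l) (e l)"])
  qed
  moreover have "(\<Sum>p\<in>?P. signof p * (\<Prod>i=0..<k. real (mbinom (e (p i)) (\<delta> i))))
      = det (mat k k (\<lambda>(i, l). real (mbinom (e l) (\<delta> i))))"
    by (subst det_def'[of _ k]) (auto simp: permutes_less intro!: sum.cong prod.cong)
  moreover have "(\<Prod>l<k. lookup (\<phi> l) (e l)) \<noteq> 0"
    using nz by (auto simp: in_keys_iff)
  ultimately show False using det by simp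
qed

section \<open>Monomials, integrality and norms of determinants\<close>

lemma keys_prod:
  fixes f :: "'a \<Rightarrow> mpoly"
  assumes "x \<in> keys (\<Prod>i\<in>A. f i)" "finite A"
  shows "\<exists>g. (\<forall>i\<in>A. g i \<in> keys (f i)) \<and> x = (\<Sum>i\<in>A. g i)"
  using assms(2,1)
proof (induction A arbitrary: x rule: finite_induct)
  case (insert a A)
  then obtain u v where uv: "x = u + v" "u \<in> keys (f a)" "v \<in> keys (\<Prod>i\<in>A. f i)"
    using keys_mult[of "f a" "\<Prod>i\<in>A. f i"] by auto
  from insert.IH[OF uv(3)] obtain g where g: "\<forall>i\<in>A. g i \<in> keys (f i)" "v = (\<Sum>i\<in>A. g i)" by blast
  have "(\<Sum>i\<in>A. (g(a := u)) i) = (\<Sum>i\<in>A. g i)"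
    by (intro sum.cong refl) (use insert.hyps in auto)
  then show ?case using insert.hyps g uv by (intro exI[of _ "g(a := u)"]) auto
qed simp

lemma det_mat_expand:
  "det (mat k k (\<lambda>(i, j). F i j)) = (\<Sum>p | p permutes {0..<k}. signof p * (\<Prod>i=0..<k. F i (p i)))"
  for F :: "nat \<Rightarrow> nat \<Rightarrow> mpoly"
  by (subst det_def'[of _ k]) (auto simp: permutes_less intro!: sum.cong prod.cong)

lemma keys_det:
  fixes F :: "nat \<Rightarrow> nat \<Rightarrow> mpoly"
  assumes "x \<in> keys (det (mat k k (\<lambda>(i, j). F i j)))"
  shows "\<exists>p g. p permutes {0..<k} \<and> (\<forall>i<k. g i \<in> keys (F i (p i))) \<and> x = (\<Sum>i<k. g i)"
proof -
  have "x \<in> (\<Union>p\<in>{p. p permutes {0..<k}}. keys (signof p * (\<Prod>i=0..<k. F i (p i))))"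
    using assms unfolding det_mat_expand by (rule subsetD[OF keys_sum_subset])
  then obtain p where p: "p permutes {0..<k}" "x \<in> keys (signof p * (\<Prod>i=0..<k. F i (p i)))"
    by auto
  then have "x \<in> keys (\<Prod>i=0..<k. F i (p i))" by (auto simp: in_keys_iff)
  then show ?thesis
    using keys_prod[of x "\<lambda>i. F i (p i)" "{0..<k}"] p(1) by (auto simp: atLeast0LessThan)
qed

lemma vars_in_det:
  assumes "\<And>i j. i < k \<Longrightarrow> j < k \<Longrightarrow> vars_in A (F i j)"
  shows "vars_in A (det (mat k k (\<lambda>(i, j). F i j)))"
  unfolding vars_in_def
proof
  fix x assume "x \<in> keys (det (mat k k (\<lambda>(i, j). F i j)))"
  then obtain p g where p: "p permutes {0..<k}" "\<forall>i<k. g i \<in> keys (F i (p i))" "x = (\<Sum>i<k. g i)"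
    using keys_det by blast
  then have "keys (g i) \<subseteq> A" if "i < k" for i
    using assms[of i "p i"] that permutes_less by (auto simp: vars_in_def)
  moreover have "keys (\<Sum>i<k. g i) \<subseteq> (\<Union>i<k. keys (g i))"
    by (rule keys_sum_subset)
  ultimately show "keys x \<subseteq> A" unfolding p(3) by blast
qed

lemma int_coeffs_signof_mult: "int_coeffs P \<Longrightarrow> int_coeffs (signof p * P)"
  by (cases p rule: sign_cases) (auto simp: int_coeffs_uminus)

lemma int_coeffs_det:
  assumes "\<And>i j. i < k \<Longrightarrow> j < k \<Longrightarrow> int_coeffs (F i j)"
  shows "int_coeffs (det (mat k k (\<lambda>(i, j). F i j)))"
  unfolding det_mat_expand
  by (intro int_coeffs_sum int_coeffs_signof_mult int_coeffs_prod) (auto intro!: assms simp: permutes_less)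

lemma shift_signof_mult: "shift \<xi> m (signof p * P) = signof p * shift \<xi> m P"
  by (cases p rule: sign_cases) (auto simp: shift_uminus)

lemma shift_det:
  "shift \<xi> m (det (mat k k (\<lambda>(i, j). F i j))) = det (mat k k (\<lambda>(i, j). shift \<xi> m (F i j)))"
  unfolding det_mat_expand shift_sum shift_signof_mult shift_prod ..

text \<open>The Leibniz expansion together with k! \<le> k^k; as a k-th power the bound can be
  absorbed into a constant later.\<close>

lemma l1_det:
  assumes "\<And>i j. i < k \<Longrightarrow> j < k \<Longrightarrow> l1 (F i j) \<le> B" "0 \<le> B"
  shows "l1 (det (mat k k (\<lambda>(i, j). F i j))) \<le> (real k * B) ^ k"
proof -
  have "l1 (signof p * (\<Prod>i=0..<k. F i (p i))) \<le> B ^ k" if "p permutes {0..<k}" for p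
  proof -
    have "l1 (signof p * (\<Prod>i=0..<k. F i (p i))) = l1 (\<Prod>i=0..<k. F i (p i))"
      by (cases p rule: sign_cases) auto
    also have "\<dots> \<le> (\<Prod>i=0..<k. l1 (F i (p i)))" by (rule l1_prod)
    also have "\<dots> \<le> (\<Prod>i=0..<k. B)"
      by (intro prod_mono) (use assms that permutes_less in auto)
    finally show ?thesis by simp
  qed
  then have "l1 (det (mat k k (\<lambda>(i, j). F i j))) \<le> (\<Sum>p | p permutes {0..<k}. B ^ k)"
    unfolding det_mat_expand by (intro order.trans[OF l1_sum] sum_mono) auto
  also have "\<dots> = fact k * B ^ k" by (simp add: card_permutations[of "{0..<k}" k])
  also have "\<dots> \<le> real k ^ k * B ^ k"
    by (intro mult_right_mono) (use assms(2) fact_le_power[of k, where 'a = real] in auto)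
  finally show ?thesis by (simp add: power_mult_distrib)
qed

section \<open>Derivatives of products in separate variables, and size estimates\<close>

lemma vars_in_hasse: "vars_in A P \<Longrightarrow> vars_in A (hasse d P)"
proof -
  assume "vars_in A P"
  then have "keys (e + d) \<subseteq> A" if "e \<in> keys (hasse d P)" for e
    using keys_hasse[OF that] by (auto simp: vars_in_def)
  moreover have "keys e \<subseteq> keys (e + d)" for e :: monom by (auto simp: in_keys_iff lookup_add)
  ultimately show ?thesis by (auto simp: vars_in_def)
qed

lemma mbinom_disjoint:
  assumes "m \<notin> keys a" "m \<notin> keys d"
  shows "mbinom (a + single m u) (d + single m s) = mbinom a d * (u choose s)"
proof -
  have k: "keys (d + single m s) \<subseteq> insert m (keys d)"
    using keys_add[of d "single m s"] by (auto split: if_splits)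
  have "mbinom (a + single m u) (d + single m s)
      = (u choose s) * (\<Prod>h\<in>keys d. lookup (a + single m u) h choose lookup (d + single m s) h)"
    unfolding mbinom_superset[OF _ k, simplified] using assms by (simp add: lookup_add in_keys_iff)
  also have "(\<Prod>h\<in>keys d. lookup (a + single m u) h choose lookup (d + single m s) h) = mbinom a d"
    unfolding mbinom_def using assms
    by (intro prod.cong refl) (auto simp: lookup_add lookup_single when_def)
  finally show ?thesis by (simp add: mult.commute)
qed

text \<open>The derivative in the last variable acts on one factor and the remaining ones on the
  other. This is what turns the matrix of mixed derivatives into a product of two Wronskian
  matrices.\<close>

lemma hasse_mult_disjoint:
  assumes P: "vars_in A P" and Q: "vars_in {m} Q" and m: "m \<notin> A" "m \<notin> keys d"
  shows "hasse (d + single m s) (P * Q) = hasse d P * hasse (single m s) Q"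
proof (rule poly_mapping_eqI)
  fix x :: monom
  obtain i where x: "x = i + single m (lookup x m)" and "keys i = keys x - {m}" by (rule monom_split)
  then have i: "m \<notin> keys i" by simp
  define t where "t = lookup x m"
  have id: "m \<notin> keys (i + d)" using i m keys_add[of i d] by blast
  have eq: "x + (d + single m s) = (i + d) + single m (t + s)"
    by (subst x) (simp add: t_def single_add add_ac)
  have "lookup (hasse (d + single m s) (P * Q)) x
      = real (mbinom (i + d) d * ((t + s) choose s)) * lookup (P * Q) ((i + d) + single m (t + s))"
    unfolding lookup_hasse eq by (subst mbinom_disjoint[OF id m(2)]) simp
  also have "\<dots> = (real (mbinom (i + d) d) * lookup P (i + d)) * (real ((t + s) choose s) * lookup Q (single m (t + s)))"
    by (subst lookup_mult_disjoint[OF P Q m(1) id]) simp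
  also have "\<dots> = lookup (hasse d P) i * lookup (hasse (single m s) Q) (single m t)"
    by (simp add: lookup_hasse mbinom_superset[of "{m}"] flip: single_add)
  also have "\<dots> = lookup (hasse d P * hasse (single m s) Q) (i + single m t)"
    by (rule lookup_mult_disjoint[symmetric, OF vars_in_hasse[OF P] vars_in_hasse[OF Q] m(1) i])
  finally show "lookup (hasse (d + single m s) (P * Q)) x = lookup (hasse d P * hasse (single m s) Q) x"
    using x by (simp add: t_def)
qed

lemma vars_in_shift_monom: "vars_in (keys e) (shift_monom \<xi> m e)"
proof (induction m)
  case (Suc m)
  have eq: "shift_monom \<xi> (Suc m) e = shift_monom \<xi> m e * (single (single m 1) 1 + single 0 (\<xi> m)) ^ lookup e m"
    by (simp add: shift_monom_def)
  show ?case
  proof (cases "m \<in> keys e")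
    case True
    have "vars_in (keys e \<union> {m}) (shift_monom \<xi> (Suc m) e)"
      unfolding eq by (rule vars_in_mult[OF Suc vars_in_binomial_power_mpoly])
    then show ?thesis using True by (simp add: insert_absorb)
  qed (use Suc eq in \<open>simp add: in_keys_iff\<close>)
qed (simp add: shift_monom_def vars_in_def)

lemma vars_in_shift_mono: "vars_in A P \<Longrightarrow> vars_in A (shift \<xi> m P)"
proof -
  assume A: "vars_in A P"
  have "keys j \<subseteq> A" if "lookup (shift \<xi> m P) j \<noteq> 0" for j
  proof -
    have "\<exists>e\<in>keys P. lookup (shift_monom \<xi> m e) j \<noteq> 0"
    proof (rule ccontr)
      assume "\<not> ?thesis"
      then show False using that by (simp add: shift_def lookup_lin)
    qed
    then obtain e where e: "e \<in> keys P" "j \<in> keys (shift_monom \<xi> m e)"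
      by (auto simp: in_keys_iff)
    then have "keys j \<subseteq> keys e" "keys e \<subseteq> A"
      using vars_in_shift_monom[of e \<xi> m] A by (simp_all add: vars_in_def)
    then show ?thesis by (rule order.trans)
  qed
  then show ?thesis by (simp add: vars_in_def in_keys_iff)
qed

lemma shift_Suc_eq: "vars_in {..<m} P \<Longrightarrow> shift \<xi> (Suc m) P = shift \<xi> m P"
  unfolding shift_def lin_def
proof (intro sum.cong refl)
  fix e assume "vars_in {..<m} P" "e \<in> keys P"
  then have "lookup e m = 0" 
    by (auto simp: vars_in_def in_keys_iff subset_iff)
  then show "single 0 (lookup P e) * shift_monom \<xi> (Suc m) e = single 0 (lookup P e) * shift_monom \<xi> m e"
    by (simp add: shift_monom_def)
qed

lemma mbinom_le: 
  assumes "finite S" "keys d \<subseteq> S"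
  shows "mbinom e d \<le> 2 ^ (\<Sum>h\<in>S. lookup e h)"
proof -
  have b: "n choose k \<le> 2 ^ n" for n k :: nat
    by (cases "k \<le> n") (use choose_row_sum[of n] member_le_sum[of k "{..n}" "\<lambda>k. n choose k"] in \<open>auto simp: binomial_eq_0\<close>)
  show ?thesis
    unfolding mbinom_superset[OF assms] power_sum by (intro prod_mono) (auto intro: b)
qed

lemma l1_hasse:
  assumes "finite S" "keys d \<subseteq> S" "\<And>e. e \<in> keys P \<Longrightarrow> 2 ^ (\<Sum>h\<in>S. lookup e h) \<le> B"
  shows "l1 (hasse d P) \<le> B * l1 P"
proof -
  have "l1 (hasse d P) = (\<Sum>e\<in>keys (hasse d P). real (mbinom (e + d) d) * \<bar>lookup P (e + d)\<bar>)"
    by (simp add: l1_def lookup_hasse abs_mult)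
  also have "\<dots> \<le> (\<Sum>e\<in>keys (hasse d P). B * \<bar>lookup P (e + d)\<bar>)"
  proof (intro sum_mono mult_right_mono)
    fix e assume "e \<in> keys (hasse d P)"
    then have "2 ^ (\<Sum>h\<in>S. lookup (e + d) h) \<le> B" by (intro assms(3) keys_hasse)
    moreover have "real (mbinom (e + d) d) \<le> 2 ^ (\<Sum>h\<in>S. lookup (e + d) h)"
      using of_nat_mono[OF mbinom_le[OF assms(1,2), of "e + d"], where 'a = real] by simp
    ultimately show "real (mbinom (e + d) d) \<le> B" by linarith
  qed simp
  also have "\<dots> = (\<Sum>e\<in>(\<lambda>e. e + d) ` keys (hasse d P). B * \<bar>lookup P e\<bar>)"
    by (subst sum.reindex) (auto intro: inj_onI)
  also have "\<dots> \<le> (\<Sum>e\<in>keys P. B * \<bar>lookup P e\<bar>)"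
  proof (rule sum_mono2)
    fix e assume "e \<in> keys P - (\<lambda>e. e + d) ` keys (hasse d P)"
    then have "0 \<le> B" using assms(3)[of e] by (meson DiffD1 order.trans zero_le_numeral zero_le_power)
    then show "0 \<le> B * \<bar>lookup P e\<bar>" by simp
  qed (use keys_hasse in auto)
  finally show ?thesis by (simp add: l1_def sum_distrib_left)
qed

text \<open>Meant for polynomials whose coefficients are a selection of those of \<open>W\<close>,
  such as the integral multiples of the two factors of a Wronskian.\<close>

lemma l1_slice:
  fixes g :: "monom \<Rightarrow> monom"
  assumes "inj_on g (keys U)" "\<And>i. i \<in> keys U \<Longrightarrow> lookup U i = lookup W (g i)"
  shows "l1 U \<le> l1 W"
proof -
  have "l1 U = (\<Sum>i\<in>keys U. \<bar>lookup W (g i)\<bar>)" using assms(2) by (simp add: l1_def)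
  also have "\<dots> = (\<Sum>i\<in>g ` keys U. \<bar>lookup W i\<bar>)" by (subst sum.reindex) (use assms in auto)
  also have "\<dots> \<le> l1 W"
    unfolding l1_def by (rule sum_mono2) (use assms in \<open>auto simp: in_keys_iff\<close>)
  finally show ?thesis .
qed

text \<open>The terms with j \<le> (k - 1) \<epsilon> / 4 are at least \<epsilon> D / 4 each, and
  there are at least k \<epsilon> / 8 of them.\<close>

lemma truncated_sum_lower_bound:
  fixes \<epsilon> D N :: real
  assumes "0 < \<epsilon>" "\<epsilon> \<le> 1" "N * (real k - 1) \<le> D" "0 < k" "0 < D" "0 \<le> N"
  shows "real k * \<epsilon>\<^sup>2 * D / 32 \<le> (\<Sum>j<k. max 0 (\<epsilon> * D / 2 - N * real j))"
proof -
  define r where "r = nat \<lfloor>(real k - 1) * \<epsilon> / 4\<rfloor>"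
  have r1: "real r \<le> (real k - 1) * \<epsilon> / 4"
    unfolding r_def by (rule of_nat_floor) (use assms in simp)
  have r2: "(real k - 1) * \<epsilon> / 4 < real r + 1"
    unfolding r_def using assms by linarith
  have "(real k - 1) * \<epsilon> / 4 \<le> (real k - 1) * 1"
    using mult_left_mono[of "\<epsilon> / 4" 1 "real k - 1"] assms by simp
  then have "real r < real k" using r1 by simp
  then have rk: "r < k" by simp
  have "(real r + 1) * (\<epsilon> * D / 4) = (\<Sum>j<Suc r. \<epsilon> * D / 4)" by (simp add: algebra_simps)
  also have "\<dots> \<le> (\<Sum>j<Suc r. max 0 (\<epsilon> * D / 2 - N * real j))"
  proof (rule sum_mono)
    fix j assume "j \<in> {..<Suc r}"
    then have "real j \<le> (real k - 1) * \<epsilon> / 4" using r1 by auto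
    then have "N * real j \<le> N * ((real k - 1) * \<epsilon> / 4)" using assms(6) by (rule mult_left_mono)
    also have "\<dots> = (N * (real k - 1)) * (\<epsilon> / 4)" by simp
    also have "\<dots> \<le> D * (\<epsilon> / 4)" using assms by (intro mult_right_mono) auto
    finally have "\<epsilon> * D / 4 \<le> \<epsilon> * D / 2 - N * real j" by (simp add: field_simps)
    then show "\<epsilon> * D / 4 \<le> max 0 (\<epsilon> * D / 2 - N * real j)" by (rule max.coboundedI2)
  qed
  also have "\<dots> \<le> (\<Sum>j<k. max 0 (\<epsilon> * D / 2 - N * real j))"
    by (rule sum_mono2) (use rk in auto)
  finally have *: "(real r + 1) * (\<epsilon> * D / 4) \<le> (\<Sum>j<k. max 0 (\<epsilon> * D / 2 - N * real j))" .
  \<comment> \<open>For k \<ge> 2 this follows from k \<le> 2 (k - 1); for k = 1 the single term j =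
    0 suffices.\<close>
  have "real k * \<epsilon> / 8 \<le> real r + 1"
  proof (cases "k = 1")
    case True
    then show ?thesis using assms by simp
  next
    case False
    then have "2 \<le> k" using assms(4) by simp
    then have "real k * \<epsilon> \<le> (2 * (real k - 1)) * \<epsilon>" using assms by (intro mult_right_mono) auto
    then show ?thesis using r2 by (simp add: field_simps)
  qed
  then have "(real k * \<epsilon> / 8) * (\<epsilon> * D / 4) \<le> (real r + 1) * (\<epsilon> * D / 4)"
    using assms by (intro mult_right_mono) auto
  also note *
  finally show ?thesis by (simp add: power2_eq_square mult_ac)
qed

lemma lookup_sum_single:
  fixes g :: "monom \<Rightarrow> real"
  assumes "finite S" "\<And>x. g x \<noteq> 0 \<Longrightarrow> x \<in> S"
  shows "lookup (\<Sum>i\<in>S. single i (g i)) x = g x"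
proof -
  have "lookup (\<Sum>i\<in>S. single i (g i)) x = (\<Sum>i\<in>S. if i = x then g i else 0)"
    by (simp add: lookup_sum lookup_single when_def)
  also have "\<dots> = g x" using assms by (auto simp: sum.delta)
  finally show ?thesis .
qed

text \<open>The coefficients of \<open>P\<close> form a matrix with rows indexed by monomials in the
  first \<open>m\<close> variables and columns by powers of the last one; a rank decomposition of it
  separates that variable.\<close>

lemma mpoly_rank_decomposition:
  assumes P: "vars_in {..<Suc m} P"
  shows "\<exists>(k::nat) \<Phi> \<Psi> e f. P = (\<Sum>l<k. \<Phi> l * \<Psi> l) \<and> inj_on e {..<k} \<and> inj_on f {..<k} \<and>
     (\<forall>l<k. vars_in {..<m} (\<Phi> l) \<and> vars_in {m} (\<Psi> l) \<and> e l \<in> keys (\<Phi> l) \<and> f l \<in> keys (\<Psi> l) \<and>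
        (\<forall>i\<in>keys (\<Phi> l). e l \<le> i) \<and> (\<forall>j\<in>keys (\<Psi> l). f l \<le> j) \<and>
        (\<exists>x\<in>keys P. f l = single m (lookup x m)))"
proof -
  define R where "R = (\<lambda>x. x - single m (lookup x m)) ` keys P"
  define C where "C = (\<lambda>x. single m (lookup x m)) ` keys P"
  \<comment> \<open>Without the guard, other splittings \<open>i + j\<close> of a monomial of
    \<open>P\<close> would produce further entries.\<close>
  define A where "A i j = (if i \<in> R \<and> j \<in> C then lookup P (i + j) else 0)" for i j
  have fin: "finite R" "finite C" by (auto simp: R_def C_def)
  have supp: "\<forall>i j. A i j \<noteq> 0 \<longrightarrow> i \<in> R \<and> j \<in> C" by (auto simp: A_def)
  have R: "keys i \<subseteq> {..<m}" if "i \<in> R" for i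
  proof -
    from that obtain x where x: "x \<in> keys P" "i = x - single m (lookup x m)" by (auto simp: R_def)
    have "keys x \<subseteq> {..<Suc m}" using P x by (auto simp: vars_in_def)
    moreover have "h \<noteq> m \<and> h \<in> keys x" if "h \<in> keys i" for h
      using that unfolding x(2) in_keys_iff lookup_minus by (metis diff_0_eq_0 diff_self_eq_0 lookup_single_eq)
    ultimately show ?thesis by (fastforce simp: less_Suc_eq)
  qed
  have C: "keys j \<subseteq> {m}" if "j \<in> C" for j
    using that by (auto simp: C_def split: if_splits)
  have A: "A i (single m t) = lookup P (i + single m t)" if "m \<notin> keys i" for i t
  proof (cases "i + single m t \<in> keys P")
    case False
    then show ?thesis by (simp add: A_def in_keys_iff)
  next
    case True
    have "lookup (i + single m t) m = t" using that by (simp add: lookup_add in_keys_iff)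
    moreover have "i + single m t - single m t = i" by simp
    ultimately have "i \<in> R" "single m t \<in> C"
      using True unfolding R_def C_def by (force intro: image_eqI)+
    then show ?thesis by (simp add: A_def)
  qed
  from rank_decomposition[OF fin supp] obtain k :: nat and \<phi> \<psi> e f where
    "\<forall>i j. A i j = (\<Sum>l<k. \<phi> l i * \<psi> l j)" and inj: "inj_on e {..<k}" "inj_on f {..<k}" and
    *: "\<forall>l<k. e l \<in> R \<and> f l \<in> C \<and> \<phi> l (e l) \<noteq> 0 \<and> \<psi> l (f l) \<noteq> 0 \<and>
        (\<forall>i. \<phi> l i \<noteq> 0 \<longrightarrow> i \<in> R \<and> e l \<le> i) \<and> (\<forall>j. \<psi> l j \<noteq> 0 \<longrightarrow> j \<in> C \<and> f l \<le> j)"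
    by (elim exE conjE) (rule that)
  then have dec: "A i j = (\<Sum>l<k. \<phi> l i * \<psi> l j)" for i j by blast
  define \<Phi> where "\<Phi> l = (\<Sum>i\<in>R. single i (\<phi> l i))" for l
  define \<Psi> where "\<Psi> l = (\<Sum>j\<in>C. single j (\<psi> l j))" for l
  have \<Phi>: "lookup (\<Phi> l) x = \<phi> l x" if "l < k" for l x
    unfolding \<Phi>_def by (rule lookup_sum_single) (use fin * that in blast)+
  have \<Psi>: "lookup (\<Psi> l) x = \<psi> l x" if "l < k" for l x
    unfolding \<Psi>_def by (rule lookup_sum_single) (use fin * that in blast)+
  have v\<Phi>: "vars_in {..<m} (\<Phi> l)" if "l < k" for l
    using * that R by (auto simp: vars_in_def in_keys_iff[of _ "\<Phi> l"] \<Phi>)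
  have v\<Psi>: "vars_in {m} (\<Psi> l)" if "l < k" for l
    using * that C by (auto simp: vars_in_def in_keys_iff[of _ "\<Psi> l"] \<Psi>)
  have "P = (\<Sum>l<k. \<Phi> l * \<Psi> l)"
  proof (rule poly_mapping_eqI)
    fix x :: monom
    obtain i where x: "x = i + single m (lookup x m)" and "keys i = keys x - {m}" by (rule monom_split)
    then have i: "m \<notin> keys i" by simp
    have "lookup P (i + single m (lookup x m)) = (\<Sum>l<k. \<phi> l i * \<psi> l (single m (lookup x m)))"
      unfolding A[OF i, symmetric] by (rule dec)
    also have "\<dots> = (\<Sum>l<k. lookup (\<Phi> l * \<Psi> l) (i + single m (lookup x m)))"
    proof (rule sum.cong[OF refl])
      fix l assume "l \<in> {..<k}"
      then have l: "l < k" by simp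
      show "\<phi> l i * \<psi> l (single m (lookup x m)) = lookup (\<Phi> l * \<Psi> l) (i + single m (lookup x m))"
        using i by (subst lookup_mult_disjoint[OF v\<Phi>[OF l] v\<Psi>[OF l]]) (auto simp: \<Phi> \<Psi> l)
    qed
    finally show "lookup P x = lookup (\<Sum>l<k. \<Phi> l * \<Psi> l) x"
      using x by (metis lookup_sum)
  qed
  moreover have "e l \<in> keys (\<Phi> l) \<and> f l \<in> keys (\<Psi> l) \<and>
        (\<forall>i\<in>keys (\<Phi> l). e l \<le> i) \<and> (\<forall>j\<in>keys (\<Psi> l). f l \<le> j) \<and>
        (\<exists>x\<in>keys P. f l = single m (lookup x m))" if "l < k" for l
  proof -
    have "f l \<in> C" using * that by blast
    then have "\<exists>x\<in>keys P. f l = single m (lookup x m)" by (auto simp: C_def)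
    then show ?thesis using * that by (simp add: in_keys_iff[of _ "\<Phi> l"] in_keys_iff[of _ "\<Psi> l"] \<Phi> \<Psi>)
  qed
  ultimately show ?thesis using inj v\<Phi> v\<Psi> by blast
qed

text \<open>From P = \<Sum> \<Phi> l \<Psi> l, the matrix of mixed derivatives is the Wronskian
  matrix of the \<Phi> l times the transpose of that of the \<Psi> l. Its size is at most
  \<open>Suc d\<close> because the lowest terms of the \<Psi> l are distinct powers of one
  variable.\<close>

lemma wronskian_factorization:
  assumes P: "vars_in {..<Suc m} P" "P \<noteq> 0" and d: "\<forall>x\<in>keys P. lookup x m \<le> d"
  shows "\<exists>k \<delta> s U V. 0 < k \<and> k \<le> Suc d \<and>
     (\<forall>i<k. keys (\<delta> i) \<subseteq> {..<m} \<and> (\<Sum>h<m. lookup (\<delta> i) h) \<le> i \<and> s i \<le> i) \<and>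
     vars_in {..<m} U \<and> vars_in {m} V \<and> U \<noteq> 0 \<and> V \<noteq> 0 \<and>
     U * V = det (mat k k (\<lambda>(i, j). hasse (\<delta> i + single m (s j)) P))"
proof -
  from mpoly_rank_decomposition[OF P(1)] obtain k :: nat and \<Phi> \<Psi> e f where
    PP: "P = (\<Sum>l<k. \<Phi> l * \<Psi> l)" and inj: "inj_on e {..<k}" "inj_on f {..<k}" and
    *: "\<forall>l<k. vars_in {..<m} (\<Phi> l) \<and> vars_in {m} (\<Psi> l) \<and> e l \<in> keys (\<Phi> l) \<and> f l \<in> keys (\<Psi> l) \<and>
        (\<forall>i\<in>keys (\<Phi> l). e l \<le> i) \<and> (\<forall>j\<in>keys (\<Psi> l). f l \<le> j) \<and>
        (\<exists>x\<in>keys P. f l = single m (lookup x m))"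
    by (elim exE conjE) (rule that)
  have "k \<noteq> 0" using PP P(2) by (intro notI) simp
  have "f l \<in> single m ` {..d}" if "l < k" for l
  proof -
    from that * obtain x where "x \<in> keys P" "f l = single m (lookup x m)" by blast
    then show ?thesis using d by auto
  qed
  then have "card (f ` {..<k}) \<le> card (single m ` {..d} :: monom set)"
    by (intro card_mono finite_imageI) auto
  also have "\<dots> \<le> Suc d" using card_image_le[of "{..d}" "single m"] by simp
  finally have "k \<le> Suc d" using inj by (simp add: card_image)
  have ke: "keys (e l) \<subseteq> {..<m}" if "l < k" for l using * that by (auto simp: vars_in_def)
  have kf: "keys (f l) \<subseteq> {m}" if "l < k" for l using * that by (auto simp: vars_in_def)
  from binomial_minor_nonzero[of "{..<m}", OF _ inj(1) ke] obtain \<delta> where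
    \<delta>: "\<And>i. i < k \<Longrightarrow> keys (\<delta> i) \<subseteq> {..<m} \<and> (\<Sum>h<m. lookup (\<delta> i) h) \<le> i"
      "det (mat k k (\<lambda>(i, l). real (mbinom (e l) (\<delta> i)))) \<noteq> 0" by auto
  from binomial_minor_nonzero[of "{m}", OF _ inj(2) kf] obtain \<eta> where
    \<eta>: "\<And>i. i < k \<Longrightarrow> keys (\<eta> i) \<subseteq> {m} \<and> (\<Sum>h\<in>{m}. lookup (\<eta> i) h) \<le> i"
      "det (mat k k (\<lambda>(i, l). real (mbinom (f l) (\<eta> i)))) \<noteq> 0" by auto
  define s where "s i = lookup (\<eta> i) m" for i
  have s: "\<eta> i = single m (s i)" "s i \<le> i" if "i < k" for i
    using \<eta>(1)[OF that] keys_subset_single unfolding s_def by auto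
  let ?A = "mat k k (\<lambda>(i, l). hasse (\<delta> i) (\<Phi> l))"
  let ?B = "mat k k (\<lambda>(i, l). hasse (\<eta> i) (\<Psi> l))"
  have "det ?A \<noteq> 0" by (rule wronskian_nonzero[of k \<Phi> e]) (use * \<delta> in auto)
  moreover have "det ?B \<noteq> 0" by (rule wronskian_nonzero[of k \<Psi> f]) (use * \<eta> in auto)
  moreover have "vars_in {..<m} (det ?A)"
    by (intro vars_in_det vars_in_hasse) (use * in auto)
  moreover have "vars_in {m} (det ?B)"
    by (intro vars_in_det vars_in_hasse) (use * in auto)
  moreover have "det ?A * det ?B = det (mat k k (\<lambda>(i, j). hasse (\<delta> i + single m (s j)) P))"
  proof -
    have "det ?A * det ?B = det ?A * det (transpose_mat ?B)"
      by (subst det_transpose[of _ k]) auto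
    also have "\<dots> = det (?A * transpose_mat ?B)"
      by (rule det_mult[symmetric, of _ k]) auto
    also have "?A * transpose_mat ?B = mat k k (\<lambda>(i, j). hasse (\<delta> i + single m (s j)) P)"
    proof (rule eq_matI)
      fix i j assume "i < dim_row (mat k k (\<lambda>(i, j). hasse (\<delta> i + single m (s j)) P))"
        "j < dim_col (mat k k (\<lambda>(i, j). hasse (\<delta> i + single m (s j)) P))"
      then have ij: "i < k" "j < k" by auto
      have "(?A * transpose_mat ?B) $$ (i, j) = (\<Sum>l<k. hasse (\<delta> i) (\<Phi> l) * hasse (single m (s j)) (\<Psi> l))"
        using ij s by (simp add: scalar_prod_def atLeast0LessThan)
      also have "\<dots> = (\<Sum>l<k. hasse (\<delta> i + single m (s j)) (\<Phi> l * \<Psi> l))"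
        by (intro sum.cong refl hasse_mult_disjoint[symmetric, of "{..<m}"]) (use * \<delta>(1)[OF ij(1)] in auto)
      also have "\<dots> = hasse (\<delta> i + single m (s j)) P" unfolding PP by (simp add: hasse_sum)
      finally show "(?A * transpose_mat ?B) $$ (i, j)
          = mat k k (\<lambda>(i, j). hasse (\<delta> i + single m (s j)) P) $$ (i, j)" using ij by simp
    qed auto
    finally show ?thesis .
  qed
  ultimately show ?thesis using \<open>k \<noteq> 0\<close> \<open>k \<le> Suc d\<close> \<delta>(1) s(2)
    by (intro exI[of _ k] exI[of _ \<delta>] exI[of _ s] exI[of _ "det ?A"] exI[of _ "det ?B"]) auto
qed

section \<open>Roth's lemma\<close>

text \<open>The variable of index \<open>h\<close> has weight \<open>n h\<close>, and \<open>b ^ n h\<close> is a lower bound for the height of \<open>p h / q h\<close>. The bound on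
  \<open>l1 P\<close> is stated relative to \<open>D\<close> because a \<open>k\<close>-rowed Wronskian multiplies \<open>D\<close> by \<open>k\<close> and raises the norm to
  the power \<open>k\<close>, up to a factor that only affects \<open>C\<close>.\<close>

definition roth_hyp :: "real \<Rightarrow> real \<Rightarrow> real \<Rightarrow> nat \<Rightarrow> (nat \<Rightarrow> nat) \<Rightarrow> (nat \<Rightarrow> int) \<Rightarrow> (nat \<Rightarrow> int) \<Rightarrow> mpoly \<Rightarrow> nat \<Rightarrow> bool"
  where "roth_hyp T b C m n p q P D \<longleftrightarrow>
    (\<forall>h<m. T \<le> real (n h) \<and> coprime (p h) (q h) \<and> q h \<noteq> 0 \<and> b ^ n h \<le> \<bar>of_int (p h)\<bar> \<and>
       (\<forall>e\<in>keys P. n h * lookup e h \<le> D)) \<and>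
    (\<forall>h. Suc h < m \<longrightarrow> T * real (n h) \<le> real (n (Suc h))) \<and>
    P \<noteq> 0 \<and> int_coeffs P \<and> vars_in {..<m} P \<and> 0 < D \<and> l1 P \<le> C powr (real D / real (n 0))"

definition roth_concl :: "real \<Rightarrow> nat \<Rightarrow> (nat \<Rightarrow> nat) \<Rightarrow> (nat \<Rightarrow> int) \<Rightarrow> (nat \<Rightarrow> int) \<Rightarrow> mpoly \<Rightarrow> nat \<Rightarrow> bool"
  where "roth_concl \<epsilon> m n p q P D \<longleftrightarrow>
    (\<exists>e\<in>keys (shift (\<lambda>h. of_int (p h) / of_int (q h)) m P). real (wt n m e) \<le> \<epsilon> * real D)"

lemma roth_hyp_mono:
  assumes "roth_hyp T b C m n p q P D" "T' \<le> T"
  shows "roth_hyp T' b C m n p q P D"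
proof -
  have "T' * real (n h) \<le> real (n (Suc h))" if "T * real (n h) \<le> real (n (Suc h))" for h
    using that mult_right_mono[OF assms(2), of "real (n h)"] by linarith
  then show ?thesis using assms unfolding roth_hyp_def by (meson order.trans)
qed

lemma shift_no_vars: "vars_in {..<0} P \<Longrightarrow> shift \<xi> 0 P = P"
  using shift_by_zero[of 0 P] by (simp add: shift_def shift_monom_def[abs_def])

text \<open>The logarithm of \<open>index_one_variable\<close>: since |p| \<ge> b^N, vanishing to
  order l gives N l ln b \<le> ln (l1 V).\<close>

lemma index_one_variable_exists:
  fixes p q :: int and b B \<epsilon> :: real
  assumes V: "int_coeffs V" "V \<noteq> 0" "vars_in {m} V"
    and pq: "coprime p q" "q \<noteq> 0" "\<xi> m = of_int p / of_int q"
    and b: "1 < b" "b ^ N \<le> \<bar>of_int p\<bar>" "0 < N"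
    and B: "ln (l1 V) \<le> B * ln b"
  shows "\<exists>t. lookup (shift \<xi> (Suc m) V) (single m t) \<noteq> 0 \<and> real (N * t) \<le> B"
proof -
  have "0 < b ^ N" using b by simp
  with b(2) have p0: "p \<noteq> 0" by auto
  have le: "real (N * l) \<le> B" if "\<And>t. t < l \<Longrightarrow> lookup (shift \<xi> (Suc m) V) (single m t) = 0" for l
  proof -
    have "b ^ (N * l) \<le> \<bar>of_int p\<bar> ^ l"
      unfolding power_mult by (rule power_mono) (use b in auto)
    also have "\<dots> \<le> l1 V"
      by (rule index_one_variable[where \<xi> = \<xi> and m = m, OF V pq(1) p0 pq(2,3)]) (rule that)
    finally have "b ^ (N * l) \<le> l1 V" .
    moreover have "0 < b ^ (N * l)" using b(1) by simp
    ultimately have "ln (b ^ (N * l)) \<le> ln (l1 V)" by simp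
    moreover have "ln (b ^ (N * l)) = real (N * l) * ln b" by (rule ln_realpow)
    ultimately have "real (N * l) * ln b \<le> B * ln b" using B by linarith
    moreover have "0 < ln b" using b(1) by simp
    ultimately show ?thesis by (rule mult_right_le_imp_le)
  qed
  define l where "l = (LEAST t. lookup (shift \<xi> (Suc m) V) (single m t) \<noteq> 0)"
  have "\<exists>t. lookup (shift \<xi> (Suc m) V) (single m t) \<noteq> 0"
  proof (rule ccontr)
    assume "\<not> ?thesis"
    then have *: "real (N * l) \<le> B" for l using le by blast
    have "real l \<le> real (N * l)" for l using b(3) by (cases N) auto
    then have "real l \<le> B" for l using * order.trans by blast
    then show False by (meson not_le reals_Archimedean2)
  qed
  then have "lookup (shift \<xi> (Suc m) V) (single m l) \<noteq> 0" unfolding l_def by (rule LeastI_ex)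
  moreover have "real (N * l) \<le> B" by (rule le) (use not_less_Least l_def in blast)
  ultimately show ?thesis by blast
qed

section \<open>Order of vanishing and norm of the Wronskian\<close>

lemma weights_mono:
  assumes "\<And>h. Suc h < m \<Longrightarrow> T * real (n h) \<le> real (n (Suc h))" "1 \<le> T" "i \<le> j" "j < m"
  shows "n i \<le> n j"
  using assms(3,4)
proof (induction j rule: dec_induct)
  case (step j)
  have "1 * real (n j) \<le> T * real (n j)" using assms(2) by (intro mult_right_mono) auto
  also have "\<dots> \<le> real (n (Suc j))" using assms(1) step by simp
  finally show ?case using step by simp
qed simp

lemma wt_Suc_single:
  "m \<notin> keys e \<Longrightarrow> wt n (Suc m) (e + single m t) = wt n m e + n m * t"
proof -
  assume "m \<notin> keys e"
  then have "lookup (e + single m t) m = t" by (simp add: lookup_add in_keys_iff)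
  moreover have "wt n m (e + single m t) = wt n m e"
    unfolding wt_def by (intro sum.cong refl) (auto simp: lookup_add lookup_single when_def)
  ultimately show ?thesis by (simp add: wt_def)
qed

text \<open>A derivative lowers the weighted order at most by its own weight. In each Leibniz term
  the row part \<open>\<delta> i\<close> uses at most half of \<epsilon> D and column j uses at most
  \<open>n m * j\<close>; the sum over the columns is the same for every permutation. The maximum
  with 0 is allowed because weights are nonnegative.\<close>

lemma wronskian_order_lower_bound:
  assumes ord: "\<And>e. e \<in> keys (shift \<xi> (Suc m) P) \<Longrightarrow> \<epsilon> * real D < real (wt n (Suc m) e)"
    and \<delta>: "\<And>i. i < k \<Longrightarrow> keys (\<delta> i) \<subseteq> {..<m} \<and> real (wt n m (\<delta> i)) \<le> \<epsilon> * real D / 2 \<and> s i \<le> i"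
    and x: "x \<in> keys (shift \<xi> (Suc m) (det (mat k k (\<lambda>(i, j). hasse (\<delta> i + single m (s j)) P))))"
  shows "(\<Sum>j<k. max 0 (\<epsilon> * real D / 2 - real (n m) * real j)) \<le> real (wt n (Suc m) x)"
proof -
  obtain p g where p: "p permutes {0..<k}"
    and g: "\<forall>i<k. g i \<in> keys (shift \<xi> (Suc m) (hasse (\<delta> i + single m (s (p i))) P))"
    and xg: "x = (\<Sum>i<k. g i)"
    using keys_det[of x k "\<lambda>i j. shift \<xi> (Suc m) (hasse (\<delta> i + single m (s j)) P)"] x
    unfolding shift_det by blast
  have each: "max 0 (\<epsilon> * real D / 2 - real (n m) * real (p i)) \<le> real (wt n (Suc m) (g i))" if i: "i < k" for i
  proof -
    have pi: "p i < k" using p i by (rule permutes_less)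
    let ?d = "\<delta> i + single m (s (p i))"
    have d: "m \<notin> keys (\<delta> i)" "keys ?d \<subseteq> {..<Suc m}"
      using \<delta>[OF i] keys_add[of "\<delta> i" "single m (s (p i))"] by (auto split: if_splits)
    have "g i \<in> keys (hasse ?d (shift \<xi> (Suc m) P))"
      using g i d by (simp add: hasse_shift)
    then have "g i + ?d \<in> keys (shift \<xi> (Suc m) P)" by (rule keys_hasse)
    from ord[OF this] have "\<epsilon> * real D < real (wt n (Suc m) (g i)) + (real (wt n m (\<delta> i)) + real (n m * s (p i)))"
      using d by (simp add: wt_add[of _ _ "g i"] wt_Suc_single)
    moreover have "real (n m * s (p i)) \<le> real (n m) * real (p i)"
      using \<delta>[OF pi] by (simp add: mult_left_mono)
    ultimately have "\<epsilon> * real D / 2 - real (n m) * real (p i) \<le> real (wt n (Suc m) (g i))"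
      using \<delta>[OF i] by linarith
    then show ?thesis by simp
  qed
  have "(\<Sum>j<k. max 0 (\<epsilon> * real D / 2 - real (n m) * real j))
      = (\<Sum>i<k. max 0 (\<epsilon> * real D / 2 - real (n m) * real (p i)))"
    using sum.permute[OF p, of "\<lambda>j. max 0 (\<epsilon> * real D / 2 - real (n m) * real j)"]
    by (simp add: o_def atLeast0LessThan)
  also have "\<dots> \<le> (\<Sum>i<k. real (wt n (Suc m) (g i)))"
    by (rule sum_mono) (use each in auto)
  also have "\<dots> = real (wt n (Suc m) x)"
  proof -
    have "wt n (Suc m) (\<Sum>i<r. g i) = (\<Sum>i<r. wt n (Suc m) (g i))" for r
      by (induction r) (auto simp: wt_add, simp add: wt_def)
    then show ?thesis by (simp add: xg)
  qed
  finally show ?thesis .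
qed

text \<open>The bound has the shape of the hypothesis on \<open>P\<close>, with \<open>k * D\<close>
  in place of \<open>D\<close>, so that it can feed the induction. Of the new factor
  \<open>2 ^ (m + 2)\<close>, the derivatives account for m + 1 powers of 2 and the size
  \<open>k\<close> of the matrix for one.\<close>

lemma wronskian_l1_bound:
  assumes n: "\<And>h. h \<le> m \<Longrightarrow> n 0 \<le> n h" "0 < n 0"
    and deg: "\<And>e h. e \<in> keys P \<Longrightarrow> h \<le> m \<Longrightarrow> n h * lookup e h \<le> D"
    and l1: "l1 P \<le> C powr (real D / real (n 0))" and C: "1 \<le> C"
    and k: "k \<le> Suc (D div n m)"
    and d: "\<And>i j. i < k \<Longrightarrow> j < k \<Longrightarrow> keys (d i j) \<subseteq> {..m}"
  shows "l1 (det (mat k k (\<lambda>(i, j). hasse (d i j) P))) \<le> (2 ^ (m + 2) * C) powr (real (k * D) / real (n 0))"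
proof -
  define E where "E = real D / real (n 0)"
  have E0: "0 \<le> E" by (simp add: E_def)
  have lk: "real (lookup e h) \<le> E" if "e \<in> keys P" "h \<le> m" for e h
  proof -
    have "n 0 * lookup e h \<le> n h * lookup e h" using n(1)[OF that(2)] by simp
    also have "\<dots> \<le> D" using deg that by blast
    finally have "real (n 0) * real (lookup e h) \<le> real D" by (metis of_nat_le_iff of_nat_mult)
    then show ?thesis using n(2) by (simp add: E_def field_simps)
  qed
  have entry: "l1 (hasse (d i j) P) \<le> 2 powr (real (m + 1) * E) * l1 P" if "i < k" "j < k" for i j
  proof (rule l1_hasse[of "{..m}"])
    fix e assume e: "e \<in> keys P"
    have "real (\<Sum>h\<in>{..m}. lookup e h) \<le> (\<Sum>h\<in>{..m}. E)"
      unfolding of_nat_sum by (rule sum_mono) (use lk e in auto)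
    then have "2 powr real (\<Sum>h\<in>{..m}. lookup e h) \<le> 2 powr (real (m + 1) * E)"
      by (intro powr_mono) auto
    then show "2 ^ (\<Sum>h\<in>{..m}. lookup e h) \<le> 2 powr (real (m + 1) * E)"
      by (subst (asm) powr_realpow) auto
  qed (use d that in auto)
  have "2 powr (real (m + 1) * E) * l1 P \<le> 2 powr (real (m + 1) * E) * C powr E"
    using l1 by (intro mult_left_mono) (auto simp: E_def)
  note order.trans[OF entry this]
  then have "l1 (det (mat k k (\<lambda>(i, j). hasse (d i j) P)))
      \<le> (real k * (2 powr (real (m + 1) * E) * C powr E)) ^ k"
    by (intro l1_det) auto
  also have "\<dots> \<le> (2 powr E * (2 powr (real (m + 1) * E) * C powr E)) ^ k"
  proof (intro power_mono mult_right_mono)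
    \<comment> \<open>Crudely Suc x \<le> 2^x, and D div n m is at most E because n 0 is the
      smallest weight.\<close>
    have "real k \<le> real (Suc (D div n m))" using k by (subst of_nat_le_iff)
    also have "\<dots> \<le> 2 ^ (D div n m)"
      using of_nat_mono[OF Suc_leI[OF less_exp[of "D div n m"]], where 'a = real] by simp
    also have "\<dots> = 2 powr real (D div n m)" by (simp add: powr_realpow)
    also have "\<dots> \<le> 2 powr E"
    proof (rule powr_mono)
      have "real (D div n m) \<le> real D / real (n m)" 
        by (rule of_nat_div_le_of_nat)
      also have "\<dots> \<le> E" unfolding E_def using n(1)[of m] n(2) by (intro divide_left_mono) auto
      finally show "real (D div n m) \<le> E" .
    qed simp
    finally show "real k \<le> 2 powr E" .
  qed auto
  also have "2 powr E * (2 powr (real (m + 1) * E) * C powr E) = (2 ^ (m + 2) * C) powr E"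
  proof -
    have "(2 ^ (m + 2) * C) powr E = (2 powr real (m + 2)) powr E * C powr E"
      using C by (subst powr_mult) (auto simp: powr_realpow[symmetric] powr_add)
    also have "(2 powr real (m + 2)) powr E = 2 powr E * 2 powr (real (m + 1) * E)"
      unfolding powr_powr powr_add[symmetric] by (simp add: algebra_simps)
    finally show ?thesis by simp
  qed
  also have "((2 ^ (m + 2) * C) powr E) ^ k = (2 ^ (m + 2) * C) powr (real (k * D) / real (n 0))"
    using C by (subst powr_realpow[symmetric]) (auto simp: powr_powr E_def mult.commute)
  finally show ?thesis .
qed

text \<open>If \<open>P\<close> vanished to higher order than claimed, its Wronskian would have
  weighted order at least k \<epsilon>^2 D / 32. But the Wronskian factors, and its order is small:
  the induction hypothesis bounds it for the factor in the first m variables, and the size of p m /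
  q m for the factor in the last one.\<close>

lemma roth_step:
  assumes IH: "\<And>\<epsilon> b C :: real. 0 < \<epsilon> \<Longrightarrow> \<epsilon> \<le> 1 \<Longrightarrow> 1 < b \<Longrightarrow> 1 \<le> C \<Longrightarrow>
      \<exists>T\<ge>1. \<forall>n p q P D. roth_hyp T b C m n p q P D \<longrightarrow> roth_concl \<epsilon> m n p q P D"
    and \<epsilon>: "0 < \<epsilon>" "\<epsilon> \<le> 1" and b: "1 < b" and C: "1 \<le> C"
  shows "\<exists>T\<ge>1. \<forall>n p q P D. roth_hyp T b C (Suc m) n p q P D \<longrightarrow> roth_concl \<epsilon> (Suc m) n p q P D"
proof -
  \<comment> \<open>Each factor contributes at most \<epsilon>' k D, and 2 \<epsilon>' =
    \<epsilon>^2 / 64 lies below the lower bound with \<epsilon>^2 / 32.\<close>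
  define \<epsilon>' where "\<epsilon>' = \<epsilon>\<^sup>2 / 128"
  define C' where "C' = 2 ^ (m + 2) * C"
  have "\<epsilon>\<^sup>2 \<le> 1" using \<epsilon> by (simp add: power_le_one)
  then have \<epsilon>': "0 < \<epsilon>'" "\<epsilon>' \<le> 1" using \<epsilon>(1) by (auto simp: \<epsilon>'_def)
  have "(1::real) \<le> 2 ^ (m + 2)" by (rule one_le_power) simp
  then have "1 * 1 \<le> 2 ^ (m + 2) * C" using C by (intro mult_mono) auto
  then have C': "1 \<le> C'" by (simp add: C'_def)
  obtain T1 where T1: "1 \<le> T1"
    "\<And>n p q P D. roth_hyp T1 b C' m n p q P D \<Longrightarrow> roth_concl \<epsilon>' m n p q P D"
    using IH[OF \<epsilon>' b C'] by blast
  \<comment> \<open>\<open>T1\<close> serves the induction hypothesis; 2 / \<epsilon> keeps the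
    derivatives \<open>\<delta> i\<close> within weight \<epsilon> D / 2; the last entry gives ln C'
    / n 0 \<le> \<epsilon>' ln b, as the one-variable factor requires.\<close>
  define T where "T = max T1 (max (2 / \<epsilon>) (ln C' / (\<epsilon>' * ln b)))"
  have T: "T1 \<le> T" "2 / \<epsilon> \<le> T" "ln C' / (\<epsilon>' * ln b) \<le> T" "1 \<le> T" using T1 by (auto simp: T_def)
  show ?thesis
  proof (intro exI[of _ T] conjI allI impI T(4))
    fix n p q P D assume H: "roth_hyp T b C (Suc m) n p q P D"
    define \<xi> :: "nat \<Rightarrow> real" where "\<xi> h = of_int (p h) / of_int (q h)" for h
    have nT: "T \<le> real (n h)" and pq: "coprime (p h) (q h)" "q h \<noteq> 0" "b ^ n h \<le> \<bar>of_int (p h)\<bar>"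
      and deg: "\<And>e. e \<in> keys P \<Longrightarrow> n h * lookup e h \<le> D" if "h < Suc m" for h
      using H that unfolding roth_hyp_def by blast+
    have nS: "T * real (n h) \<le> real (n (Suc h))" if "Suc h < Suc m" for h
      using H that unfolding roth_hyp_def by blast
    have P: "P \<noteq> 0" "int_coeffs P" "vars_in {..<Suc m} P" "0 < D" "l1 P \<le> C powr (real D / real (n 0))"
      using H unfolding roth_hyp_def by blast+
    have npos: "0 < n h" if "h < Suc m" for h using nT[OF that] T(4) by linarith
    have nmono: "n i \<le> n j" if "i \<le> j" "j < Suc m" for i j
      using weights_mono[of "Suc m" T n i j] nS T(4) that by blast
    show "roth_concl \<epsilon> (Suc m) n p q P D"
    proof (rule ccontr)
      assume "\<not> ?thesis"
      then have ord: "\<epsilon> * real D < real (wt n (Suc m) e)" if "e \<in> keys (shift \<xi> (Suc m) P)" for e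
        using that unfolding roth_concl_def \<xi>_def[abs_def] by force
      have "\<forall>x\<in>keys P. lookup x m \<le> D div n m"
        using deg[of m] npos[of m] by (simp add: less_eq_div_iff_mult_less_eq mult.commute)
      from wronskian_factorization[OF P(3,1) this] obtain k \<delta> s U V where
        k: "0 < k" "k \<le> Suc (D div n m)" and
        \<delta>: "\<forall>i<k. keys (\<delta> i) \<subseteq> {..<m} \<and> (\<Sum>h<m. lookup (\<delta> i) h) \<le> i \<and> s i \<le> i" and
        UV: "vars_in {..<m} U" "vars_in {m} V" "U \<noteq> 0" "V \<noteq> 0" and
        W: "U * V = det (mat k k (\<lambda>(i, j). hasse (\<delta> i + single m (s j)) P))"
        by (elim exE conjE) (rule that)
      define W where "W = U * V"
      have kd: "keys (\<delta> i + single m (s j)) \<subseteq> {..m}" if "i < k" for i j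
        using keys_add[of "\<delta> i" "single m (s j)"] \<delta> that by (fastforce split: if_splits)
      have nk: "real (n m) * (real k - 1) \<le> real D"
      proof -
        have "n m * (k - 1) \<le> n m * (D div n m)" using k by (intro mult_left_mono) auto
        also have "\<dots> \<le> D" by simp
        finally have "real (n m) * real (k - 1) \<le> real D" by (metis of_nat_le_iff of_nat_mult)
        then show ?thesis using k by (simp add: of_nat_diff)
      qed
      \<comment> \<open>Here rapid growth enters: the orders are at most k - 1 \<le> D / n m, while
        the weights involved are at most the previous one, which is at most \<epsilon> / 2 times n
        m.\<close>
      have wt\<delta>: "real (wt n m (\<delta> i)) \<le> \<epsilon> * real D / 2" if i: "i < k" for i
      proof (cases m)
        case 0
        then show ?thesis using \<epsilon> by (simp add: wt_def)
      next
        case (Suc m')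
        have "wt n m (\<delta> i) \<le> (\<Sum>h<m. n m' * lookup (\<delta> i) h)"
          unfolding wt_def by (intro sum_mono mult_right_mono nmono) (use Suc in auto)
        also have "\<dots> = n m' * (\<Sum>h<m. lookup (\<delta> i) h)" by (simp add: sum_distrib_left)
        also have "\<dots> \<le> n m' * (k - 1)" using \<delta> i by (intro mult_left_mono) (auto intro: order.trans)
        finally have "real (wt n m (\<delta> i)) \<le> real (n m' * (k - 1))" by (rule of_nat_mono)
        then have "real (wt n m (\<delta> i)) \<le> real (n m') * (real k - 1)"
          using k by (simp add: of_nat_diff)
        moreover have "(2 / \<epsilon>) * real (n m') \<le> real (n m)"
          using mult_right_mono[OF T(2), of "real (n m')"] nS[of m'] Suc by simp
        then have "(2 / \<epsilon>) * real (n m') * (real k - 1) \<le> real (n m) * (real k - 1)"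
          using k by (intro mult_right_mono) auto
        ultimately have "(2 / \<epsilon>) * real (wt n m (\<delta> i)) \<le> real D"
          using nk \<epsilon> mult_left_mono[of "real (wt n m (\<delta> i))" "real (n m') * (real k - 1)" "2 / \<epsilon>"]
          by (simp add: mult.assoc)
        then show ?thesis using \<epsilon> by (simp add: field_simps)
      qed
      have Wint: "int_coeffs W" unfolding W_def W by (intro int_coeffs_det int_coeffs_hasse P)
      have Wl1: "l1 W \<le> C' powr (real (k * D) / real (n 0))"
        unfolding W_def W C'_def
        by (rule wronskian_l1_bound[OF _ _ _ P(5) C k(2)]) (use nmono npos deg kd in auto)
      have Wdeg: "n h * lookup x h \<le> k * D" if x: "x \<in> keys W" and h: "h < Suc m" for x h
      proof -
        obtain \<pi> g where g: "\<forall>i<k. g i \<in> keys (hasse (\<delta> i + single m (s (\<pi> i))) P)" "x = (\<Sum>i<k. g i)"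
          using keys_det[of x k "\<lambda>i j. hasse (\<delta> i + single m (s j)) P"] x unfolding W_def W by blast
        have "n h * lookup (g i) h \<le> D" if i: "i < k" for i
        proof -
          have "g i + (\<delta> i + single m (s (\<pi> i))) \<in> keys P" using g i keys_hasse by blast
          from deg[OF h this] show ?thesis by (simp add: lookup_add algebra_simps)
        qed
        then have "(\<Sum>i<k. n h * lookup (g i) h) \<le> (\<Sum>i<k. D)" by (intro sum_mono) auto
        then show ?thesis by (simp add: g(2) lookup_sum sum_distrib_left)
      qed
      obtain u where u: "u \<in> keys U" using UV(3) by (metis ex_in_conv keys_eq_empty)
      obtain v where v: "v \<in> keys V" using UV(4) by (metis ex_in_conv keys_eq_empty)
      have v': "v = single m (lookup v m)" using v UV(2) keys_subset_single by (auto simp: vars_in_def)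
      have u': "m \<notin> keys u" using u UV(1) by (auto simp: vars_in_def)
      have look: "lookup W (i + single m t) = lookup U i * lookup V (single m t)" if "m \<notin> keys i" for i t
        unfolding W_def using lookup_mult_disjoint[OF UV(1,2) _ that] by simp
      \<comment> \<open>\<open>U\<close> and \<open>V\<close> need not be integral, but their multiples \<open>U'\<close> and \<open>V'\<close> occur among the coefficients of \<open>W\<close>.\<close>
      define U' where "U' = single 0 (lookup V v) * U"
      define V' where "V' = single 0 (lookup U u) * V"
      have U': "lookup U' i = lookup W (i + v)" if "m \<notin> keys i" for i
        using look[OF that, of "lookup v m"] v' by (simp add: U'_def)
      have V': "lookup V' (single m t) = lookup W (u + single m t)" for t
        using look[OF u', of t] by (simp add: V'_def)
      have kU: "keys U' = keys U" using v by (auto simp: U'_def in_keys_iff)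
      have kV: "keys V' = keys V" using u by (auto simp: V'_def in_keys_iff)
      have vU: "vars_in {..<m} U'" using UV(1) kU by (simp add: vars_in_def)
      have vV: "vars_in {m} V'" using UV(2) kV by (simp add: vars_in_def)
      have mU: "m \<notin> keys i" if "i \<in> keys U'" for i using that vU by (auto simp: vars_in_def)
      have mV: "j = single m (lookup j m)" if "j \<in> keys V'" for j
        using that vV keys_subset_single by (auto simp: vars_in_def)
      have V'k: "lookup V' j = lookup W (u + j)" if "j \<in> keys V'" for j
        using V'[of "lookup j m", folded mV[OF that]] .
      have nzU: "U' \<noteq> 0" using u kU by auto
      have nzV: "V' \<noteq> 0" using v kV by auto
      have l1U: "l1 U' \<le> l1 W"
        by (rule l1_slice[of "\<lambda>i. i + v"]) (auto intro!: inj_onI U' dest: mU)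
      have l1V: "l1 V' \<le> l1 W"
        by (rule l1_slice[of "\<lambda>j. u + j"]) (auto intro: inj_onI V'k)
      have intU: "int_coeffs U'"
        unfolding int_coeffs_def
      proof
        fix i
        show "lookup U' i \<in> \<int>"
        proof (cases "i \<in> keys U'")
          case True
          then show ?thesis using U'[OF mU[OF True]] Wint by (simp add: int_coeffs_def)
        qed (simp add: in_keys_iff)
      qed
      have intV: "int_coeffs V'"
        unfolding int_coeffs_def
      proof
        fix j
        show "lookup V' j \<in> \<int>"
        proof (cases "j \<in> keys V'")
          case True
          then show ?thesis using V'k Wint by (simp add: int_coeffs_def)
        qed (simp add: in_keys_iff)
      qed
      have "n h * lookup e h \<le> k * D" if "h < m" "e \<in> keys U'" for h e
      proof -
        have "e + v \<in> keys W" using U'[OF mU[OF that(2)]] that(2) by (simp add: in_keys_iff)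
        from Wdeg[OF this, of h] show ?thesis using that by (simp add: lookup_add algebra_simps)
      qed
      moreover have "T1 * real (n h) \<le> real (n (Suc h))" if "Suc h < m" for h
        using nS[of h] that mult_right_mono[OF T(1), of "real (n h)"] by simp
      moreover have "T1 \<le> real (n h)" if "h < m" for h using nT[of h] T(1) that by simp
      ultimately have "roth_hyp T1 b C' m n p q U' (k * D)"
        unfolding roth_hyp_def using nzU intU vU pq k P(4) order.trans[OF l1U Wl1] by simp
      then have "roth_concl \<epsilon>' m n p q U' (k * D)" by (rule T1(2))
      then obtain e where e: "e \<in> keys (shift \<xi> m U')" "real (wt n m e) \<le> \<epsilon>' * real (k * D)"
        unfolding roth_concl_def \<xi>_def[abs_def] by blast
      have "ln (l1 V') \<le> \<epsilon>' * real (k * D) * ln b"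
      proof -
        obtain j where "j \<in> keys V'" using v kV by blast
        then have "1 \<le> l1 V'" using abs_coeff_ge_1[OF intV] abs_lookup_le_l1 order.trans by blast
        then have "ln (l1 V') \<le> ln (C' powr (real (k * D) / real (n 0)))"
          using l1V Wl1 by (subst ln_le_cancel_iff) auto
        also have "\<dots> = real (k * D) * (ln C' / real (n 0))" using C' by (simp add: ln_powr)
        also have "\<dots> \<le> real (k * D) * (\<epsilon>' * ln b)"
        proof (rule mult_left_mono)
          have "ln C' / (\<epsilon>' * ln b) \<le> real (n 0)" using T(3) nT[of 0] by simp
          then show "ln C' / real (n 0) \<le> \<epsilon>' * ln b"
            using \<epsilon>' b npos[of 0] by (simp add: field_simps)
        qed simp
        finally show ?thesis by (simp add: mult_ac)
      qed
      then obtain t where t: "lookup (shift \<xi> (Suc m) V') (single m t) \<noteq> 0" "real (n m * t) \<le> \<epsilon>' * real (k * D)"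
        using index_one_variable_exists[OF intV nzV vV pq(1)[of m] pq(2)[of m] _ b pq(3)[of m] npos[of m], of \<xi>]
        by (auto simp: \<xi>_def)
      have me: "m \<notin> keys e" using e(1) vars_in_shift[of m \<xi> U'] by (auto simp: vars_in_def)
      have "lookup (shift \<xi> (Suc m) (U' * V')) (e + single m t)
          = lookup (shift \<xi> m U') e * lookup (shift \<xi> (Suc m) V') (single m t)"
        unfolding shift_mult shift_Suc_eq[OF vU]
        by (rule lookup_mult_disjoint[OF vars_in_shift vars_in_shift_mono[OF vV] _ me]) simp
      also have "\<dots> \<noteq> 0" using e(1) t(1) by (simp add: in_keys_iff)
      finally have "lookup (shift \<xi> (Suc m) (U' * V')) (e + single m t) \<noteq> 0" .
      \<comment> \<open>The product is a scalar multiple of \<open>W\<close>, so its nonzero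
        coefficient yields one of the translate of \<open>W\<close>.\<close>
      moreover have "U' * V' = single 0 (lookup V v) * (single 0 (lookup U u) * W)"
        by (simp add: U'_def V'_def W_def mult_ac)
      ultimately have "e + single m t \<in> keys (shift \<xi> (Suc m) W)"
        by (auto simp: shift_mult in_keys_iff)
      then have "(\<Sum>j<k. max 0 (\<epsilon> * real D / 2 - real (n m) * real j)) \<le> real (wt n (Suc m) (e + single m t))"
        unfolding W_def W by (intro wronskian_order_lower_bound[OF ord]) (use \<delta> wt\<delta> in auto)
      also have "\<dots> \<le> 2 * \<epsilon>' * real (k * D)"
        using e(2) t(2) by (simp add: wt_Suc_single[OF me])
      finally have "(\<Sum>j<k. max 0 (\<epsilon> * real D / 2 - real (n m) * real j)) \<le> 2 * \<epsilon>' * real (k * D)" .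
      moreover have "real k * \<epsilon>\<^sup>2 * real D / 32 \<le> (\<Sum>j<k. max 0 (\<epsilon> * real D / 2 - real (n m) * real j))"
        by (rule truncated_sum_lower_bound) (use \<epsilon> nk k P(4) in auto)
      moreover have "2 * \<epsilon>' * real (k * D) < real k * \<epsilon>\<^sup>2 * real D / 32"
        using \<epsilon> k P(4) by (simp add: \<epsilon>'_def)
      ultimately show False by linarith
    qed
  qed
qed

theorem roth_lemma:
  assumes "0 < \<epsilon>" "\<epsilon> \<le> 1" "1 < b" "1 \<le> C"
  shows "\<exists>T\<ge>1. \<forall>n p q P D. roth_hyp T b C m n p q P D \<longrightarrow> roth_concl \<epsilon> m n p q P D"
  using assms
\<comment> \<open>The step calls the hypothesis with a smaller \<epsilon> and a larger
  \<open>C\<close>.\<close>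
proof (induction m arbitrary: \<epsilon> b C)
  case 0
  have "roth_concl \<epsilon> 0 n p q P D" if H: "roth_hyp 1 b C 0 n p q P D" for n p q P D
  proof -
    have P: "P \<noteq> 0" "vars_in {..<0} P" using H unfolding roth_hyp_def by blast+
    then obtain e where "e \<in> keys P" by (metis ex_in_conv keys_eq_empty)
    then show ?thesis
      unfolding roth_concl_def shift_no_vars[OF P(2)] using 0 by (intro bexI[of _ e]) (auto simp: wt_def)
  qed
  then show ?case by (intro exI[of _ 1]) auto
next
  case (Suc m)
  show ?case by (rule roth_step) (use Suc in auto)
qed

section \<open>The auxiliary polynomial\<close>

definition box :: "nat \<Rightarrow> (nat \<Rightarrow> nat) \<Rightarrow> monom set" where
  "box m d = {e. keys e \<subseteq> {..<m} \<and> (\<forall>h<m. lookup e h \<le> d h)}"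

lemma box_0: "box 0 d = {0}"
  by (auto simp: box_def)

lemma box_Suc: "box (Suc m) d = (\<lambda>(e, t). e + single m t) ` (box m d \<times> {..d m})"
proof (intro equalityI subsetI)
  fix x assume x: "x \<in> box (Suc m) d"
  obtain e where e: "x = e + single m (lookup x m)" "keys e = keys x - {m}" by (rule monom_split)
  have "lookup e h = lookup x h" if "h < m" for h
    using that by (subst e(1)) (simp add: lookup_add lookup_single when_def)
  then have "e \<in> box m d" using x e(2) by (auto simp: box_def less_Suc_eq)
  moreover have "lookup x m \<in> {..d m}" using x by (auto simp: box_def)
  ultimately show "x \<in> (\<lambda>(e, t). e + single m t) ` (box m d \<times> {..d m})"
    using e(1) by (intro image_eqI[of _ _ "(e, lookup x m)"]) auto
next
  fix x assume "x \<in> (\<lambda>(e, t). e + single m t) ` (box m d \<times> {..d m})"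
  then obtain e t where x: "x = e + single m t" "e \<in> box m d" "t \<le> d m" by auto
  have "keys x \<subseteq> {..<Suc m}"
    using keys_add[of e "single m t"] x by (fastforce simp: box_def split: if_splits)
  moreover have "lookup e m = 0" using x by (auto simp: box_def in_keys_iff)
  ultimately show "x \<in> box (Suc m) d"
    using x by (auto simp: box_def lookup_add lookup_single when_def less_Suc_eq)
qed

lemma inj_on_box: "inj_on (\<lambda>(e, t). e + single m t) (box m d \<times> {..d m})"
proof (rule inj_onI)
  fix u v assume "u \<in> box m d \<times> {..d m}" "v \<in> box m d \<times> {..d m}"
    and eq: "(\<lambda>(e, t). e + single m t) u = (\<lambda>(e, t). e + single m t) v"
  then have "m \<notin> keys (fst u)" "m \<notin> keys (fst v)" by (auto simp: box_def)
  then show "u = v" using eq add_single_unique[of m "fst u" "fst v" "snd u" "snd v"]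
    by (auto simp: case_prod_beta prod_eq_iff)
qed

lemma sum_box_Suc:
  "(\<Sum>x\<in>box (Suc m) d. F x) = (\<Sum>e\<in>box m d. \<Sum>t\<le>d m. F (e + single m t))"
  unfolding box_Suc by (subst sum.reindex[OF inj_on_box]) (simp add: sum.cartesian_product case_prod_beta o_def)

lemma finite_box [simp]: "finite (box m d)"
  by (induction m) (auto simp: box_0 box_Suc)

lemma card_box: "card (box m d) = (\<Prod>h<m. d h + 1)"
proof (induction m)
  case (Suc m)
  have "card (box (Suc m) d) = card (box m d \<times> {..d m})"
    unfolding box_Suc by (rule card_image[OF inj_on_box])
  then show ?case using Suc by (simp add: card_cartesian_product)
qed (simp add: box_0)

text \<open>For a random point of the box, 2 wt - m D is a sum of m independent centred terms of
  absolute value at most D, so the cross terms vanish and the variances add. Doubling avoids halving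
  the mean.\<close>

lemma wt_box_second_moment:
  assumes "\<And>h. h < m \<Longrightarrow> n h * d h = D"
  shows "(\<Sum>e\<in>box m d. 2 * real (wt n m e) - real (m * D)) = 0 \<and>
    (\<Sum>e\<in>box m d. (2 * real (wt n m e) - real (m * D))\<^sup>2) \<le> real (card (box m d)) * (real m * (real D)\<^sup>2)"
  using assms
proof (induction m)
  case 0
  then show ?case by (simp add: box_0 wt_def)
next
  case (Suc m)
  let ?s = "\<lambda>e. 2 * real (wt n m e) - real (m * D)"
  let ?u = "\<lambda>t. real (n m) * (2 * real t - real (d m))"
  have nd: "real (n m) * real (d m) = real D" using Suc.prems[of m] by (metis lessI of_nat_mult)
  have split: "2 * real (wt n (Suc m) (e + single m t)) - real (Suc m * D) = ?s e + ?u t" if "e \<in> box m d" for e t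
  proof -
    have "m \<notin> keys e" using that by (auto simp: box_def)
    then show ?thesis using nd by (simp add: wt_Suc_single algebra_simps)
  qed
  have "(\<Sum>t\<le>k. 2 * real t - real k) = 0" for k :: nat
  proof -
    have "2 * (\<Sum>t\<le>k. real t) = real k * (real k + 1)" by (induction k) (auto simp: algebra_simps)
    moreover have "(\<Sum>t\<le>k. 2 * real t - real k) = 2 * (\<Sum>t\<le>k. real t) - (\<Sum>t\<le>k. real k)"
      by (simp only: sum_subtractf sum_distrib_left)
    ultimately show ?thesis by (simp add: algebra_simps)
  qed
  then have u0: "(\<Sum>t\<le>d m. ?u t) = 0" by (simp add: sum_distrib_left[symmetric])
  have IH: "(\<Sum>e\<in>box m d. ?s e) = 0" "(\<Sum>e\<in>box m d. (?s e)\<^sup>2) \<le> real (card (box m d)) * (real m * (real D)\<^sup>2)"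
    using Suc by auto
  have c: "real (card (box (Suc m) d)) = real (card (box m d)) * (real (d m) + 1)"
    by (simp add: card_box algebra_simps)
  have "(\<Sum>e\<in>box (Suc m) d. 2 * real (wt n (Suc m) e) - real (Suc m * D))
      = (\<Sum>e\<in>box m d. \<Sum>t\<le>d m. ?s e + ?u t)"
    unfolding sum_box_Suc by (intro sum.cong refl) (rule split)
  also have "\<dots> = (\<Sum>e\<in>box m d. (real (d m) + 1) * ?s e + (\<Sum>t\<le>d m. ?u t))"
    by (intro sum.cong refl) (simp only: sum.distrib, simp)
  also have "\<dots> = (real (d m) + 1) * (\<Sum>e\<in>box m d. ?s e)"
    unfolding u0 sum_distrib_left by simp
  also have "\<dots> = 0" using IH(1) by simp
  finally have 1: "(\<Sum>e\<in>box (Suc m) d. 2 * real (wt n (Suc m) e) - real (Suc m * D)) = 0" .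
  have u2: "(\<Sum>t\<le>d m. (?u t)\<^sup>2) \<le> (real (d m) + 1) * (real D)\<^sup>2"
  proof -
    have "(?u t)\<^sup>2 \<le> (real D)\<^sup>2" if "t \<le> d m" for t
    proof (rule abs_le_square_iff[THEN iffD1])
      have "\<bar>2 * real t - real (d m)\<bar> \<le> real (d m)" using that by auto
      then have "real (n m) * \<bar>2 * real t - real (d m)\<bar> \<le> real (n m) * real (d m)" by (intro mult_left_mono) auto
      then show "\<bar>?u t\<bar> \<le> \<bar>real D\<bar>" using nd by (simp add: abs_mult)
    qed
    then have "(\<Sum>t\<le>d m. (?u t)\<^sup>2) \<le> (\<Sum>t\<le>d m. (real D)\<^sup>2)" by (intro sum_mono) auto
    then show ?thesis by (simp add: algebra_simps)
  qed
  have sq: "(\<Sum>t\<le>k. (s + u t)\<^sup>2) = (real k + 1) * s\<^sup>2 + 2 * s * (\<Sum>t\<le>k. u t) + (\<Sum>t\<le>k. (u t)\<^sup>2)"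
    for s :: real and u k
    by (simp add: power2_sum sum.distrib sum_distrib_left algebra_simps)
  have "(\<Sum>e\<in>box (Suc m) d. (2 * real (wt n (Suc m) e) - real (Suc m * D))\<^sup>2)
      = (\<Sum>e\<in>box m d. \<Sum>t\<le>d m. (?s e + ?u t)\<^sup>2)"
    unfolding sum_box_Suc by (intro sum.cong refl arg_cong[where f = "\<lambda>x. x\<^sup>2"]) (rule split)
  also have "\<dots> = (\<Sum>e\<in>box m d. (real (d m) + 1) * (?s e)\<^sup>2 + 2 * ?s e * (\<Sum>t\<le>d m. ?u t) + (\<Sum>t\<le>d m. (?u t)\<^sup>2))"
    by (intro sum.cong refl) (rule sq)
  also have "\<dots> = (real (d m) + 1) * (\<Sum>e\<in>box m d. (?s e)\<^sup>2) + real (card (box m d)) * (\<Sum>t\<le>d m. (?u t)\<^sup>2)"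
    unfolding u0 by (simp add: sum.distrib sum_distrib_left)
  also have "\<dots> \<le> (real (d m) + 1) * (real (card (box m d)) * (real m * (real D)\<^sup>2))
      + real (card (box m d)) * ((real (d m) + 1) * (real D)\<^sup>2)"
    by (intro add_mono mult_left_mono IH(2) u2) auto
  also have "\<dots> = real (card (box (Suc m) d)) * (real (Suc m) * (real D)\<^sup>2)"
    unfolding c by (simp add: algebra_simps)
  finally show ?case using 1 by simp
qed

text \<open>The doubled deviation is \<open>a\<close> = 4 N D, whose square is 4 m D^2, four times
  the bound on the variance; hence the quarter.\<close>

lemma wt_box_deviation:
  assumes "\<And>h. h < m \<Longrightarrow> n h * d h = D" "m = 4 * N\<^sup>2" "0 < N" "0 < D" "S0 = 2 * N * (N - 1) * D"
  shows "4 * card {e \<in> box m d. wt n m e < S0 \<or> m * D < wt n m e + S0} \<le> card (box m d)"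
proof -
  let ?s = "\<lambda>e. 2 * real (wt n m e) - real (m * D)"
  let ?B = "{e \<in> box m d. wt n m e < S0 \<or> m * D < wt n m e + S0}"
  define a where "a = 4 * real N * real D"
  have S0: "2 * real S0 = real (m * D) - a"
  proof -
    obtain N' where "N = Suc N'" using assms(3) gr0_implies_Suc by blast
    then show ?thesis by (simp add: assms(2,5) a_def algebra_simps power2_eq_square)
  qed
  have "a\<^sup>2 \<le> (?s e)\<^sup>2" if "e \<in> ?B" for e
  proof (rule abs_le_square_iff[THEN iffD1])
    have "wt n m e < S0 \<or> m * D < wt n m e + S0" using that by blast
    then have "real (wt n m e) < real S0 \<or> real (m * D) < real (wt n m e) + real S0"
      by (metis of_nat_add of_nat_less_iff)
    moreover have "0 \<le> a" by (simp add: a_def)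
    ultimately show "\<bar>a\<bar> \<le> \<bar>?s e\<bar>" using S0 by linarith
  qed
  then have "(\<Sum>e\<in>?B. a\<^sup>2) \<le> (\<Sum>e\<in>?B. (?s e)\<^sup>2)" by (intro sum_mono) auto
  also have "\<dots> \<le> (\<Sum>e\<in>box m d. (?s e)\<^sup>2)" by (rule sum_mono2) auto
  also have "\<dots> \<le> real (card (box m d)) * (real m * (real D)\<^sup>2)"
    using wt_box_second_moment[of m n d D] assms(1) by blast
  finally have "real (card ?B) * a\<^sup>2 \<le> real (card (box m d)) * (real m * (real D)\<^sup>2)" by simp
  moreover have "a\<^sup>2 = 4 * (real m * (real D)\<^sup>2)"
    using assms(2) by (simp add: a_def power_mult_distrib)
  moreover have "0 < real m * (real D)\<^sup>2" using assms by simp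
  ultimately have "real (card ?B) * 4 * (real m * (real D)\<^sup>2) \<le> real (card (box m d)) * (real m * (real D)\<^sup>2)"
    by (simp add: mult_ac)
  then have "real (card ?B) * 4 \<le> real (card (box m d))"
    using \<open>0 < real m * (real D)\<^sup>2\<close> by (rule mult_right_le_imp_le)
  then show ?thesis by linarith
qed

text \<open>With B = |G| A, vectors with entries up to B have images with entries up to B^2. There
  are fewer images than vectors because B^2 + 1 < (B + 1)^2 and 2 |M| \<le> |G|; the difference of
  two vectors with equal image is the solution.\<close>

lemma siegel_lemma:
  fixes a :: "'i \<Rightarrow> 'j \<Rightarrow> nat"
  assumes G: "finite G" "G \<noteq> {}" and M: "finite M" "2 * card M \<le> card G"
    and a: "\<And>i j. i \<in> G \<Longrightarrow> j \<in> M \<Longrightarrow> a i j \<le> A" and A: "1 \<le> A"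
  shows "\<exists>c :: 'i \<Rightarrow> int. (\<exists>i\<in>G. c i \<noteq> 0) \<and> (\<forall>i\<in>G. \<bar>c i\<bar> \<le> int (card G * A)) \<and>
    (\<forall>j\<in>M. (\<Sum>i\<in>G. c i * int (a i j)) = 0)"
proof -
  define B where "B = card G * A"
  have cG: "0 < card G" using G by auto
  then have B: "1 \<le> B" unfolding B_def using A by simp
  define X where "X = (\<Pi>\<^sub>E i\<in>G. {..B})"
  define Y where "Y = (\<Pi>\<^sub>E j\<in>M. {..B * B})"
  define F where "F f = (\<lambda>j\<in>M. \<Sum>i\<in>G. f i * a i j)" for f
  have "F f \<in> Y" if "f \<in> X" for f
  proof -
    have "(\<Sum>i\<in>G. f i * a i j) \<le> B * B" if "j \<in> M" for j
    proof -
      have "(\<Sum>i\<in>G. f i * a i j) \<le> (\<Sum>i\<in>G. B * A)"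
        by (intro sum_mono mult_mono) (use a \<open>f \<in> X\<close> that in \<open>auto simp: X_def PiE_iff\<close>)
      then show ?thesis by (simp add: B_def mult_ac)
    qed
    then show ?thesis by (auto simp: F_def Y_def)
  qed
  then have sub: "F ` X \<subseteq> Y" by blast
  have "card Y = (B * B + 1) ^ card M" unfolding Y_def by (subst card_PiE) (use M in auto)
  also have "\<dots> < (B + 1) ^ card G"
  \<comment> \<open>With exponent 0 the comparison of the bases is no longer strict, so strictness
    must come from G being nonempty.\<close>
  proof (cases "card M = 0")
    case True
    then show ?thesis using cG B one_less_power[of "Suc B" "card G"] by simp
  next
    case False
    have "(B * B + 1) ^ card M < ((B + 1)\<^sup>2) ^ card M"
      by (rule power_strict_mono) (use False B in \<open>auto simp: power2_eq_square\<close>)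
    also have "\<dots> = (B + 1) ^ (2 * card M)" by (simp add: power_mult)
    also have "\<dots> \<le> (B + 1) ^ card G" by (rule power_increasing) (use M in auto)
    finally show ?thesis .
  qed
  also have "\<dots> = card X" unfolding X_def by (subst card_PiE) (use G in auto)
  finally have "card Y < card X" .
  moreover have "finite Y" unfolding Y_def by (intro finite_PiE M) auto
  ultimately have "\<not> inj_on F X" using sub card_inj_on_le[of F X Y] by fastforce
  then obtain f g where fg: "f \<in> X" "g \<in> X" "F f = F g" "f \<noteq> g" by (auto simp: inj_on_def)
  define c where "c i = int (f i) - int (g i)" for i
  have "\<exists>i\<in>G. f i \<noteq> g i" using fg PiE_ext[of f G "\<lambda>_. {..B}" g] unfolding X_def by blast
  then have "\<exists>i\<in>G. c i \<noteq> 0" by (simp add: c_def)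
  moreover have "\<bar>c i\<bar> \<le> int B" if "i \<in> G" for i
  proof -
    have "f i \<le> B" "g i \<le> B" using fg that by (auto simp: X_def PiE_iff)
    then show ?thesis by (simp add: c_def)
  qed
  moreover have "(\<Sum>i\<in>G. c i * int (a i j)) = 0" if "j \<in> M" for j
  proof -
    have "(\<Sum>i\<in>G. f i * a i j) = (\<Sum>i\<in>G. g i * a i j)"
      using fun_cong[OF fg(3), of j] that by (simp add: F_def)
    then have "int (\<Sum>i\<in>G. f i * a i j) = int (\<Sum>i\<in>G. g i * a i j)" by simp
    then show ?thesis by (simp add: c_def left_diff_distrib sum_subtractf)
  qed
  ultimately show ?thesis unfolding B_def by blast
qed

lemma keys_shift_le:
  assumes "j \<in> keys (shift \<xi> m P)"
  shows "\<exists>e\<in>keys P. \<forall>h. lookup j h \<le> lookup e h"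
proof -
  have j: "keys j \<subseteq> {..<m}" using assms vars_in_shift by (auto simp: vars_in_def)
  have "\<exists>e\<in>keys P. mbinom e j \<noteq> 0"
  proof (rule ccontr)
    assume "\<not> ?thesis"
    then have "lookup (shift \<xi> m P) j = 0" by (simp add: lookup_shift[OF j])
    then show False using assms by (simp add: in_keys_iff)
  qed
  then obtain e where e: "e \<in> keys P" "mbinom e j \<noteq> 0" by blast
  have "lookup e h = lookup (e - j) h + lookup j h" for h
    using mbinom_nonzeroD[OF e(2)] lookup_add by metis
  then show ?thesis using e(1) by (metis le_add2)
qed

text \<open>Here \<open>m * D / 2\<close> is the average weight on the box and \<open>S0 = (1 - 1/N) m D / 2\<close>. With \<open>m = 4 N\<^sup>2\<close> variables,
  Chebyshev's inequality leaves at most a quarter of the box outside \<open>[S0, m D - S0]\<close>. By symmetry the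
  same quarter serves as the set of forbidden monomials and as the set of vanishing conditions.\<close>

lemma auxiliary_polynomial:
  assumes nd: "\<And>h. h < m \<Longrightarrow> n h * d h = D" and m: "m = 4 * N\<^sup>2" "0 < N" "0 < D" and S0: "S0 = 2 * N * (N - 1) * D"
  shows "\<exists>P. P \<noteq> 0 \<and> int_coeffs P \<and> keys P \<subseteq> box m d \<and> l1 P \<le> 8 ^ (\<Sum>h<m. d h) \<and>
    (\<forall>e\<in>keys P. S0 \<le> wt n m e \<and> wt n m e + S0 \<le> m * D) \<and>
    (\<forall>j\<in>keys (shift (\<lambda>_. 1) m P). S0 \<le> wt n m j)"
proof -
  define M where "M = {e \<in> box m d. wt n m e < S0 \<or> m * D < wt n m e + S0}"
  define G where "G = box m d - M"
  \<comment> \<open>\<open>A\<close> bounds the binomials and also the size of the box, so the norm,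
    at most \<open>card G * (card G * A)\<close>, is at most A^3; hence the base 8.\<close>
  define A :: nat where "A = 2 ^ (\<Sum>h<m. d h)"
  have A1: "1 \<le> A" by (simp add: A_def)
  have fin: "finite M" "finite G" by (auto simp: M_def G_def)
  have M4: "4 * card M \<le> card (box m d)" unfolding M_def by (rule wt_box_deviation[of m n d D N]) (use nd m S0 in auto)
  have "card G = card (box m d) - card M" unfolding G_def by (rule card_Diff_subset) (use fin in \<open>auto simp: M_def\<close>)
  moreover have box1: "1 \<le> card (box m d)" unfolding card_box by (simp add: prod_pos Suc_le_eq)
  ultimately have G: "2 * card M \<le> card G" "G \<noteq> {}" using M4 by auto
  have mb: "mbinom e j \<le> A" if "e \<in> box m d" "j \<in> box m d" for e j
  proof -
    have "mbinom e j \<le> 2 ^ (\<Sum>h<m. lookup e h)" using that by (intro mbinom_le) (auto simp: box_def)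
    also have "\<dots> \<le> A" unfolding A_def using that by (intro power_increasing sum_mono) (auto simp: box_def)
    finally show ?thesis .
  qed
  from siegel_lemma[OF fin(2) G(2) fin(1) G(1), of mbinom A] obtain c :: "monom \<Rightarrow> int" where
    c: "\<exists>i\<in>G. c i \<noteq> 0" "\<forall>i\<in>G. \<bar>c i\<bar> \<le> int (card G * A)" "\<forall>j\<in>M. (\<Sum>i\<in>G. c i * int (mbinom i j)) = 0"
    using mb A1 by (auto simp: G_def M_def)
  define P :: mpoly where "P = (\<Sum>e\<in>G. single e (real_of_int (c e)))"
  have lookP: "lookup P x = (if x \<in> G then real_of_int (c x) else 0)" for x
    unfolding P_def using fin(2) by (simp add: lookup_sum lookup_single when_def sum.delta)
  have kP: "keys P \<subseteq> G" by (auto simp: in_keys_iff lookP split: if_splits)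
  have "P \<noteq> 0"
  proof
    assume "P = 0"
    obtain i where "i \<in> G" "c i \<noteq> 0" using c(1) by blast
    then show False using lookP[of i] \<open>P = 0\<close> by simp
  qed
  moreover have "int_coeffs P" by (simp add: int_coeffs_def lookP)
  moreover have "keys P \<subseteq> box m d" using kP by (auto simp: G_def)
  moreover have "l1 P \<le> 8 ^ (\<Sum>h<m. d h)"
  proof -
    have cb: "card (box m d) \<le> A"
      unfolding card_box A_def power_sum using Suc_leI[OF less_exp] by (intro prod_mono) auto
    have cG: "card G \<le> A" by (rule order.trans[OF card_mono cb]) (auto simp: G_def)
    have "l1 P = (\<Sum>e\<in>G. \<bar>real_of_int (c e)\<bar>)"
      by (subst l1_superset[OF fin(2) kP]) (simp add: lookP)
    also have "\<dots> \<le> (\<Sum>e\<in>G. real (A * A))"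
    proof (rule sum_mono)
      fix e assume "e \<in> G"
      then have "\<bar>c e\<bar> \<le> int (card G * A)" using c(2) by blast
      also have "\<dots> \<le> int (A * A)" using cG by (simp add: mult_right_mono)
      finally show "\<bar>real_of_int (c e)\<bar> \<le> real (A * A)" by linarith
    qed
    also have "\<dots> \<le> real A * real (A * A)" using cG by (simp add: mult_right_mono)
    also have "\<dots> = 8 ^ (\<Sum>h<m. d h)"
      by (simp add: A_def power_mult_distrib[symmetric])
    finally show ?thesis .
  qed
  moreover have "S0 \<le> wt n m e \<and> wt n m e + S0 \<le> m * D" if "e \<in> keys P" for e
    using kP that by (force simp: G_def M_def)
  moreover have "S0 \<le> wt n m j" if j: "j \<in> keys (shift (\<lambda>_. 1) m P)" for j
  proof (rule ccontr)
    assume "\<not> S0 \<le> wt n m j"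
    have kj: "keys j \<subseteq> {..<m}" using j vars_in_shift by (auto simp: vars_in_def)
    obtain e where e: "e \<in> keys P" "\<forall>h. lookup j h \<le> lookup e h" using keys_shift_le[OF j] by blast
    \<comment> \<open>A monomial of the translate divides a monomial of \<open>P\<close>, so a
      violating \<open>j\<close> lies in the box and is among the imposed conditions.\<close>
    have "j \<in> box m d" using e kP kj unfolding G_def box_def by (blast intro: order.trans)
    then have jM: "j \<in> M" using \<open>\<not> S0 \<le> wt n m j\<close> by (simp add: M_def)
    have "lookup (shift (\<lambda>_. 1) m P) j = (\<Sum>e\<in>keys P. lookup P e * real (mbinom e j))"
      unfolding lookup_shift[OF kj] by (simp add: mpow_def)
    also have "\<dots> = (\<Sum>e\<in>G. lookup P e * real (mbinom e j))"
      by (rule sum.mono_neutral_left) (use fin kP in \<open>auto simp: in_keys_iff\<close>)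
    also have "\<dots> = of_int (\<Sum>e\<in>G. c e * int (mbinom e j))" by (simp add: lookP)
    also have "\<dots> = 0" using c(3) jM by simp
    finally show False using j by (simp add: in_keys_iff)
  qed
  ultimately show ?thesis by blast
qed

section \<open>Powers of rationals close to integers\<close>

lemma l1_shift_one: "l1 (shift (\<lambda>_. 1) m P) \<le> (\<Sum>e\<in>keys P. \<bar>lookup P e\<bar> * 2 ^ (\<Sum>h<m. lookup e h))"
proof -
  have mon: "l1 (shift_monom (\<lambda>_. 1) m e) \<le> 2 ^ (\<Sum>h<m. lookup e h)" for e
  proof -
    have "l1 (single (single h 1) 1 + single 0 1) \<le> 2" for h :: nat
      by (rule order.trans[OF l1_add]) simp
    then have "l1 ((single (single h 1) 1 + single 0 1) ^ k) \<le> 2 ^ k" for h k :: nat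
    proof (induction k)
      case (Suc k)
      then show ?case
        unfolding power_Suc by (intro order.trans[OF l1_mult] mult_mono) auto
    qed simp
    then have "(\<Prod>h<m. l1 ((single (single h 1) 1 + single 0 1) ^ lookup e h)) \<le> (\<Prod>h<m. 2 ^ lookup e h)"
      by (intro prod_mono) auto
    then show ?thesis
      unfolding shift_monom_def power_sum by (rule order.trans[OF l1_prod])
  qed
  have "l1 (shift (\<lambda>_. 1) m P) \<le> (\<Sum>e\<in>keys P. l1 (single 0 (lookup P e) * shift_monom (\<lambda>_. 1) m e))"
    unfolding shift_def lin_def by (rule l1_sum)
  also have "\<dots> \<le> (\<Sum>e\<in>keys P. \<bar>lookup P e\<bar> * 2 ^ (\<Sum>h<m. lookup e h))"
    by (intro sum_mono order.trans[OF l1_mult] mult_mono) (auto intro: mon)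
  finally show ?thesis .
qed

text \<open>In the expansion at (1, ..., 1) only weights of at least \<open>S0\<close> occur, so
  after clearing denominators every term carries powers of the small differences x - y of nearly
  that weight. Of the base 4, one factor 2 comes from the binomials and one from the translation to
  1.\<close>

lemma value_upper_bound:
  fixes a R :: real and x y :: "nat \<Rightarrow> real"
  assumes nd: "\<And>h. h < m \<Longrightarrow> n h * d h = D"
    and P: "keys P \<subseteq> box m d" and S0: "\<And>j. j \<in> keys (shift (\<lambda>_. 1) m P) \<Longrightarrow> S0 \<le> wt n m j"
    and xy: "\<And>h. h < m \<Longrightarrow> 0 < y h \<and> y h \<le> a ^ n h \<and> 0 \<le> x h - y h \<and> x h - y h \<le> R ^ n h"
    and R: "1 \<le> R" "R \<le> a" and J: "keys J \<subseteq> {..<m}" "\<And>h. h < m \<Longrightarrow> lookup J h \<le> d h"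
  shows "\<bar>(\<Prod>h<m. y h ^ (d h - lookup J h)) * lookup (shift (\<lambda>h. x h / y h) m P) J\<bar>
    \<le> 4 ^ (\<Sum>h<m. d h) * l1 P * (a ^ (m * D - S0) * R ^ S0)"
proof -
  let ?Q = "shift (\<lambda>_. 1) m P"
  let ?Y = "\<Prod>h<m. y h ^ (d h - lookup J h)"
  let ?A = "2 ^ (\<Sum>h<m. d h) :: real"
  have "shift (\<lambda>h. x h / y h) m P = shift (\<lambda>h. x h / y h - 1) m ?Q"
    by (simp add: shift_shift)
  then have F: "lookup (shift (\<lambda>h. x h / y h) m P) J
      = (\<Sum>j\<in>keys ?Q. lookup ?Q j * (real (mbinom j J) * mpow (\<lambda>h. x h / y h - 1) m (j - J)))"
    by (simp add: lookup_shift[OF J(1)])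
  have jd: "lookup j h \<le> d h" if "j \<in> keys ?Q" "h < m" for j h
    using keys_shift_le[OF that(1)] P that(2) by (auto simp: box_def intro: order.trans)
  have summand: "\<bar>real (mbinom j J) * (?Y * mpow (\<lambda>h. x h / y h - 1) m (j - J))\<bar> \<le> ?A * (a ^ (m * D - S0) * R ^ S0)"
    if j: "j \<in> keys ?Q" for j
  proof (cases "mbinom j J = 0")
    case True
    then show ?thesis using R by simp
  next
    case False
    have Jj: "lookup J h \<le> lookup j h" for h
      using mbinom_nonzeroD[OF False] lookup_add by (metis le_add2)
    have "mbinom j J \<le> 2 ^ (\<Sum>h<m. lookup j h)" by (rule mbinom_le) (use J in auto)
    also have "\<dots> \<le> 2 ^ (\<Sum>h<m. d h)" by (intro power_increasing sum_mono) (use jd j in auto)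
    finally have "real (mbinom j J) \<le> real (2 ^ (\<Sum>h<m. d h))" by (rule of_nat_mono)
    then have mb: "real (mbinom j J) \<le> ?A" by simp
    have "?Y * mpow (\<lambda>h. x h / y h - 1) m (j - J)
        = (\<Prod>h<m. y h ^ (d h - lookup j h) * (x h - y h) ^ (lookup j h - lookup J h))"
      unfolding mpow_def prod.distrib[symmetric]
    proof (rule prod.cong[OF refl])
      fix h assume "h \<in> {..<m}"
      then have h: "h < m" by simp
      have "d h - lookup J h = (d h - lookup j h) + (lookup j h - lookup J h)"
        using Jj[of h] jd[OF j h] by simp
      moreover have yy: "y h * (x h / y h - 1) = x h - y h" using xy[OF h] by (simp add: field_simps)
      ultimately show "y h ^ (d h - lookup J h) * (x h / y h - 1) ^ lookup (j - J) h
          = y h ^ (d h - lookup j h) * (x h - y h) ^ (lookup j h - lookup J h)"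
        by (simp add: power_add lookup_minus mult.assoc yy flip: power_mult_distrib)
    qed
    also have "\<bar>\<dots>\<bar> \<le> (\<Prod>h<m. (a ^ n h) ^ (d h - lookup j h) * (R ^ n h) ^ (lookup j h - lookup J h))"
      unfolding abs_prod
    proof (intro prod_mono conjI)
      fix h assume "h \<in> {..<m}"
      then have h: "h < m" by simp
      show "\<bar>y h ^ (d h - lookup j h) * (x h - y h) ^ (lookup j h - lookup J h)\<bar>
          \<le> (a ^ n h) ^ (d h - lookup j h) * (R ^ n h) ^ (lookup j h - lookup J h)"
        using xy[OF h] by (simp add: abs_mult power_abs) (intro mult_mono power_mono; simp)
    qed simp
    also have "\<dots> = a ^ (m * D - wt n m j) * R ^ (wt n m j - wt n m J)"
    proof -
      have "(\<Sum>h<m. n h * (d h - lookup j h)) = (\<Sum>h<m. n h * d h) - (\<Sum>h<m. n h * lookup j h)"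
        unfolding diff_mult_distrib2 by (rule sum_subtractf_nat) (use jd j in auto)
      also have "(\<Sum>h<m. n h * d h) = m * D" using nd by simp
      finally have "(\<Sum>h<m. n h * (d h - lookup j h)) = m * D - wt n m j" by (simp add: wt_def)
      moreover have "(\<Sum>h<m. n h * (lookup j h - lookup J h)) = wt n m j - wt n m J"
        unfolding diff_mult_distrib2 wt_def by (rule sum_subtractf_nat) (use Jj in auto)
      ultimately show ?thesis by (simp add: prod.distrib power_sum[symmetric] flip: power_mult)
    qed
    \<comment> \<open>Since R \<ge> 1, the weight lost to \<open>J\<close> may be restored; since R
      \<le> a, the factors R beyond the first S0 are then replaced by a.\<close>
    also have "\<dots> \<le> a ^ (m * D - wt n m j) * R ^ wt n m j"
      using R by (intro mult_left_mono power_increasing) auto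
    also have "\<dots> = a ^ (m * D - wt n m j) * (R ^ (wt n m j - S0) * R ^ S0)"
      using S0[OF j] by (simp flip: power_add)
    also have "\<dots> \<le> a ^ (m * D - wt n m j) * (a ^ (wt n m j - S0) * R ^ S0)"
      using R by (intro mult_left_mono mult_right_mono power_mono) auto
    also have "\<dots> = a ^ (m * D - S0) * R ^ S0"
    proof -
      have "wt n m j \<le> (\<Sum>h<m. n h * d h)" unfolding wt_def by (intro sum_mono mult_left_mono) (use jd j in auto)
      also have "\<dots> = m * D" using nd by simp
      finally have "(m * D - wt n m j) + (wt n m j - S0) = m * D - S0" using S0[OF j] by simp
      then show ?thesis by (metis mult.assoc power_add)
    qed
    finally have "\<bar>?Y * mpow (\<lambda>h. x h / y h - 1) m (j - J)\<bar> \<le> a ^ (m * D - S0) * R ^ S0" .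
    then have "real (mbinom j J) * \<bar>?Y * mpow (\<lambda>h. x h / y h - 1) m (j - J)\<bar> \<le> ?A * (a ^ (m * D - S0) * R ^ S0)"
      by (rule mult_mono[OF mb]) auto
    then show ?thesis by (simp only: abs_mult abs_of_nat)
  qed
  have "\<bar>?Y * lookup (shift (\<lambda>h. x h / y h) m P) J\<bar>
      = \<bar>\<Sum>j\<in>keys ?Q. lookup ?Q j * (real (mbinom j J) * (?Y * mpow (\<lambda>h. x h / y h - 1) m (j - J)))\<bar>"
    unfolding F sum_distrib_left by (simp add: mult_ac)
  also have "\<dots> \<le> (\<Sum>j\<in>keys ?Q. \<bar>lookup ?Q j * (real (mbinom j J) * (?Y * mpow (\<lambda>h. x h / y h - 1) m (j - J)))\<bar>)"
    by (rule sum_abs)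
  also have "\<dots> \<le> (\<Sum>j\<in>keys ?Q. \<bar>lookup ?Q j\<bar> * (?A * (a ^ (m * D - S0) * R ^ S0)))"
  proof (rule sum_mono)
    fix j assume "j \<in> keys ?Q"
    then show "\<bar>lookup ?Q j * (real (mbinom j J) * (?Y * mpow (\<lambda>h. x h / y h - 1) m (j - J)))\<bar>
        \<le> \<bar>lookup ?Q j\<bar> * (?A * (a ^ (m * D - S0) * R ^ S0))"
      unfolding abs_mult[of "lookup ?Q j"] by (intro mult_left_mono summand) auto
  qed
  also have "\<dots> = l1 ?Q * (?A * (a ^ (m * D - S0) * R ^ S0))"
    by (simp add: l1_def sum_distrib_right)
  also have "\<dots> \<le> (?A * l1 P) * (?A * (a ^ (m * D - S0) * R ^ S0))"
  proof (rule mult_right_mono)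
    have "l1 ?Q \<le> (\<Sum>e\<in>keys P. \<bar>lookup P e\<bar> * 2 ^ (\<Sum>h<m. lookup e h))" by (rule l1_shift_one)
    also have "\<dots> \<le> (\<Sum>e\<in>keys P. \<bar>lookup P e\<bar> * ?A)"
      using P by (intro sum_mono mult_left_mono power_increasing) (auto simp: box_def)
    finally show "l1 ?Q \<le> ?A * l1 P" by (simp add: l1_def sum_distrib_right[symmetric] mult.commute)
  qed (use R in auto)
  also have "?A * ?A = 4 ^ (\<Sum>h<m. d h)" by (simp flip: power_mult_distrib)
  then have "(?A * l1 P) * (?A * (a ^ (m * D - S0) * R ^ S0)) = 4 ^ (\<Sum>h<m. d h) * l1 P * (a ^ (m * D - S0) * R ^ S0)"
    by (metis mult.assoc mult.left_commute)
  finally show ?thesis .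
qed

text \<open>Both bounds on the weights of \<open>P\<close> enter. Numerators occur with weight at
  least S0, of which the derivative removes at most D; clearing denominators leaves powers of b of
  weight m D - wt e \<ge> S0. So every summand, hence the nonzero sum, is an integer multiple of the
  common factor.\<close>

lemma value_lower_bound:
  fixes a b :: int and y0 :: "nat \<Rightarrow> int"
  assumes nd: "\<And>h. h < m \<Longrightarrow> n h * d h = D"
    and P: "keys P \<subseteq> box m d" "int_coeffs P"
    and wtP: "\<And>e. e \<in> keys P \<Longrightarrow> S0 \<le> wt n m e \<and> wt n m e + S0 \<le> m * D"
    and y: "\<And>h. h < m \<Longrightarrow> y0 h \<noteq> 0" and ab: "0 < a" "0 < b"
    and J: "J \<in> keys (shift (\<lambda>h. of_int (a ^ n h) / of_int (y0 h * b ^ n h)) m P)" "wt n m J \<le> D"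
  shows "of_int a ^ (S0 - D) * of_int b ^ S0 \<le>
    \<bar>(\<Prod>h<m. of_int (y0 h * b ^ n h) ^ (d h - lookup J h)) *
      lookup (shift (\<lambda>h. of_int (a ^ n h) / of_int (y0 h * b ^ n h)) m P) J\<bar>"
proof -
  let ?x = "\<lambda>h. of_int (a ^ n h) :: real" and ?y = "\<lambda>h. of_int (y0 h * b ^ n h) :: real"
  let ?K = "of_int a ^ (S0 - D) * of_int b ^ S0 :: real"
  let ?Y = "\<Prod>h<m. ?y h ^ (d h - lookup J h)"
  let ?F = "lookup (shift (\<lambda>h. ?x h / ?y h) m P) J"
  have y0: "?y h \<noteq> 0" if "h < m" for h using y[OF that] ab by simp
  have kJ: "keys J \<subseteq> {..<m}" using J(1) vars_in_shift by (auto simp: vars_in_def)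
  have Jd: "lookup J h \<le> d h" if "h < m" for h
    using keys_shift_le[OF J(1)] P(1) that by (auto simp: box_def intro: order.trans)
  have summand: "\<exists>z::int. ?Y * (lookup P e * (real (mbinom e J) * mpow (\<lambda>h. ?x h / ?y h) m (e - J))) = ?K * of_int z"
    if e: "e \<in> keys P" for e
  proof (cases "mbinom e J = 0")
    case True
    then show ?thesis by (intro exI[of _ 0]) simp
  next
    case False
    have Je: "lookup J h \<le> lookup e h" for h
      using mbinom_nonzeroD[OF False] lookup_add by (metis le_add2)
    have ed: "lookup e h \<le> d h" if "h < m" for h using e P(1) that by (auto simp: box_def)
    let ?z = "\<Prod>h<m. y0 h ^ (d h - lookup e h)"
    obtain w where w: "lookup P e = of_int w" using P(2) by (auto simp: int_coeffs_def elim: Ints_cases)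
    have "?Y * mpow (\<lambda>h. ?x h / ?y h) m (e - J)
        = (\<Prod>h<m. (of_int a ^ n h) ^ (lookup e h - lookup J h) * ((of_int b ^ n h) ^ (d h - lookup e h) * of_int (y0 h) ^ (d h - lookup e h)))"
      unfolding mpow_def prod.distrib[symmetric]
    proof (rule prod.cong[OF refl])
      fix h assume "h \<in> {..<m}"
      then have h: "h < m" by simp
      have "d h - lookup J h = (d h - lookup e h) + (lookup e h - lookup J h)"
        using Je[of h] ed[OF h] by simp
      then have "?y h ^ (d h - lookup J h) * (?x h / ?y h) ^ lookup (e - J) h
          = ?y h ^ (d h - lookup e h) * (?y h * (?x h / ?y h)) ^ (lookup e h - lookup J h)"
        unfolding power_mult_distrib[of "?y h" "?x h / ?y h"] by (simp add: power_add lookup_minus mult.assoc)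
      also have "?y h * (?x h / ?y h) = ?x h" using y0[OF h] by simp
      finally show "?y h ^ (d h - lookup J h) * (?x h / ?y h) ^ lookup (e - J) h
          = (of_int a ^ n h) ^ (lookup e h - lookup J h) * ((of_int b ^ n h) ^ (d h - lookup e h) * of_int (y0 h) ^ (d h - lookup e h))"
        by (simp add: power_mult_distrib mult_ac)
    qed
    also have "\<dots> = of_int a ^ (wt n m e - wt n m J) * (of_int b ^ (m * D - wt n m e) * of_int ?z)"
    proof -
      have "(\<Sum>h<m. n h * (d h - lookup e h)) = (\<Sum>h<m. n h * d h) - (\<Sum>h<m. n h * lookup e h)"
        unfolding diff_mult_distrib2 by (rule sum_subtractf_nat) (use ed in auto)
      also have "(\<Sum>h<m. n h * d h) = m * D" using nd by simp
      finally have "(\<Sum>h<m. n h * (d h - lookup e h)) = m * D - wt n m e" by (simp add: wt_def)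
      moreover have "(\<Sum>h<m. n h * (lookup e h - lookup J h)) = wt n m e - wt n m J"
        unfolding diff_mult_distrib2 wt_def by (rule sum_subtractf_nat) (use Je in auto)
      ultimately show ?thesis by (simp add: prod.distrib power_sum[symmetric] flip: power_mult)
    qed
    \<comment> \<open>Subtraction is truncated, but S0 \<le> wt e and wt J \<le> D give S0 - D \<le>
      wt e - wt J in all cases.\<close>
    also have "wt n m e - wt n m J = (S0 - D) + (wt n m e - wt n m J - (S0 - D))"
      using wtP[OF e] J(2) by arith
    also have "of_int a ^ ((S0 - D) + (wt n m e - wt n m J - (S0 - D)))
        = of_int a ^ (S0 - D) * (of_int (a ^ (wt n m e - wt n m J - (S0 - D))) :: real)"
      by (simp only: power_add of_int_power)
    also have "of_int b ^ (m * D - wt n m e) = of_int b ^ S0 * (of_int (b ^ (m * D - wt n m e - S0)) :: real)"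
      using wtP[OF e] by (simp flip: power_add)
    finally have "?Y * (lookup P e * (real (mbinom e J) * mpow (\<lambda>h. ?x h / ?y h) m (e - J)))
        = ?K * of_int (w * int (mbinom e J) * (a ^ (wt n m e - wt n m J - (S0 - D)) * (b ^ (m * D - wt n m e - S0) * ?z)))"
      unfolding w by (simp add: mult_ac)
    then show ?thesis by blast
  qed
  have "?Y * ?F = (\<Sum>e\<in>keys P. ?Y * (lookup P e * (real (mbinom e J) * mpow (\<lambda>h. ?x h / ?y h) m (e - J))))"
    by (simp only: lookup_shift[OF kJ] sum_distrib_left)
  moreover have "\<exists>z. \<forall>e\<in>keys P. ?Y * (lookup P e * (real (mbinom e J) * mpow (\<lambda>h. ?x h / ?y h) m (e - J))) = ?K * of_int (z e :: int)"
    by (rule bchoice) (use summand in blast)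
  then obtain z :: "monom \<Rightarrow> int" where
    z: "\<And>e. e \<in> keys P \<Longrightarrow> ?Y * (lookup P e * (real (mbinom e J) * mpow (\<lambda>h. ?x h / ?y h) m (e - J))) = ?K * of_int (z e)"
    by blast
  have "(\<Sum>e\<in>keys P. ?Y * (lookup P e * (real (mbinom e J) * mpow (\<lambda>h. ?x h / ?y h) m (e - J))))
      = ?K * of_int (\<Sum>e\<in>keys P. z e)"
    unfolding of_int_sum sum_distrib_left by (rule sum.cong[OF refl z])
  ultimately have eq: "?Y * ?F = ?K * of_int (\<Sum>e\<in>keys P. z e)" by (rule trans)
  have "?Y * ?F \<noteq> 0" using y0 J(1) by (auto simp: in_keys_iff)
  then have "(\<Sum>e\<in>keys P. z e) \<noteq> 0" unfolding eq by (metis mult_zero_right of_int_0)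
  then have "1 \<le> \<bar>real_of_int (\<Sum>e\<in>keys P. z e)\<bar>" by linarith
  then have "?K * 1 \<le> ?K * \<bar>real_of_int (\<Sum>e\<in>keys P. z e)\<bar>" using ab by (intro mult_left_mono) auto
  also have "\<dots> = \<bar>?Y * ?F\<bar>" unfolding eq using ab by (simp add: abs_mult)
  finally show ?thesis by simp
qed

lemma infinite_subsequence:
  assumes "infinite (S :: nat set)"
  shows "\<exists>n. (\<forall>h. n h \<in> S \<and> T \<le> real (n h)) \<and> (\<forall>h. T * real (n h) \<le> real (n (Suc h)))"
proof -
  have ex: "\<exists>k\<in>S. c \<le> real k" for c :: real
  proof -
    obtain k where "k \<in> S" "nat \<lceil>c\<rceil> < k" using assms infinite_nat_iff_unbounded by blast
    then show ?thesis by (intro bexI[of _ k]) linarith+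
  qed
  have "\<exists>n. \<forall>h. (n h \<in> S \<and> T \<le> real (n h)) \<and> T * real (n h) \<le> real (n (Suc h))"
  proof (rule dependent_nat_choice)
    show "\<exists>x. x \<in> S \<and> T \<le> real x" using ex by blast
  next
    fix x h
    obtain k where "k \<in> S" "max T (T * real x) \<le> real k" using ex by blast
    then show "\<exists>y. (y \<in> S \<and> T \<le> real y) \<and> T * real x \<le> real y" by auto
  qed
  then show ?thesis by blast
qed

text \<open>Divided by b^n, the condition says that (a/b)^n exceeds some integer y by a positive
  amount of at most \<rho>^n.\<close>

theorem mahler_fractional_part:
  fixes a b :: int and \<rho> :: real
  assumes ab: "0 < b" "b < a" "coprime a b" and \<rho>: "0 < \<rho>" "\<rho> < 1"
  shows "finite {n. \<exists>y. 0 < a ^ n - y * b ^ n \<and> real_of_int (a ^ n - y * b ^ n) \<le> (\<rho> * b) ^ n}"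
proof (rule ccontr)
  define S where "S = {n. \<exists>y. 0 < a ^ n - y * b ^ n \<and> real_of_int (a ^ n - y * b ^ n) \<le> (\<rho> * b) ^ n}"
  assume "infinite {n. \<exists>y. 0 < a ^ n - y * b ^ n \<and> real_of_int (a ^ n - y * b ^ n) \<le> (\<rho> * b) ^ n}"
  then have inf: "infinite S" by (simp add: S_def)
  define R where "R = \<rho> * b"
  have R0: "0 < R" using ab \<rho> by (simp add: R_def)
  have "R < 1 * real_of_int b" unfolding R_def using ab \<rho> by (intro mult_strict_right_mono) auto
  then have Ra: "R < a" using ab by linarith
  \<comment> \<open>Otherwise a positive integer would be smaller than 1.\<close>
  have R1: "1 \<le> R"
  proof (rule ccontr)
    assume "\<not> 1 \<le> R"
    obtain k where "k \<in> S" "0 < k" using inf infinite_nat_iff_unbounded by blast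
    then obtain y where "0 < a ^ k - y * b ^ k" "real_of_int (a ^ k - y * b ^ k) \<le> R ^ k"
      by (auto simp: S_def R_def)
    moreover have "R ^ k < 1" using \<open>\<not> 1 \<le> R\<close> R0 \<open>0 < k\<close> by (simp add: power_less_one_iff)
    ultimately show False by linarith
  qed
  have la: "0 < ln (real_of_int a)" using ab by (simp add: ln_gt_zero)
  define L where "L = ln (1 / \<rho>)"
  have L: "0 < L" using \<rho> by (simp add: L_def ln_gt_zero)
  \<comment> \<open>The gain S0 L is 2 N (N - 1) D L. This choice makes it at least 8 N D ln a,
    while the losses stay below (5 N + 1) D ln a.\<close>
  obtain N0 :: nat where N0: "4 * ln a / L < real N0" using reals_Archimedean2 by blast
  define N where "N = N0 + 1"
  have N: "0 < N" "4 * ln a \<le> (real N - 1) * L" using N0 L by (auto simp: N_def field_simps)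
  define m where "m = 4 * N\<^sup>2"
  have m0: "0 < m" using N by (simp add: m_def)
  \<comment> \<open>Reduction to lowest terms divides the numerator a^n by a gcd of at most R^n, so
    a / R is the base for the height.\<close>
  define b0 where "b0 = a / R"
  have b0: "1 < b0" using Ra R0 by (simp add: b0_def)
  have C: "(1::real) \<le> 8 ^ m" by simp
  obtain T0 where T0: "1 \<le> T0" "\<And>n p q P D. roth_hyp T0 b0 (8 ^ m) m n p q P D \<Longrightarrow> roth_concl 1 m n p q P D"
    using roth_lemma[OF _ _ b0 C, of 1 m] by auto
  \<comment> \<open>The exponent of 32 will be at most m D / n 0; with m = 4 N^2 the second
    threshold keeps the cost of that factor below N D ln a.\<close>
  define T where "T = max T0 (4 * N * ln 32 / ln a + 1)"
  obtain n where nS: "\<And>h. n h \<in> S" and nT: "\<And>h. T \<le> real (n h)" and nstep: "\<And>h. T * real (n h) \<le> real (n (Suc h))"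
    using infinite_subsequence[OF inf, of T] by blast
  have T01: "T0 \<le> T" by (simp add: T_def)
  have n_pos: "0 < n h" for h using nT[of h] T01 T0(1) by linarith
  obtain y0 where y0: "\<And>h. 0 < a ^ n h - y0 h * b ^ n h \<and> real_of_int (a ^ n h - y0 h * b ^ n h) \<le> R ^ n h"
    using nS unfolding S_def R_def mem_Collect_eq by metis
  \<comment> \<open>A common multiple of the weights, so that every variable reaches weight exactly
    \<open>D\<close> in the box.\<close>
  define D where "D = (\<Prod>h<m. n h)"
  define d where "d h = D div n h" for h
  have D0: "0 < D" using n_pos by (simp add: D_def)
  have nd: "n h * d h = D" if "h < m" for h
  proof -
    have "n h dvd D" unfolding D_def by (rule dvd_prodI) (use that in auto)
    then show ?thesis by (simp add: d_def)
  qed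
  define S0 where "S0 = 2 * N * (N - 1) * D"
  obtain P where P: "P \<noteq> 0" "int_coeffs P" "keys P \<subseteq> box m d" "l1 P \<le> 8 ^ (\<Sum>h<m. d h)"
    "\<And>e. e \<in> keys P \<Longrightarrow> S0 \<le> wt n m e \<and> wt n m e + S0 \<le> m * D"
    "\<And>j. j \<in> keys (shift (\<lambda>_. 1) m P) \<Longrightarrow> S0 \<le> wt n m j"
    using auxiliary_polynomial[of m n d D N S0] nd N(1) D0 by (auto simp: m_def S0_def)
  define x where "x h = a ^ n h" for h
  define y where "y h = y0 h * b ^ n h" for h
  have y_pos: "0 < y h" for h
  proof -
    have "real_of_int (x h - y h) < real_of_int a ^ n h"
      using y0[of h] power_strict_mono[OF Ra, of "n h"] R0 n_pos[of h] unfolding x_def y_def by linarith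
    then show ?thesis by (simp add: x_def)
  qed
  have xy: "0 < x h - y h" "real_of_int (x h - y h) \<le> R ^ n h" for h using y0[of h] by (auto simp: x_def y_def)
  define p where "p h = x h div gcd (x h) (y h)" for h
  define q where "q h = y h div gcd (x h) (y h)" for h
  have g0: "0 < gcd (x h) (y h)" for h using y_pos[of h] by (simp add: gcd_pos_int)
  have pq: "x h = p h * gcd (x h) (y h)" "y h = q h * gcd (x h) (y h)" for h by (simp_all add: p_def q_def)
  have q0: "q h \<noteq> 0" for h using pq(2)[of h] y_pos[of h] by auto
  have ratio: "real_of_int (p h) / real_of_int (q h) = real_of_int (x h) / real_of_int (y h)" for h
  proof -
    have "real_of_int (x h) / real_of_int (y h)
        = (real_of_int (p h) * real_of_int (gcd (x h) (y h))) / (real_of_int (q h) * real_of_int (gcd (x h) (y h)))"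
      using pq[of h] by (metis of_int_mult)
    also have "\<dots> = real_of_int (p h) / real_of_int (q h)"
      using g0[of h] by (intro mult_divide_mult_cancel_right) simp
    finally show ?thesis by simp
  qed
  have cop: "coprime (p h) (q h)" for h
    unfolding p_def q_def using y_pos[of h] by (intro div_gcd_coprime) auto
  have p_large: "b0 ^ n h \<le> \<bar>real_of_int (p h)\<bar>" for h
  proof -
    have "gcd (x h) (y h) dvd x h - y h" by (intro dvd_diff) auto
    then have "gcd (x h) (y h) \<le> x h - y h" using xy(1) by (rule zdvd_imp_le)
    then have g: "real_of_int (gcd (x h) (y h)) \<le> R ^ n h" using xy(2)[of h] by linarith
    have "0 < p h * gcd (x h) (y h)" using pq(1)[of h] y_pos[of h] xy(1)[of h] by linarith
    then have p_pos: "0 < p h" using g0[of h] by (simp add: zero_less_mult_iff)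
    have "real_of_int a ^ n h = real_of_int (p h) * real_of_int (gcd (x h) (y h))"
      using pq(1)[of h] unfolding x_def by (metis of_int_mult of_int_power)
    also have "\<dots> \<le> real_of_int (p h) * R ^ n h" using g p_pos by (intro mult_left_mono) auto
    finally show ?thesis using R0 p_pos by (simp add: b0_def power_divide divide_le_eq)
  qed
  have nmono: "n 0 \<le> n h" if "h < m" for h
    using weights_mono[of "Suc m" T n 0 h] nstep T01 T0(1) that by auto
  have dsum: "real (\<Sum>h<m. d h) \<le> real m * (real D / real (n 0))"
  proof -
    have "real (d h) \<le> real D / real (n 0)" if "h < m" for h
    proof -
      have "n 0 * d h \<le> D" using mult_right_mono[OF nmono[OF that], of "d h"] nd[OF that] by simp
      then have "real (n 0) * real (d h) \<le> real D" by (metis of_nat_le_iff of_nat_mult)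
      then show ?thesis using n_pos[of 0] by (simp add: field_simps)
    qed
    then have "(\<Sum>h<m. real (d h)) \<le> (\<Sum>h<m. real D / real (n 0))" by (intro sum_mono) auto
    then show ?thesis by simp
  qed
  have "l1 P \<le> 8 powr real (\<Sum>h<m. d h)" using P(4) by (subst powr_realpow) auto
  also have "\<dots> \<le> 8 powr (real m * (real D / real (n 0)))" using dsum by (intro powr_mono) auto
  also have "\<dots> = (8 ^ m) powr (real D / real (n 0))"
    by (simp add: powr_powr flip: powr_realpow)
  finally have l1P: "l1 P \<le> (8 ^ m) powr (real D / real (n 0))" .
  have "roth_hyp T b0 (8 ^ m) m n p q P D"
    unfolding roth_hyp_def
  proof (intro conjI allI impI ballI)
    fix h e assume "h < m" "e \<in> keys P"
    then have "n h * lookup e h \<le> n h * d h" using P(3) by (intro mult_left_mono) (auto simp: box_def)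
    then show "n h * lookup e h \<le> D" using nd \<open>h < m\<close> by simp
  qed (use nT nstep cop q0 p_large P l1P D0 in \<open>auto simp: vars_in_def box_def\<close>)
  from T0(2)[OF roth_hyp_mono[OF this T01]]
  obtain J where J: "J \<in> keys (shift (\<lambda>h. real_of_int (x h) / real_of_int (y h)) m P)" "wt n m J \<le> D"
    unfolding roth_concl_def ratio by auto
  let ?G = "\<bar>(\<Prod>h<m. real_of_int (y h) ^ (d h - lookup J h)) *
    lookup (shift (\<lambda>h. real_of_int (x h) / real_of_int (y h)) m P) J\<bar>"
  have "real_of_int a ^ (S0 - D) * real_of_int b ^ S0 \<le> ?G"
    using value_lower_bound[of m n d D P S0 y0 a b J] nd P(2,3,5) J ab y_pos
    unfolding x_def y_def by (metis (no_types, lifting) mult_zero_left less_irrefl order.strict_trans)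
  also have "?G \<le> 4 ^ (\<Sum>h<m. d h) * l1 P * (real_of_int a ^ (m * D - S0) * R ^ S0)"
  proof (rule value_upper_bound[OF nd P(3) P(6) _ R1])
    fix h
    show "0 < real_of_int (y h) \<and> real_of_int (y h) \<le> real_of_int a ^ n h \<and>
        0 \<le> real_of_int (x h) - real_of_int (y h) \<and> real_of_int (x h) - real_of_int (y h) \<le> R ^ n h"
      using y_pos[of h] xy[of h] by (auto simp: x_def simp flip: of_int_power)
  next
    show "keys J \<subseteq> {..<m}" using J(1) vars_in_shift by (auto simp: vars_in_def)
    show "lookup J h \<le> d h" if "h < m" for h
      using keys_shift_le[OF J(1)] P(3) that by (auto simp: box_def intro: order.trans)
  qed (use Ra in auto)
  also have "\<dots> \<le> 4 ^ (\<Sum>h<m. d h) * 8 ^ (\<Sum>h<m. d h) * (real_of_int a ^ (m * D - S0) * R ^ S0)"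
    using P(4) R0 ab by (intro mult_right_mono mult_left_mono) auto
  also have "\<dots> = 32 ^ (\<Sum>h<m. d h) * (real_of_int a ^ (m * D - S0) * R ^ S0)"
    by (simp flip: power_mult_distrib)
  also have "R ^ S0 = \<rho> ^ S0 * real_of_int b ^ S0" by (simp add: R_def power_mult_distrib)
  finally have "real_of_int a ^ (S0 - D) * real_of_int b ^ S0
      \<le> (32 ^ (\<Sum>h<m. d h) * (real_of_int a ^ (m * D - S0) * \<rho> ^ S0)) * real_of_int b ^ S0"
    by (simp add: mult_ac)
  then have "real_of_int a ^ (S0 - D) \<le> 32 ^ (\<Sum>h<m. d h) * (real_of_int a ^ (m * D - S0) * \<rho> ^ S0)"
    using ab by (simp del: of_int_power)
  moreover have "0 < real_of_int a ^ (S0 - D)" using ab by simp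
  ultimately have "ln (real_of_int a ^ (S0 - D)) \<le> ln (32 ^ (\<Sum>h<m. d h) * (real_of_int a ^ (m * D - S0) * \<rho> ^ S0))"
    by simp
  also have "\<dots> = real (\<Sum>h<m. d h) * ln 32 + (real (m * D - S0) * ln a + real S0 * ln \<rho>)"
    using ab \<rho> by (simp add: ln_mult ln_realpow)
  also have "ln \<rho> = - L" using \<rho> by (simp add: L_def ln_div)
  finally have "real (S0 - D) * ln a \<le> real (\<Sum>h<m. d h) * ln 32 + (real (m * D - S0) * ln a - real S0 * L)"
    by (simp add: ln_realpow)
  moreover have "real S0 - real D \<le> real (S0 - D)" by linarith
  then have "(real S0 - real D) * ln a \<le> real (S0 - D) * ln a" using la by (intro mult_right_mono) auto
  moreover have "real (\<Sum>h<m. d h) * ln 32 \<le> real m * (real D / real (n 0)) * ln 32"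
    using dsum by (intro mult_right_mono) auto
  moreover have "real m * (real D / real (n 0)) * ln 32 < real N * real D * ln a"
  proof -
    have "4 * N * ln 32 / ln a < real (n 0)" using nT[of 0] unfolding T_def by simp
    then have "4 * N * ln 32 < ln a * real (n 0)" using la by (simp add: field_simps)
    then have "(4 * N * ln 32) * (real N * real D) < (ln a * real (n 0)) * (real N * real D)"
      using N D0 by (intro mult_strict_right_mono) auto
    then show ?thesis using n_pos[of 0] by (simp add: m_def field_simps power2_eq_square)
  qed
  moreover have S0_eq: "real S0 = 2 * real N * (real N - 1) * real D"
    using N(1) by (simp add: S0_def of_nat_diff)
  moreover have "real (m * D - S0) * ln a = 2 * (real N * real N * real D * ln a) + 2 * (real N * real D * ln a)"
  proof -
    have "2 * N * (N - 1) \<le> 2 * N * N" by (intro mult_left_mono) auto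
    also have "\<dots> \<le> m" by (simp add: m_def power2_eq_square)
    finally have "S0 \<le> m * D" unfolding S0_def by (rule mult_right_mono) simp
    then have "real (m * D - S0) = 4 * (real N)\<^sup>2 * real D - real S0" by (simp add: m_def of_nat_diff)
    then show ?thesis unfolding S0_eq by (simp add: algebra_simps power2_eq_square)
  qed
  moreover have "(real S0 - real D) * ln a
      = 2 * (real N * real N * real D * ln a) - 2 * (real N * real D * ln a) - real D * ln a"
    unfolding S0_eq by (simp add: algebra_simps)
  moreover have "8 * (real N * real D * ln a) \<le> real S0 * L"
  proof -
    have "2 * real N * real D * (4 * ln a) \<le> 2 * real N * real D * ((real N - 1) * L)"
      using N(2) by (intro mult_left_mono) auto
    then show ?thesis unfolding S0_eq by (simp add: mult_ac)
  qed
  moreover have "real D * ln a \<le> real N * real D * ln a"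
    using N(1) D0 la by simp
  moreover have "0 < real N * real D * ln a" using N(1) D0 la by simp
  ultimately show False by linarith
qed

section \<open>Estimates for the zeta function\<close>

text \<open>For x \<ge> k, 1 / x^n is at most k^2 / k^n times 1 / x^2, hence at most that constant
  times 1 / (x - 1) - 1 / x, and this telescopes.\<close>

lemma zeta_bounds:
  assumes "2 \<le> n" "2 \<le> k"
  shows "(\<Sum>j=1..<k. 1 / real j ^ n) \<le> riemann_zeta (real n)"
    and "riemann_zeta (real n) \<le> (\<Sum>j=1..<k. 1 / real j ^ n) + (real k)\<^sup>2 / ((real k - 1) * real k ^ n)"
proof -
  define f where "f m = 1 / real (Suc m) ^ n" for m
  define c where "c = (real k)\<^sup>2 / real k ^ n"
  define g where "g m = c * (1 / (real m + real k - 1))" for m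
  have f: "real (Suc m) powr - real n = f m" for m
    by (simp add: f_def powr_minus powr_realpow inverse_eq_divide del: of_nat_Suc)
  \<comment> \<open>The series is indexed from 0, so \<open>f (m + (k - 1))\<close> is the term 1 /
    (m + k)^n and the tail starts at k.\<close>
  have bound: "f (m + (k - 1)) \<le> g m - g (Suc m)" for m
  proof -
    let ?x = "real m + real k"
    have x: "1 < ?x" "real k \<le> ?x" "0 < real k" using assms by auto
    have n: "n = 2 + (n - 2)" using assms by simp
    have "f (m + (k - 1)) = 1 / ?x ^ n" using assms by (simp add: f_def add.commute)
    also have "\<dots> = 1 / (?x\<^sup>2 * ?x ^ (n - 2))" by (subst n, subst power_add) simp
    also have "\<dots> \<le> 1 / (?x\<^sup>2 * real k ^ (n - 2))"
      using x by (intro divide_left_mono mult_left_mono power_mono mult_pos_pos zero_less_power) auto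
    also have "\<dots> = c * (1 / ?x\<^sup>2)"
    proof -
      have "real k ^ n = (real k)\<^sup>2 * real k ^ (n - 2)" by (subst n, subst power_add) simp
      then show ?thesis using x by (simp add: c_def)
    qed
    also have "\<dots> \<le> c * (1 / (?x - 1) - 1 / ?x)"
    proof (rule mult_left_mono)
      have "1 / ?x\<^sup>2 \<le> 1 / ((?x - 1) * ?x)"
        using x by (intro divide_left_mono) (auto simp: power2_eq_square)
      also have "\<dots> = 1 / (?x - 1) - 1 / ?x" using x by (simp add: field_simps)
      finally show "1 / ?x\<^sup>2 \<le> 1 / (?x - 1) - 1 / ?x" .
    qed (simp add: c_def)
    also have "\<dots> = g m - g (Suc m)" by (simp add: g_def right_diff_distrib)
    finally show ?thesis .
  qed
  have f0: "0 \<le> f m" for m by (simp add: f_def)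
  have "g \<longlonglongrightarrow> 0" unfolding g_def by real_asymp
  then have tel: "(\<lambda>m. g m - g (Suc m)) sums (g 0 - 0)" by (rule telescope_sums')
  have sum_tail: "summable (\<lambda>m. f (m + (k - 1)))"
    by (rule summable_comparison_test'[OF sums_summable[OF tel], of 0]) (use bound f0 in auto)
  then have summ: "summable f" by (simp only: summable_iff_shift)
  have "suminf (\<lambda>m. f (m + (k - 1))) \<le> suminf (\<lambda>m. g m - g (Suc m))"
    by (rule suminf_le[OF bound sum_tail sums_summable[OF tel]])
  also have "\<dots> = g 0" using sums_unique[OF tel] by simp
  finally have up: "suminf (\<lambda>m. f (m + (k - 1))) \<le> g 0" .
  have lo: "0 \<le> suminf (\<lambda>m. f (m + (k - 1)))" by (rule suminf_nonneg[OF sum_tail]) (rule f0)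
  have head: "(\<Sum>m<k - 1. f m) = (\<Sum>j=1..<k. 1 / real j ^ n)"
    by (rule sum.reindex_bij_witness[of _ "\<lambda>j. j - 1" Suc]) (auto simp: f_def)
  have zeta: "riemann_zeta (real n) = suminf (\<lambda>m. f (m + (k - 1))) + (\<Sum>j=1..<k. 1 / real j ^ n)"
    unfolding riemann_zeta_def f head[symmetric] by (rule suminf_split_initial_segment[OF summ])
  show "(\<Sum>j=1..<k. 1 / real j ^ n) \<le> riemann_zeta (real n)" using zeta lo by simp
  show "riemann_zeta (real n) \<le> (\<Sum>j=1..<k. 1 / real j ^ n) + (real k)\<^sup>2 / ((real k - 1) * real k ^ n)"
    using zeta up by (simp add: g_def c_def mult.commute)
qed

text \<open>From 2^n / (1 + x) = 2^n - 2^n x + 2^n x^2 / (1 + x), where 2^n x = (4/3)^n + 1 + 4^n t.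
  So \<delta> is the quadratic term, of order (8/9)^n, minus 4^n t, of order (4/5)^n; from n = 7 on
  the first dominates by the numerical estimates below.\<close>

lemma zeta_reciprocal_expansion:
  assumes n: "7 \<le> n"
  shows "\<exists>\<delta>. 1 / (riemann_zeta (real n) - 1) = 2 ^ n - 1 - (4 / 3) ^ n + \<delta> \<and> 0 \<le> \<delta> \<and> \<delta> \<le> 2 * (8 / 9) ^ n \<and> \<delta> < 1"
proof -
  define t where "t = riemann_zeta (real n) - 1 - 1 / 2 ^ n - 1 / 3 ^ n - 1 / 4 ^ n"
  define x where "x = (2 / 3) ^ n + (1 / 2) ^ n + 2 ^ n * t"
  have n2: "2 \<le> n" using n by simp
  have s5: "(\<Sum>j=1..<5. 1 / real j ^ n) = 1 + 1 / 2 ^ n + 1 / 3 ^ n + 1 / 4 ^ n"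
    by (simp add: numeral_eq_Suc)
  have s9: "(\<Sum>j=1..<9. 1 / real j ^ n) = 1 + 1 / 2 ^ n + 1 / 3 ^ n + 1 / 4 ^ n + 1 / 5 ^ n + 1 / 6 ^ n + 1 / 7 ^ n + 1 / 8 ^ n"
    by (simp add: numeral_eq_Suc)
  have t0: "0 \<le> t" using zeta_bounds(1)[OF n2, of 5] s5 by (simp add: t_def)
  \<comment> \<open>The cruder of two bounds: a tail from 5 suffices for the size of
    \<open>x\<close>, while the sign of \<delta> is decided with the tail from 9.\<close>
  have t5: "t \<le> (25 / 4) / 5 ^ n" using zeta_bounds(2)[OF n2, of 5] s5 by (simp add: t_def)
  have t9: "t \<le> 1 / 5 ^ n + 1 / 6 ^ n + 1 / 7 ^ n + 1 / 8 ^ n + (81 / 8) / 9 ^ n"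
    using zeta_bounds(2)[OF n2, of 9] s9 by (simp add: t_def)
  have dec: "q ^ n \<le> q ^ 7" if "0 \<le> q" "q \<le> 1" for q :: real
    using n that by (intro power_decreasing) auto
  have x0: "0 \<le> x" using t0 by (simp add: x_def)
  have Z: "riemann_zeta (real n) - 1 = (1 + x) / 2 ^ n"
    by (simp add: x_def t_def field_simps flip: power_mult_distrib)
  have X: "2 ^ n * x = (4 / 3) ^ n + 1 + 4 ^ n * t"
    by (simp add: x_def distrib_left mult.assoc[symmetric] flip: power_mult_distrib)
  define \<delta> where "\<delta> = 2 ^ n * x\<^sup>2 / (1 + x) - 4 ^ n * t"
  have "1 / (riemann_zeta (real n) - 1) = 2 ^ n - 2 ^ n * x + 2 ^ n * x\<^sup>2 / (1 + x)"
    unfolding Z using x0 by (simp add: field_simps power2_eq_square)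
  then have eq: "1 / (riemann_zeta (real n) - 1) = 2 ^ n - 1 - (4 / 3) ^ n + \<delta>"
    by (simp add: X \<delta>_def)
  have x_le: "x \<le> 7 / 5 * (2 / 3) ^ n"
  proof -
    have "2 ^ n * t \<le> 2 ^ n * ((25 / 4) / 5 ^ n)" using t5 by (intro mult_left_mono) auto
    then have "x \<le> (2 / 3) ^ n + (1 / 2) ^ n + 25 / 4 * (2 / 5) ^ n" by (simp add: x_def power_divide)
    also have "\<dots> = (2 / 3) ^ n * (1 + (3 / 4) ^ n + 25 / 4 * (3 / 5) ^ n)"
      by (simp add: distrib_left mult.left_commute flip: power_mult_distrib)
    also have "\<dots> \<le> (2 / 3) ^ n * (7 / 5)"
    proof (rule mult_left_mono)
      show "1 + (3 / 4) ^ n + 25 / 4 * (3 / 5) ^ n \<le> (7 / 5 :: real)"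
      proof -
        have "(3 / 4 :: real) ^ 7 \<le> 14 / 100" "(3 / 5 :: real) ^ 7 \<le> 3 / 100" by (simp_all add: power_divide)
        then show ?thesis using dec[of "3 / 4"] dec[of "3 / 5"] by linarith
      qed
    qed simp
    finally show ?thesis by simp
  qed
  have "\<delta> \<le> 2 ^ n * x\<^sup>2 / (1 + x)" using t0 by (simp add: \<delta>_def)
  also have "\<dots> \<le> 2 ^ n * x\<^sup>2 / 1" using x0 by (intro divide_left_mono) auto
  also have "\<dots> \<le> 2 ^ n * (7 / 5 * (2 / 3) ^ n)\<^sup>2" using x_le x0 by (simp add: power_mono)
  also have "\<dots> = 49 / 25 * (8 / 9) ^ n"
    by (simp add: power_mult_distrib power2_eq_square mult.left_commute flip: power_mult_distrib)
  finally have \<delta>_le: "\<delta> \<le> 49 / 25 * (8 / 9) ^ n" .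
  have "4 ^ n * t * (1 + x) \<le> 2 ^ n * x\<^sup>2"
  proof -
    have "4 ^ n * t \<le> 4 ^ n * (1 / 5 ^ n + 1 / 6 ^ n + 1 / 7 ^ n + 1 / 8 ^ n + (81 / 8) / 9 ^ n)"
      using t9 by (intro mult_left_mono) auto
    \<comment> \<open>The factor (8/9)^n is taken out because it is the order of the quadratic term,
      with which \<open>t\<close> is compared.\<close>
    also have "\<dots> = (8 / 9) ^ n * ((9 / 10) ^ n + (3 / 4) ^ n + (9 / 14) ^ n + (9 / 16) ^ n + 81 / 8 * (1 / 2) ^ n)"
    proof -
      have p: "(a / b) ^ n = a ^ n * (1 / b ^ n)" for a b :: real by (simp add: power_divide)
      have "(8 / 9) ^ n * q ^ n = 4 ^ n * (1 / r ^ n)" if "8 / 9 * q = 4 / r" for q r :: real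
        using that by (metis p power_mult_distrib)
      from this[of "9 / 10" 5] this[of "3 / 4" 6] this[of "9 / 14" 7] this[of "9 / 16" 8] this[of "1 / 2" 9]
      show ?thesis by (simp add: distrib_left)
    qed
    also have "\<dots> \<le> (8 / 9) ^ n * 1"
    proof (rule mult_left_mono)
      show "(9 / 10) ^ n + (3 / 4) ^ n + (9 / 14) ^ n + (9 / 16) ^ n + 81 / 8 * (1 / 2) ^ n \<le> (1 :: real)"
      proof -
        have "(9 / 10 :: real) ^ 7 \<le> 48 / 100" "(3 / 4 :: real) ^ 7 \<le> 14 / 100" "(9 / 14 :: real) ^ 7 \<le> 5 / 100"
          "(9 / 16 :: real) ^ 7 \<le> 2 / 100" "(1 / 2 :: real) ^ 7 \<le> 1 / 100"
          by (simp_all add: power_divide)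
        then show ?thesis
          using dec[of "9 / 10"] dec[of "3 / 4"] dec[of "9 / 14"] dec[of "9 / 16"] dec[of "1 / 2"]
          by linarith
      qed
    qed simp
    finally have "4 ^ n * t * (1 + x) \<le> (8 / 9) ^ n * (1 + 2 * (3 / 4) ^ n)"
    proof (intro mult_mono)
      have "(2 / 3) ^ n \<le> (3 / 4 :: real) ^ n" by (intro power_mono) auto
      moreover have "0 \<le> (3 / 4 :: real) ^ n" by simp
      ultimately show "1 + x \<le> 1 + 2 * (3 / 4) ^ n" using x_le by linarith
    qed (use x0 in auto)
    \<comment> \<open>Expanding the square gives (8/9)^n + 2 (2/3)^n + (1/2)^n, whose first two
      terms are exactly the left-hand side.\<close>
    also have "\<dots> \<le> 2 ^ n * ((2 / 3) ^ n + (1 / 2) ^ n)\<^sup>2"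
    proof -
      have "2 ^ n * ((2 / 3) ^ n + (1 / 2) ^ n)\<^sup>2
          = (2 * (2 / 3) * (2 / 3)) ^ n + 2 * (2 * (2 / 3) * (1 / 2)) ^ n + (2 * (1 / 2) * (1 / 2) :: real) ^ n"
        unfolding power_mult_distrib by (simp add: power2_eq_square algebra_simps)
      moreover have "(8 / 9) ^ n * (1 + 2 * (3 / 4) ^ n) = (8 / 9) ^ n + 2 * (2 / 3 :: real) ^ n"
        by (simp add: distrib_left mult.left_commute flip: power_mult_distrib)
      ultimately show ?thesis by simp
    qed
    also have "\<dots> \<le> 2 ^ n * x\<^sup>2"
      using t0 by (intro mult_left_mono power_mono) (auto simp: x_def)
    finally show ?thesis .
  qed
  then have "0 \<le> \<delta>" using x0 by (simp add: \<delta>_def field_simps)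
  moreover have "\<delta> \<le> 2 * (8 / 9) ^ n" using \<delta>_le by (rule order.trans) simp
  moreover have "(8 / 9 :: real) ^ 7 \<le> 45 / 100" by (simp add: power_divide)
  then have "\<delta> < 1" using \<delta>_le dec[of "8 / 9"] by linarith
  ultimately show ?thesis using eq by blast
qed

text \<open>With r = 2^n minus the floor of (4/3)^n, the claim is r - 2 \<le> 1 / (\<zeta>(n) - 1) <
  r; for these n, r is 3, 6, 13, 28, 59 and partial sums with a tail estimate decide it.\<close>

lemma zeta_reciprocal_small:
  assumes "n \<in> {2, 3, 4, 5, 6}"
  shows "2 ^ n - \<lfloor>(4 / 3 :: real) ^ n\<rfloor> - \<lfloor>1 / (riemann_zeta (real n) - 1)\<rfloor> \<in> {1, 2}"
proof -
  have fl: "r - \<lfloor>1 / z\<rfloor> \<in> {1, 2}" if "0 < z" "z * c \<le> 1" "1 < z * d" "c = real_of_int r - 2" "d = real_of_int r" for z c d :: real and r :: int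
  proof -
    have "real_of_int r - 2 \<le> 1 / z" "1 / z < real_of_int r" using that by (auto simp: field_simps)
    then have "r - 2 \<le> \<lfloor>1 / z\<rfloor>" "\<lfloor>1 / z\<rfloor> < r" by (auto simp: le_floor_iff floor_less_iff)
    then show ?thesis by auto
  qed
  have s: "(\<Sum>j=1..<2. 1 / real j ^ n) = 1" "(\<Sum>j=1..<4. 1 / real j ^ n) = 1 + 1 / 2 ^ n + 1 / 3 ^ n"
    "(\<Sum>j=1..<5. 1 / real j ^ n) = 1 + 1 / 2 ^ n + 1 / 3 ^ n + 1 / 4 ^ n"
    "(\<Sum>j=1..<6. 1 / real j ^ n) = 1 + 1 / 2 ^ n + 1 / 3 ^ n + 1 / 4 ^ n + 1 / 5 ^ n" for n
    by (simp_all add: numeral_eq_Suc)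
  have "\<lfloor>(4 / 3 :: real) ^ 2\<rfloor> = 1" "\<lfloor>(4 / 3 :: real) ^ 3\<rfloor> = 2" "\<lfloor>(4 / 3 :: real) ^ 4\<rfloor> = 3"
    "\<lfloor>(4 / 3 :: real) ^ 5\<rfloor> = 4" "\<lfloor>(4 / 3 :: real) ^ 6\<rfloor> = 5"
    by (auto simp: floor_eq_iff power_divide)
  moreover have "(3::int) - \<lfloor>1 / (riemann_zeta (real 2) - 1)\<rfloor> \<in> {1, 2}"
  proof -
    have "1 + 1 / 4 + 1 / 9 \<le> riemann_zeta (real 2)" "riemann_zeta (real 2) \<le> 1 + 1"
      using zeta_bounds(1)[of 2 4] zeta_bounds(2)[of 2 2] unfolding s by simp_all
    then show ?thesis by (intro fl[of _ 1 3]) (linarith | simp)+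
  qed
  moreover have "(6::int) - \<lfloor>1 / (riemann_zeta (real 3) - 1)\<rfloor> \<in> {1, 2}"
  proof -
    have "1 + 1 / 8 + 1 / 27 + 1 / 64 \<le> riemann_zeta (real 3)" "riemann_zeta (real 3) \<le> 1 + 1 / 8 + 1 / 27 + 1 / 12"
      using zeta_bounds(1)[of 3 5] zeta_bounds(2)[of 3 4] unfolding s by simp_all
    then show ?thesis by (intro fl[of _ 4 6]) (linarith | simp)+
  qed
  moreover have "(13::int) - \<lfloor>1 / (riemann_zeta (real 4) - 1)\<rfloor> \<in> {1, 2}"
  proof -
    have "1 + 1 / 16 + 1 / 81 + 1 / 256 \<le> riemann_zeta (real 4)"
      "riemann_zeta (real 4) \<le> 1 + 1 / 16 + 1 / 81 + 1 / 256 + 1 / 100"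
      using zeta_bounds(1)[of 4 5] zeta_bounds(2)[of 4 5] unfolding s by simp_all
    then show ?thesis by (intro fl[of _ 11 13]) (linarith | simp)+
  qed
  moreover have "(28::int) - \<lfloor>1 / (riemann_zeta (real 5) - 1)\<rfloor> \<in> {1, 2}"
  proof -
    have "1 + 1 / 32 + 1 / 243 + 1 / 1024 \<le> riemann_zeta (real 5)"
      "riemann_zeta (real 5) \<le> 1 + 1 / 32 + 1 / 243 + 1 / 1024 + 1 / 500"
      using zeta_bounds(1)[of 5 5] zeta_bounds(2)[of 5 5] unfolding s by simp_all
    then show ?thesis by (intro fl[of _ 26 28]) (linarith | simp)+
  qed
  \<comment> \<open>A tail from 5 would give an upper bound for \<zeta>(6) - 1 above 1/57, so the
    term at 5 is kept exactly.\<close>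
  moreover have "(59::int) - \<lfloor>1 / (riemann_zeta (real 6) - 1)\<rfloor> \<in> {1, 2}"
  proof -
    have "1 + 1 / 64 + 1 / 729 + 1 / 4096 \<le> riemann_zeta (real 6)"
      "riemann_zeta (real 6) \<le> 1 + 1 / 64 + 1 / 729 + 1 / 4096 + 1 / 15625 + 1 / 6480"
      using zeta_bounds(1)[of 6 5] zeta_bounds(2)[of 6 6] unfolding s by simp_all
    then show ?thesis by (intro fl[of _ 57 59]) (linarith | simp)+
  qed
  ultimately show ?thesis using assms by auto
qed

text \<open>With \<phi> the fractional part of (4/3)^n, k is 1 minus the floor of \<delta> - \<phi>.
  This difference lies strictly between -1 and 1, and k = 1 means \<phi> \<le> \<delta>.\<close>

lemma zeta_reciprocal_large:
  assumes "7 \<le> n" "\<lfloor>1 / (riemann_zeta (real n) - 1)\<rfloor> = 2 ^ n - \<lfloor>(4 / 3 :: real) ^ n\<rfloor> - k"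
  shows "k \<in> {1, 2}" and "k = 1 \<Longrightarrow> (4 / 3) ^ n - real_of_int \<lfloor>(4 / 3 :: real) ^ n\<rfloor> \<le> 2 * (8 / 9) ^ n"
proof -
  obtain \<delta> where \<delta>: "1 / (riemann_zeta (real n) - 1) = 2 ^ n - 1 - (4 / 3) ^ n + \<delta>" "0 \<le> \<delta>" "\<delta> \<le> 2 * (8 / 9) ^ n" "\<delta> < 1"
    using zeta_reciprocal_expansion[OF assms(1)] by blast
  let ?f = "\<lfloor>(4 / 3 :: real) ^ n\<rfloor>"
  have f: "real_of_int ?f \<le> (4 / 3) ^ n" "(4 / 3) ^ n < real_of_int ?f + 1" by linarith+
  have "real_of_int (2 ^ n - ?f - k) \<le> 2 ^ n - 1 - (4 / 3) ^ n + \<delta>"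
    "2 ^ n - 1 - (4 / 3) ^ n + \<delta> < real_of_int (2 ^ n - ?f - k) + 1"
    unfolding assms(2)[symmetric] \<delta>(1) by linarith+
  moreover have "real_of_int (2 ^ n - ?f - k) = 2 ^ n - real_of_int ?f - real_of_int k" by simp
  ultimately have z: "2 ^ n - real_of_int ?f - real_of_int k \<le> 2 ^ n - 1 - (4 / 3) ^ n + \<delta>"
    "2 ^ n - 1 - (4 / 3) ^ n + \<delta> < 2 ^ n - real_of_int ?f - real_of_int k + 1" by linarith+
  have "0 < real_of_int k" "real_of_int k < 3" using z f \<delta>(2,4) by linarith+
  then show "k \<in> {1, 2}" by auto
  show "(4 / 3) ^ n - real_of_int ?f \<le> 2 * (8 / 9) ^ n" if "k = 1"
    using z(1) \<delta>(3) that by simp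
qed

theorem theorem1p1:
  fixes k :: "nat \<Rightarrow> int"
  assumes "\<And>n. n \<ge> 2 \<Longrightarrow>
    \<lfloor>1 / (riemann_zeta (real n) - 1)\<rfloor> = 2 ^ n - \<lfloor>(4 / 3 :: real) ^ n\<rfloor> - k n"
  shows "(\<forall>n\<ge>2. k n \<in> {1, 2}) \<and> finite {n. n \<ge> 2 \<and> k n = 1} \<and> finite {n. n \<ge> 2 \<and> k n \<noteq> 2}"
proof -
  have range: "k n \<in> {1, 2}" if "n \<ge> 2" for n
  proof (cases "7 \<le> n")
    case True
    then show ?thesis using zeta_reciprocal_large(1) assms[OF that] by blast
  next
    case False
    then have "n \<in> {2, 3, 4, 5, 6}" using that by auto
    from zeta_reciprocal_small[OF this] show ?thesis unfolding assms[OF that] by simp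
  qed
  have cop: "coprime (4::int) 3"
  proof (rule coprimeI)
    fix c :: int assume "c dvd 4" "c dvd 3"
    then have "c dvd 4 - 3" by (rule dvd_diff)
    then show "is_unit c" by simp
  qed
  \<comment> \<open>The base 9/10 lies strictly between the rate 8/9 of \<delta> and 1; the slack
    absorbs the factor 2.\<close>
  define M where "M = {n. \<exists>y. 0 < (4::int) ^ n - y * 3 ^ n \<and> real_of_int (4 ^ n - y * 3 ^ n) \<le> (9 / 10 * real_of_int 3) ^ n}"
  have "finite M"
    unfolding M_def by (rule mahler_fractional_part) (use cop in simp_all)
  moreover have "{n. n \<ge> 2 \<and> k n = 1} \<subseteq> {..<80} \<union> M"
  proof
    fix n assume "n \<in> {n. n \<ge> 2 \<and> k n = 1}"
    then have n: "n \<ge> 2" "k n = 1" by auto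
    show "n \<in> {..<80} \<union> M"
    proof (cases "n < 80")
      case False
      let ?f = "\<lfloor>(4 / 3 :: real) ^ n\<rfloor>"
      have frac: "(4 / 3) ^ n - real_of_int ?f \<le> 2 * (8 / 9) ^ n"
        using zeta_reciprocal_large(2)[OF _ assms[OF n(1)] n(2)] False by simp
      \<comment> \<open>Since (81/80) (8/9) = 9/10, it suffices that (81/80)^n \<ge> 2, which
        Bernoulli's inequality gives for n \<ge> 80.\<close>
      have "1 + real n * (1 / 80) \<le> (1 + 1 / 80) ^ n" by (rule Bernoulli_inequality) simp
      then have "2 * (8 / 9) ^ n \<le> (1 + 1 / 80) ^ n * (8 / 9 :: real) ^ n"
        using False by (intro mult_right_mono) auto
      also have "\<dots> = (9 / 10) ^ n" by (simp flip: power_mult_distrib)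
      finally have le: "((4 / 3) ^ n - real_of_int ?f) * 3 ^ n \<le> (9 / 10) ^ n * 3 ^ n"
        using frac by (intro mult_right_mono) auto
      have eq: "((4 / 3) ^ n - real_of_int ?f) * 3 ^ n = real_of_int (4 ^ n - ?f * 3 ^ n)"
        by (simp add: left_diff_distrib flip: power_mult_distrib)
      have "real_of_int (4 ^ n - ?f * 3 ^ n) \<le> (9 / 10) ^ n * 3 ^ n"
        using le unfolding eq .
      also have "\<dots> = (9 / 10 * real_of_int 3) ^ n" by (simp only: power_mult_distrib of_int_numeral)
      finally have upper: "real_of_int (4 ^ n - ?f * 3 ^ n) \<le> (9 / 10 * real_of_int 3) ^ n" .
      have "0 \<le> ((4 / 3) ^ n - real_of_int ?f) * 3 ^ n" by simp
      then have "0 \<le> 4 ^ n - ?f * 3 ^ n" unfolding eq by (simp only: of_int_0_le_iff)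
      \<comment> \<open>\<open>M\<close> asks for a strictly positive difference; (4/3)^n is never
        an integer for these n.\<close>
      moreover have "4 ^ n - ?f * 3 ^ n \<noteq> 0"
      proof
        assume "4 ^ n - ?f * 3 ^ n = 0"
        then have "(3::int) ^ n dvd 4 ^ n" by simp
        moreover have "coprime ((3::int) ^ n) (4 ^ n)" using cop by (simp add: coprime_commute)
        ultimately have "is_unit ((3::int) ^ n)" by (rule coprime_common_divisor[rotated -1]) simp
        then show False using n(1) by (simp add: is_unit_power_iff)
      qed
      ultimately show ?thesis using upper unfolding M_def by (intro UnI2 CollectI exI[of _ ?f]) auto
    qed simp
  qed
  ultimately have fin: "finite {n. n \<ge> 2 \<and> k n = 1}"
    using finite_subset by blast
  have "{n. n \<ge> 2 \<and> k n \<noteq> 2} = {n. n \<ge> 2 \<and> k n = 1}" using range by force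
  with range fin show ?thesis by auto
qed

end
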